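(* Let $(M,\boldsymbol\eta)$ be a co-oriented $k$-contact manifold, let $\Phi\colon G\times M\to M$ be a $k$-contact Lie group action with $k$-contact momentum map $\mathbf{J}^\Phi_{\boldsymbol\eta}\colon M\to(\mathfrak g^* )^k$, let $\boldsymbol\mu=(\mu^1,\ldots,\mu^k)\in(\mathfrak g^* )^k$ be a weak regular $k$-value of $\mathbf{J}^\Phi_{\boldsymbol\eta}$, and assume that $K_{[\boldsymbol\mu]}$ acts in a quotientable manner on $\mathbf{J}^{\Phi-1}_{\boldsymbol\eta}(\mathbb R^{\times k}\boldsymbol\mu)$. Assume that $$\mathrm T_x\big(\mathbf{J}^{\Phi-1}_{\boldsymbol\eta\,\alpha}(\mathbb R^\times\mu^\alpha)\big)=\ker\eta^\alpha_x\cap\ker \mathrm d\eta^\alpha_x+\mathrm T_x\big(\mathbf{J}^{\Phi-1}_{\boldsymbol\eta}(\mathbb R^{\times k}\boldsymbol\mu)\big)+\mathrm T_x(K_{[\mu^\alpha]}x)$$ and $$\mathrm T_x(K_{[\boldsymbol\mu]}x)=\bigcap_{\alpha=1}^k\Big(\big(\ker\eta^\alpha_x\cap\ker \mathrm d\eta^\alpha_x\big)+\mathrm T_x(K_{[\mu^\alpha]}x)\Big)\cap \mathrm T_x\big(\mathbf{J}^{\Phi-1}_{\boldsymbol\eta}(\mathbb R^{\times k}\boldsymbol\mu)\big)$$ for every $x\in \mathbf{J}^{\Phi-1}_{\boldsymbol\eta}(\mathbb R^{\times k}\boldsymbol\mu)$ and every $\alpha=1,\ldots,k$. Let $h\in C^\infty(M)$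 satisfy $\Phi_g^*h=h$ for every $g\in G$, and let $\mathbf X^h=(X^h_1,\ldots,X^h_k)$ be a $k$-contact Hamiltonian $k$-vector field associated with $h$. Assume that $\Phi_{g*}\mathbf X^h=\mathbf X^h$ for every $g\in K_{[\boldsymbol\mu]}$ and that $\mathbf X^h$ is tangent to $\mathbf{J}^{\Phi-1}_{\boldsymbol\eta}(\mathbb R^{\times k}\boldsymbol\mu)$. Then, for each $\alpha=1,\ldots,k$, the flow $\mathcal F^\alpha_t$ of $X^h_\alpha$ leaves $\mathbf{J}^{\Phi-1}_{\boldsymbol\eta}(\mathbb R^{\times k}\boldsymbol\mu)$ invariant and induces a unique flow $\mathcal K^\alpha_t$ on $\mathbf{J}^{\Phi-1}_{\boldsymbol\eta}(\mathbb R^{\times k}\boldsymbol\mu)/K_{[\boldsymbol\mu]}$ satisfying $$\pi_{[\boldsymbol\mu]}\circ\mathcal F^\alpha_t=\mathcal K^\alpha_t\circ\pi_{[\boldsymbol\mu]},$$ where $\pi_{[\boldsymbol\mu]}\colon \mathbf{J}^{\Phi-1}_{\boldsymbol\eta}(\mathbb R^{\times k}\boldsymbol\mu)\to \mathbf{J}^{\Phi-1}_{\boldsymbol\eta}(\mathbb R^{\times k}\boldsymbol\mu)/K_{[\boldsymbol\mu]}$ is the canonical projection.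
   Context: An $\mathbb R^k$-valued form is written $\boldsymbol\eta=\sum_\alpha\eta^\alpha\otimes e_\alpha$; operations act componentwise, and $\ker\boldsymbol\eta=\bigcap_\alpha\ker\eta^\alpha$. A (co-oriented) $k$-contact manifold $(M,\boldsymbol\eta)$ is a manifold $M$ with $\boldsymbol\eta\in\Omega^1(M,\mathbb R^k)$ such that (1) $0\neq\ker\boldsymbol\eta$ is a regular distribution of corank $k$, (2) $\ker \mathrm d\boldsymbol\eta$ is a regular distribution of rank $k$, (3) $\ker\boldsymbol\eta\cap\ker \mathrm d\boldsymbol\eta=0$. Regular means smooth of constant rank. Its Reeb vector fields $R_1,\ldots,R_k$ are the unique vector fields with $\iota_{R_\alpha}\eta^\beta=\delta^\beta_\alpha$, $\iota_{R_\alpha}\mathrm d\boldsymbol\eta=0$. A $k$-vector field is a tuple $\mathbf X=(X_1,\ldots,X_k)$ of vector fields; push-forward and tangency are understood componentwise. $\mathbf X$ is a $k$-contact Hamiltonian $k$-vector field associated with $h$ if $\sum_\alpha\iota_{X_\alpha}\mathrm d\eta^\alpha=\mathrm dh-\sum_\alpha(R_\alpha h)\eta^\alpha$ and $\sum_\alpha\iota_{X_\alpha}\eta^\alpha=-h$. $G$ is a Lie group with Lie algebra $\mathfrak g$; $\Phi$ is a $k$-contact Lie group action if $\Phi_g^*\boldsymbol\eta=\boldsymbol\eta$ for all $g\in G$. $\xi_M(x)=\frac{\mathrm d}{\mathrm dt}|_{t=0}\Phi(\exp(t\xi),x)$. A $k$-contact momentum map is a map $\mathbf{J}^\Phi_{\boldsymbol\eta}=(\mathbf{J}^\Phi_{\boldsymbol\eta\,1},\ldots,\mathbf{J}^\Phi_{\boldsymbol\eta\,k})\colon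 M\to(\mathfrak g^* )^k$ with $\langle \mathbf{J}^\Phi_{\boldsymbol\eta\,\alpha},\xi\rangle=\iota_{\xi_M}\eta^\alpha$ for all $\xi\in\mathfrak g$ and all $\alpha$. $y$ is a weak regular value of $F\colon M\to N$ if $F^{-1}(y)$ is a submanifold and $\mathrm T_xF^{-1}(y)=\ker \mathrm T_xF$ for all $x\in F^{-1}(y)$. $\boldsymbol\mu$ is a weak regular $k$-value of $\mathbf J=(\mathbf J_1,\ldots,\mathbf J_k)$ if each $\mu^\alpha$ is a weak regular value of $\mathbf J_\alpha$ and $\boldsymbol\mu$ is a weak regular value of $\mathbf J$. $\mathbb R^\times=\mathbb R\setminus\{0\}$, $\mathbb R^{\times k}\boldsymbol\mu=\{(\lambda_1\mu^1,\ldots,\lambda_k\mu^k):\lambda_\alpha\in\mathbb R^\times\}$. Standing assumption: for a weak regular $k$-value $\boldsymbol\mu$, the sets $\mathbf{J}^{\Phi-1}_{\boldsymbol\eta}(\mathbb R^{\times k}\boldsymbol\mu)$ and $\mathbf{J}^{\Phi-1}_{\boldsymbol\eta\,\alpha}(\mathbb R^\times\mu^\alpha)$ are submanifolds whose tangent spaces consist of the tangent vectors $v$ with $\mathrm T\mathbf J_\beta(v)\in\mathbb R\mu^\beta$ for all $\beta$ (resp. for $\beta=\alpha$). For $\mu\in\mathfrak g^*$: $\ker\mu=\{\xi\in\mathfrak g:\langle\mu,\xi\rangle=0\}$, $\mathfrak g_{[\mu]}=\{\xi\in\mathfrak g: \mathrm{ad}^*_\xi\mu\wedge\mu=0\}$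 with $\langle \mathrm{ad}^*_\xi\mu,\nu\rangle=\langle\mu,[\xi,\nu]\rangle$, $\mathfrak k_{[\mu]}=\ker\mu\cap\mathfrak g_{[\mu]}$ (a Lie subalgebra), and $K_{[\mu]}$ is the connected Lie subgroup of $G$ with Lie algebra $\mathfrak k_{[\mu]}$. $\mathfrak k_{[\boldsymbol\mu]}=\bigcap_\alpha\mathfrak k_{[\mu^\alpha]}$ and $K_{[\boldsymbol\mu]}$ is the connected Lie subgroup with Lie algebra $\mathfrak k_{[\boldsymbol\mu]}$. $Kx$ denotes the orbit of $x$. An action of a Lie group $K$ on $N$ is quotientable if $N/K$ is a manifold and $N\to N/K$ is a submersion.
   Formalization: Since the ray preimage need not be closed, a tangent field's flow can leave it; invariance and the relation π∘F_t = K_t∘π are therefore asserted for the flow restricted to times up to which the trajectory has stayed in the preimage. *)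

theory Defs
  imports
    "HOL-Analysis.Analysis"
    "HOL-Library.Set_Algebras"
    "HOL-Library.FuncSet"
    "HOL-Algebra.Group_Action"
begin

section \<open>Smooth functions on subsets of Euclidean spaces\<close>

primrec Ck_on :: "nat \<Rightarrow> 'a::real_normed_vector set \<Rightarrow> ('a \<Rightarrow> 'b::real_normed_vector) \<Rightarrow> bool" where
  "Ck_on 0 U f \<longleftrightarrow> continuous_on U f"
| "Ck_on (Suc n) U f \<longleftrightarrow> (\<forall>x\<in>U. f differentiable (at x)) \<and>
     (\<forall>v. Ck_on n U (\<lambda>x. frechet_derivative f (at x) v))"

text \<open>On an arbitrary set, smooth means locally extendable to a smooth function on an open set.
  It will be used for relatively open subsets of linear subspaces.\<close>

definition smooth_on :: "'a::real_normed_vector set \<Rightarrow> ('a \<Rightarrow> 'b::real_normed_vector) \<Rightarrow> bool" where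
  "smooth_on A f \<longleftrightarrow> (\<forall>x\<in>A. \<exists>U g. open U \<and> x \<in> U \<and> (\<forall>n. Ck_on n U g) \<and> (\<forall>y\<in>A \<inter> U. g y = f y))"

text \<open>Directional derivative.  If \<open>f\<close> is smooth on a relatively open subset of a subspace \<open>V\<close>
  and \<open>v \<in> V\<close>, it depends only on the values of \<open>f\<close> on that subset.\<close>

definition ddir :: "('a::real_normed_vector \<Rightarrow> 'b::real_normed_vector) \<Rightarrow> 'a \<Rightarrow> 'a \<Rightarrow> 'b" where
  "ddir f p v = vector_derivative (\<lambda>t. f (p + t *\<^sub>R v)) (at 0)"


section \<open>Manifolds\<close>

text \<open>A manifold is modelled on a linear subspace \<open>mspace\<close> of a Euclidean space, so that its
  dimension \<open>dim (mspace M)\<close> (possibly \<open>0\<close>) is not tied to a type.  A chart is a domain together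
  with a coordinate map.\<close>

type_synonym ('a, 'e) chart = "'a set \<times> ('a \<Rightarrow> 'e)"

record ('a, 'e) mfd =
  mtop :: "'a topology"
  mspace :: "'e set"
  atlas :: "('a, 'e) chart set"

abbreviation pts :: "('a, 'e) mfd \<Rightarrow> 'a set" where
  "pts M \<equiv> topspace (mtop M)"

abbreviation cinv :: "('a, 'e) chart \<Rightarrow> 'e \<Rightarrow> 'a" where
  "cinv c \<equiv> inv_into (fst c) (snd c)"

definition is_chart :: "('a, 'e::euclidean_space) mfd \<Rightarrow> ('a, 'e) chart \<Rightarrow> bool" where
  "is_chart M c \<longleftrightarrow> openin (mtop M) (fst c) \<and>
     openin (top_of_set (mspace M)) (snd c ` fst c) \<and>
     homeomorphic_map (subtopology (mtop M) (fst c)) (top_of_set (snd c ` fst c)) (snd c)"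

definition compatible :: "('a, 'e::euclidean_space) chart \<Rightarrow> ('a, 'e) chart \<Rightarrow> bool" where
  "compatible c c' \<longleftrightarrow> smooth_on (snd c ` (fst c \<inter> fst c')) (snd c' \<circ> cinv c) \<and>
     smooth_on (snd c' ` (fst c \<inter> fst c')) (snd c \<circ> cinv c')"

definition smooth_manifold :: "('a, 'e::euclidean_space) mfd \<Rightarrow> bool" where
  "smooth_manifold M \<longleftrightarrow> Hausdorff_space (mtop M) \<and> second_countable (mtop M) \<and>
     subspace (mspace M) \<and>
     (\<forall>c\<in>atlas M. is_chart M c) \<and> (\<Union>c\<in>atlas M. fst c) = pts M \<and>
     (\<forall>c\<in>atlas M. \<forall>c'\<in>atlas M. compatible c c')"

definition max_atlas :: "('a, 'e::euclidean_space) mfd \<Rightarrow> ('a, 'e) chart set" where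
  "max_atlas M = {c. is_chart M c \<and> (\<forall>c'\<in>atlas M. compatible c c')}"

definition real_mfd :: "(real, real) mfd" where
  "real_mfd = \<lparr>mtop = euclideanreal, mspace = UNIV, atlas = {(UNIV, \<lambda>t. t)}\<rparr>"

definition prod_mfd :: "('a, 'e) mfd \<Rightarrow> ('b, 'f) mfd \<Rightarrow> ('a \<times> 'b, 'e \<times> 'f) mfd" where
  "prod_mfd M M' = \<lparr>mtop = prod_topology (mtop M) (mtop M'), mspace = mspace M \<times> mspace M',
     atlas = {(fst c \<times> fst c', map_prod (snd c) (snd c')) | c c'. c \<in> atlas M \<and> c' \<in> atlas M'}\<rparr>"

text \<open>A map defined on an open set \<open>D\<close> of \<open>M\<close>, with values in \<open>M'\<close>.\<close>

definition smooth_map_on ::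
    "'a set \<Rightarrow> ('a, 'e::euclidean_space) mfd \<Rightarrow> ('b, 'f::euclidean_space) mfd \<Rightarrow> ('a \<Rightarrow> 'b) \<Rightarrow> bool" where
  "smooth_map_on D M M' F \<longleftrightarrow> openin (mtop M) D \<and>
     continuous_map (subtopology (mtop M) D) (mtop M') F \<and>
     (\<forall>c\<in>atlas M. \<forall>c'\<in>atlas M'.
        smooth_on (snd c ` {x \<in> fst c \<inter> D. F x \<in> fst c'}) (snd c' \<circ> F \<circ> cinv c))"

abbreviation smooth_map ::
    "('a, 'e::euclidean_space) mfd \<Rightarrow> ('b, 'f::euclidean_space) mfd \<Rightarrow> ('a \<Rightarrow> 'b) \<Rightarrow> bool" where
  "smooth_map M M' F \<equiv> smooth_map_on (pts M) M M' F"

definition smooth_function :: "('a, 'e::euclidean_space) mfd \<Rightarrow> ('a \<Rightarrow> real) \<Rightarrow> bool" where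
  "smooth_function M f \<longleftrightarrow> (\<forall>c\<in>atlas M. smooth_on (snd c ` fst c) (f \<circ> cinv c))"


section \<open>Tangent vectors, differentials, forms\<close>

text \<open>Every point carries a preferred chart \<open>chart_at M x\<close>.  The tangent space at \<open>x\<close> is the model
  space: a tangent vector is given by its coordinates in the preferred chart at its base point, and
  coordinates in any other chart are obtained from the derivative of the coordinate change.
  Tangent spaces thus are subspaces of a Euclidean space with their usual linear structure.\<close>

definition chart_at :: "('a, 'e) mfd \<Rightarrow> 'a \<Rightarrow> ('a, 'e) chart" where
  "chart_at M x = (SOME c. c \<in> atlas M \<and> x \<in> fst c)"

abbreviation tspace :: "('a, 'e) mfd \<Rightarrow> 'a \<Rightarrow> 'e set" where
  "tspace M x \<equiv> mspace M"

text \<open>Differential at \<open>x\<close> of a function with values in a vector space.  For a coordinate map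
  \<open>snd c\<close> it yields the coordinates of a tangent vector in the chart \<open>c\<close>.\<close>

definition dfun :: "('a, 'e::euclidean_space) mfd \<Rightarrow> ('a \<Rightarrow> 'b::real_normed_vector) \<Rightarrow> 'a \<Rightarrow> 'e \<Rightarrow> 'b" where
  "dfun M f x v = ddir (f \<circ> cinv (chart_at M x)) (snd (chart_at M x) x) v"

definition tmap ::
    "('a, 'e::euclidean_space) mfd \<Rightarrow> ('b, 'f::euclidean_space) mfd \<Rightarrow> ('a \<Rightarrow> 'b) \<Rightarrow> 'a \<Rightarrow> 'e \<Rightarrow> 'f" where
  "tmap M M' F x v = dfun M (snd (chart_at M' (F x)) \<circ> F) x v"

definition smooth_immersion ::
    "('a, 'e::euclidean_space) mfd \<Rightarrow> ('b, 'f::euclidean_space) mfd \<Rightarrow> ('a \<Rightarrow> 'b) \<Rightarrow> bool" where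
  "smooth_immersion M M' F \<longleftrightarrow> smooth_map M M' F \<and>
     (\<forall>x\<in>pts M. inj_on (tmap M M' F x) (tspace M x))"

definition smooth_submersion ::
    "('a, 'e::euclidean_space) mfd \<Rightarrow> ('b, 'f::euclidean_space) mfd \<Rightarrow> ('a \<Rightarrow> 'b) \<Rightarrow> bool" where
  "smooth_submersion M M' F \<longleftrightarrow> smooth_map M M' F \<and>
     (\<forall>x\<in>pts M. tmap M M' F x ` tspace M x = tspace M' (F x))"

text \<open>For a manifold \<open>S\<close> whose points are points of \<open>M\<close> (an embedded or immersed submanifold), the
  tangent space at \<open>x\<close> as a subspace of the one of \<open>M\<close>.\<close>

definition tangent_in ::
    "('a, 'e::euclidean_space) mfd \<Rightarrow> ('a, 'f::euclidean_space) mfd \<Rightarrow> 'a \<Rightarrow> 'f set" where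
  "tangent_in S M x = tmap S M (\<lambda>y. y) x ` tspace S x"

text \<open>Coordinate representations of a vector field and of a \<open>1\<close>-form in a chart \<open>c\<close>.\<close>

definition field_rep ::
    "('a, 'e::euclidean_space) mfd \<Rightarrow> ('a, 'e) chart \<Rightarrow> ('a \<Rightarrow> 'e) \<Rightarrow> 'e \<Rightarrow> 'e" where
  "field_rep M c X p = dfun M (snd c) (cinv c p) (X (cinv c p))"

definition form_rep ::
    "('a, 'e::euclidean_space) mfd \<Rightarrow> ('a, 'e) chart \<Rightarrow> ('a \<Rightarrow> 'e \<Rightarrow> real) \<Rightarrow> 'e \<Rightarrow> 'e \<Rightarrow> real" where
  "form_rep M c \<theta> p w = \<theta> (cinv c p) (ddir (snd (chart_at M (cinv c p)) \<circ> cinv c) p w)"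

definition vector_field_on ::
    "'a set \<Rightarrow> ('a, 'e::euclidean_space) mfd \<Rightarrow> ('a \<Rightarrow> 'e) \<Rightarrow> bool" where
  "vector_field_on U M X \<longleftrightarrow> (\<forall>x\<in>U. X x \<in> tspace M x) \<and>
     (\<forall>c\<in>atlas M. smooth_on (snd c ` (fst c \<inter> U)) (field_rep M c X))"

abbreviation vector_field :: "('a, 'e::euclidean_space) mfd \<Rightarrow> ('a \<Rightarrow> 'e) \<Rightarrow> bool" where
  "vector_field M X \<equiv> vector_field_on (pts M) M X"

text \<open>Linear functionals on a subspace, extended by \<open>0\<close> so that equality of functions is equality
  of functionals.\<close>

definition dual :: "'e::real_vector set \<Rightarrow> ('e \<Rightarrow> real) set" where
  "dual V = {\<mu>. (\<forall>u\<in>V. \<forall>v\<in>V. \<mu> (u + v) = \<mu> u + \<mu> v) \<and>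
     (\<forall>u\<in>V. \<forall>r. \<mu> (r *\<^sub>R u) = r * \<mu> u) \<and> (\<forall>u. u \<notin> V \<longrightarrow> \<mu> u = 0)}"

definition one_form :: "('a, 'e::euclidean_space) mfd \<Rightarrow> ('a \<Rightarrow> 'e \<Rightarrow> real) \<Rightarrow> bool" where
  "one_form M \<theta> \<longleftrightarrow> (\<forall>x\<in>pts M. \<theta> x \<in> dual (tspace M x)) \<and>
     (\<forall>c\<in>atlas M. \<forall>w\<in>mspace M. smooth_on (snd c ` fst c) (\<lambda>p. form_rep M c \<theta> p w))"

text \<open>Exterior derivative and Lie bracket, computed at \<open>x\<close> in the preferred chart at \<open>x\<close>, with the
  conventions \<open>d\<theta>(X,Y) = X(\<theta>(Y)) - Y(\<theta>(X)) - \<theta>([X,Y])\<close> and \<open>[X,Y]f = X(Yf) - Y(Xf)\<close>.\<close>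

definition ext_d :: "('a, 'e::euclidean_space) mfd \<Rightarrow> ('a \<Rightarrow> 'e \<Rightarrow> real) \<Rightarrow> 'a \<Rightarrow> 'e \<Rightarrow> 'e \<Rightarrow> real" where
  "ext_d M \<theta> x v w = (let c = chart_at M x in
     ddir (\<lambda>p. form_rep M c \<theta> p w) (snd c x) v - ddir (\<lambda>p. form_rep M c \<theta> p v) (snd c x) w)"

definition field_bracket ::
    "('a, 'e::euclidean_space) mfd \<Rightarrow> ('a \<Rightarrow> 'e) \<Rightarrow> ('a \<Rightarrow> 'e) \<Rightarrow> 'a \<Rightarrow> 'e" where
  "field_bracket M X Y x = (let c = chart_at M x in
     ddir (field_rep M c Y) (snd c x) (X x) - ddir (field_rep M c X) (snd c x) (Y x))"

definition regular_distribution ::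
    "('a, 'e::euclidean_space) mfd \<Rightarrow> ('a \<Rightarrow> 'e set) \<Rightarrow> nat \<Rightarrow> bool" where
  "regular_distribution M \<Delta> r \<longleftrightarrow>
     (\<forall>x\<in>pts M. subspace (\<Delta> x) \<and> \<Delta> x \<subseteq> tspace M x \<and> dim (\<Delta> x) = r) \<and>
     (\<forall>x\<in>pts M. \<exists>U Y. openin (mtop M) U \<and> x \<in> U \<and>
        (\<forall>i<r. vector_field_on U M (Y i)) \<and> (\<forall>y\<in>U. \<Delta> y = span ((\<lambda>i. Y i y) ` {..<r})))"


section \<open>Embedded submanifolds and weak regular values\<close>

definition slice_chart ::
    "('a, 'e::euclidean_space) mfd \<Rightarrow> 'a set \<Rightarrow> 'e set \<Rightarrow> ('a, 'e) chart \<Rightarrow> bool" where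
  "slice_chart M N V c \<longleftrightarrow> c \<in> max_atlas M \<and> snd c ` (fst c \<inter> N) = snd c ` fst c \<inter> V"

definition slice_space :: "('a, 'e::euclidean_space) mfd \<Rightarrow> 'a set \<Rightarrow> 'e set \<Rightarrow> bool" where
  "slice_space M N V \<longleftrightarrow> subspace V \<and> V \<subseteq> mspace M \<and> (\<forall>x\<in>N. \<exists>c. x \<in> fst c \<and> slice_chart M N V c)"

definition submanifold :: "('a, 'e::euclidean_space) mfd \<Rightarrow> 'a set \<Rightarrow> bool" where
  "submanifold M N \<longleftrightarrow> N \<subseteq> pts M \<and> (\<exists>V. slice_space M N V)"

text \<open>The manifold structure of an embedded submanifold.  All choices of the model space \<open>V\<close> have
  the same dimension (if \<open>N\<close> is nonempty) and give diffeomorphic structures.\<close>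

definition submfd :: "('a, 'e::euclidean_space) mfd \<Rightarrow> 'a set \<Rightarrow> ('a, 'e) mfd" where
  "submfd M N = (let V = (SOME V. slice_space M N V) in
     \<lparr>mtop = subtopology (mtop M) N, mspace = V,
      atlas = {(fst c \<inter> N, snd c) | c. slice_chart M N V c}\<rparr>)"

abbreviation tangent_sub :: "('a, 'e::euclidean_space) mfd \<Rightarrow> 'a set \<Rightarrow> 'a \<Rightarrow> 'e set" where
  "tangent_sub M N x \<equiv> tangent_in (submfd M N) M x"

text \<open>The map \<open>F\<close> takes values in a finite-dimensional space of real functions on \<open>I\<close> (such as
  linear functionals), where differentiation is evaluated pointwise.\<close>

definition weak_regular_value ::
    "('a, 'e::euclidean_space) mfd \<Rightarrow> 'i set \<Rightarrow> ('a \<Rightarrow> 'i \<Rightarrow> real) \<Rightarrow> ('i \<Rightarrow> real) \<Rightarrow> bool" where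
  "weak_regular_value M I F y \<longleftrightarrow> (let S = {x \<in> pts M. \<forall>i\<in>I. F x i = y i} in
     submanifold M S \<and>
     (\<forall>x\<in>S. tangent_sub M S x = {v \<in> tspace M x. \<forall>i\<in>I. dfun M (\<lambda>z. F z i) x v = 0}))"


section \<open>Integral curves and flows\<close>

definition velocity :: "('a, 'e::euclidean_space) mfd \<Rightarrow> (real \<Rightarrow> 'a) \<Rightarrow> real \<Rightarrow> 'e" where
  "velocity M \<gamma> t = vector_derivative (snd (chart_at M (\<gamma> t)) \<circ> \<gamma>) (at t)"

definition integral_curve ::
    "('a, 'e::euclidean_space) mfd \<Rightarrow> ('a \<Rightarrow> 'e) \<Rightarrow> real set \<Rightarrow> (real \<Rightarrow> 'a) \<Rightarrow> bool" where
  "integral_curve M X I \<gamma> \<longleftrightarrow> open I \<and> is_interval I \<and>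
     continuous_map (top_of_set I) (mtop M) \<gamma> \<and>
     (\<forall>t\<in>I. ((snd (chart_at M (\<gamma> t)) \<circ> \<gamma>) has_vector_derivative X (\<gamma> t)) (at t))"

text \<open>A (smooth, in general only local) flow \<open>F(t, x)\<close> with domain \<open>D\<close>.\<close>

definition flow :: "('a, 'e::euclidean_space) mfd \<Rightarrow> (real \<times> 'a) set \<Rightarrow> (real \<times> 'a \<Rightarrow> 'a) \<Rightarrow> bool" where
  "flow M D F \<longleftrightarrow> smooth_map_on D (prod_mfd real_mfd M) M F \<and>
     (\<forall>x\<in>pts M. is_interval {t. (t, x) \<in> D} \<and> (0, x) \<in> D \<and> F (0, x) = x) \<and>
     (\<forall>s t x. (s, x) \<in> D \<and> (t, F (s, x)) \<in> D \<and> (t + s, x) \<in> D \<longrightarrow> F (t, F (s, x)) = F (t + s, x))"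

text \<open>The flow of a vector field: \<open>t \<mapsto> F(t, x)\<close> is the maximal integral curve through \<open>x\<close>.\<close>

definition flow_of ::
    "('a, 'e::euclidean_space) mfd \<Rightarrow> ('a \<Rightarrow> 'e) \<Rightarrow> (real \<times> 'a) set \<Rightarrow> (real \<times> 'a \<Rightarrow> 'a) \<Rightarrow> bool" where
  "flow_of M X D F \<longleftrightarrow> flow M D F \<and>
     (\<forall>x\<in>pts M. integral_curve M X {t. (t, x) \<in> D} (\<lambda>t. F (t, x)) \<and>
        (\<forall>I \<gamma>. integral_curve M X I \<gamma> \<and> {t. (t, x) \<in> D} \<subseteq> I \<and> (\<forall>t. (t, x) \<in> D \<longrightarrow> \<gamma> t = F (t, x))
           \<longrightarrow> I = {t. (t, x) \<in> D}))"

text \<open>The pairs \<open>(t, x)\<close> for which the trajectory starting at \<open>x \<in> N\<close> remains in \<open>N\<close> up to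
  time \<open>t\<close>.  This is the natural time domain of the flow of a tangent vector field on a
  submanifold that need not be closed: that the flow leaves \<open>N\<close> invariant means that \<open>F\<close>,
  restricted to this domain, is a flow on \<open>N\<close>; in particular the domain is open in \<open>\<real> \<times> N\<close> and
  contains \<open>{0} \<times> N\<close>.\<close>

definition flow_domain_in :: "'a set \<Rightarrow> (real \<times> 'a) set \<Rightarrow> (real \<times> 'a \<Rightarrow> 'a) \<Rightarrow> (real \<times> 'a) set" where
  "flow_domain_in N D F =
     {(t, x). x \<in> N \<and> (t, x) \<in> D \<and> (\<forall>s\<in>closed_segment 0 t. F (s, x) \<in> N)}"


section \<open>Lie groups and Lie group actions\<close>

definition lie_group :: "'g monoid \<Rightarrow> ('g, 'l::euclidean_space) mfd \<Rightarrow> bool" where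
  "lie_group G MG \<longleftrightarrow> group G \<and> smooth_manifold MG \<and> pts MG = carrier G \<and>
     smooth_map (prod_mfd MG MG) MG (\<lambda>(a, b). a \<otimes>\<^bsub>G\<^esub> b) \<and>
     smooth_map MG MG (\<lambda>a. inv\<^bsub>G\<^esub> a)"

abbreviation lie_algebra :: "'g monoid \<Rightarrow> ('g, 'l) mfd \<Rightarrow> 'l set" where
  "lie_algebra G MG \<equiv> tspace MG \<one>\<^bsub>G\<^esub>"

definition left_invariant :: "'g monoid \<Rightarrow> ('g, 'l::euclidean_space) mfd \<Rightarrow> 'l \<Rightarrow> 'g \<Rightarrow> 'l" where
  "left_invariant G MG \<xi> g = tmap MG MG (\<lambda>a. g \<otimes>\<^bsub>G\<^esub> a) \<one>\<^bsub>G\<^esub> \<xi>"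

definition lie_bracket :: "'g monoid \<Rightarrow> ('g, 'l::euclidean_space) mfd \<Rightarrow> 'l \<Rightarrow> 'l \<Rightarrow> 'l" where
  "lie_bracket G MG \<xi> \<zeta> =
     field_bracket MG (left_invariant G MG \<xi>) (left_invariant G MG \<zeta>) \<one>\<^bsub>G\<^esub>"

definition lie_exp :: "'g monoid \<Rightarrow> ('g, 'l::euclidean_space) mfd \<Rightarrow> 'l \<Rightarrow> 'g" where
  "lie_exp G MG \<xi> = (THE \<gamma>. smooth_map real_mfd MG \<gamma> \<and>
     (\<forall>s t. \<gamma> (s + t) = \<gamma> s \<otimes>\<^bsub>G\<^esub> \<gamma> t) \<and> velocity MG \<gamma> 0 = \<xi>) 1"

text \<open>\<open>K\<close>, with the manifold structure \<open>MK\<close>, is the connected (immersed) Lie subgroup of \<open>G\<close> with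
  Lie algebra \<open>\<kk>\<close>.\<close>

definition connected_lie_subgroup ::
    "'g monoid \<Rightarrow> ('g, 'l::euclidean_space) mfd \<Rightarrow> 'g set \<Rightarrow> ('g, 'l) mfd \<Rightarrow> 'l set \<Rightarrow> bool" where
  "connected_lie_subgroup G MG K MK \<kk> \<longleftrightarrow> subgroup K G \<and> lie_group (G\<lparr>carrier := K\<rparr>) MK \<and>
     connected_space (mtop MK) \<and> smooth_immersion MK MG (\<lambda>g. g) \<and>
     tangent_in MK MG \<one>\<^bsub>G\<^esub> = \<kk>"

definition lie_group_action ::
    "'g monoid \<Rightarrow> ('g, 'l::euclidean_space) mfd \<Rightarrow> ('a, 'e::euclidean_space) mfd \<Rightarrow> ('g \<Rightarrow> 'a \<Rightarrow> 'a) \<Rightarrow> bool" where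
  "lie_group_action G MG M \<Phi> \<longleftrightarrow> lie_group G MG \<and> smooth_manifold M \<and>
     group_action G (pts M) \<Phi> \<and> smooth_map (prod_mfd MG M) M (\<lambda>(g, x). \<Phi> g x)"

definition fundamental_field ::
    "'g monoid \<Rightarrow> ('g, 'l::euclidean_space) mfd \<Rightarrow> ('a, 'e::euclidean_space) mfd \<Rightarrow> ('g \<Rightarrow> 'a \<Rightarrow> 'a) \<Rightarrow>
     'l \<Rightarrow> 'a \<Rightarrow> 'e" where
  "fundamental_field G MG M \<Phi> \<xi> x = velocity M (\<lambda>t. \<Phi> (lie_exp G MG (t *\<^sub>R \<xi>)) x) 0"

text \<open>The orbit of \<open>x\<close> under a Lie subgroup.  It is an immersed submanifold, whose manifold
  structure is the one for which \<open>K \<rightarrow> Kx\<close> is a submersion.\<close>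

abbreviation orbit_of :: "'g monoid \<Rightarrow> 'g set \<Rightarrow> ('g \<Rightarrow> 'a \<Rightarrow> 'a) \<Rightarrow> 'a \<Rightarrow> 'a set" where
  "orbit_of G K \<Phi> x \<equiv> orbit (G\<lparr>carrier := K\<rparr>) \<Phi> x"

definition orbit_structure ::
    "'g monoid \<Rightarrow> ('a, 'e::euclidean_space) mfd \<Rightarrow> ('g \<Rightarrow> 'a \<Rightarrow> 'a) \<Rightarrow> 'g set \<Rightarrow> ('g, 'l::euclidean_space) mfd \<Rightarrow>
     'a \<Rightarrow> ('a, 'e) mfd \<Rightarrow> bool" where
  "orbit_structure G M \<Phi> K MK x S \<longleftrightarrow> smooth_manifold S \<and> pts S = orbit_of G K \<Phi> x \<and>
     smooth_immersion S M (\<lambda>y. y) \<and> smooth_submersion MK S (\<lambda>g. \<Phi> g x)"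

definition tangent_orbit ::
    "'g monoid \<Rightarrow> ('a, 'e::euclidean_space) mfd \<Rightarrow> ('g \<Rightarrow> 'a \<Rightarrow> 'a) \<Rightarrow> 'g set \<Rightarrow> ('g, 'l::euclidean_space) mfd \<Rightarrow>
     'a \<Rightarrow> 'e set" where
  "tangent_orbit G M \<Phi> K MK x = {v. \<exists>S. orbit_structure G M \<Phi> K MK x S \<and> v \<in> tangent_in S M x}"

text \<open>\<open>K\<close> acts on (in particular, preserves) the submanifold \<open>N\<close>, the orbit space with the structure \<open>Q\<close> is a manifold, and
  the canonical projection is a submersion.  The latter determines \<open>Q\<close> up to diffeomorphism, and
  implies that its topology is the quotient topology.\<close>

definition quotientable ::
    "'g monoid \<Rightarrow> ('a, 'e::euclidean_space) mfd \<Rightarrow> ('g \<Rightarrow> 'a \<Rightarrow> 'a) \<Rightarrow> 'g set \<Rightarrow> 'a set \<Rightarrow>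
     ('a set, 'q::euclidean_space) mfd \<Rightarrow> bool" where
  "quotientable G M \<Phi> K N Q \<longleftrightarrow> (\<forall>g\<in>K. \<Phi> g ` N \<subseteq> N) \<and>
     smooth_manifold Q \<and> pts Q = orbits (G\<lparr>carrier := K\<rparr>) N \<Phi> \<and>
     smooth_submersion (submfd M N) Q (orbit_of G K \<Phi>)"


section \<open>Coadjoint data\<close>

definition ad_star :: "'g monoid \<Rightarrow> ('g, 'l::euclidean_space) mfd \<Rightarrow> 'l \<Rightarrow> ('l \<Rightarrow> real) \<Rightarrow> 'l \<Rightarrow> real" where
  "ad_star G MG \<xi> \<mu> \<nu> = \<mu> (lie_bracket G MG \<xi> \<nu>)"

definition wedge :: "('l \<Rightarrow> real) \<Rightarrow> ('l \<Rightarrow> real) \<Rightarrow> 'l \<Rightarrow> 'l \<Rightarrow> real" where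
  "wedge \<sigma> \<tau> u v = \<sigma> u * \<tau> v - \<sigma> v * \<tau> u"

text \<open>\<open>isotropy_ray\<close> is \<open>\<gg>\<^bsub>[\<mu>]\<^esub>\<close>, and \<open>k_ray\<close> is \<open>\<kk>\<^bsub>[\<mu>]\<^esub> = ker \<mu> \<inter> \<gg>\<^bsub>[\<mu>]\<^esub>\<close>.\<close>

definition isotropy_ray :: "'g monoid \<Rightarrow> ('g, 'l::euclidean_space) mfd \<Rightarrow> ('l \<Rightarrow> real) \<Rightarrow> 'l set" where
  "isotropy_ray G MG \<mu> = {\<xi> \<in> lie_algebra G MG.
     \<forall>u\<in>lie_algebra G MG. \<forall>v\<in>lie_algebra G MG. wedge (ad_star G MG \<xi> \<mu>) \<mu> u v = 0}"

definition k_ray :: "'g monoid \<Rightarrow> ('g, 'l::euclidean_space) mfd \<Rightarrow> ('l \<Rightarrow> real) \<Rightarrow> 'l set" where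
  "k_ray G MG \<mu> = {\<xi> \<in> lie_algebra G MG. \<mu> \<xi> = 0} \<inter> isotropy_ray G MG \<mu>"

text \<open>\<open>\<real>\<^sup>\<times>\<mu>\<close> and \<open>\<real>\<^sup>\<times>\<^sup>k\<mu>\<close>.\<close>

definition mult_ray :: "('l \<Rightarrow> real) \<Rightarrow> ('l \<Rightarrow> real) set" where
  "mult_ray \<mu> = {\<lambda>\<xi>. r * \<mu> \<xi> | r. r \<noteq> 0}"

definition mult_k_ray :: "('k \<Rightarrow> 'l \<Rightarrow> real) \<Rightarrow> ('k \<Rightarrow> 'l \<Rightarrow> real) set" where
  "mult_k_ray \<mu> = {\<lambda>\<alpha> \<xi>. r \<alpha> * \<mu> \<alpha> \<xi> | r. \<forall>\<alpha>. r \<alpha> \<noteq> 0}"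


section \<open>\<open>k\<close>-contact geometry\<close>

text \<open>The index set \<open>{1,\<dots>,k}\<close> is a finite type \<open>'k\<close>; an \<open>\<real>\<^sup>k\<close>-valued form is the family of its
  components.\<close>

definition ker_form :: "('a, 'e::euclidean_space) mfd \<Rightarrow> ('a \<Rightarrow> 'e \<Rightarrow> real) \<Rightarrow> 'a \<Rightarrow> 'e set" where
  "ker_form M \<theta> x = {v \<in> tspace M x. \<theta> x v = 0}"

definition ker_d :: "('a, 'e::euclidean_space) mfd \<Rightarrow> ('a \<Rightarrow> 'e \<Rightarrow> real) \<Rightarrow> 'a \<Rightarrow> 'e set" where
  "ker_d M \<theta> x = {v \<in> tspace M x. \<forall>w\<in>tspace M x. ext_d M \<theta> x v w = 0}"

definition k_contact :: "('a, 'e::euclidean_space) mfd \<Rightarrow> ('k::finite \<Rightarrow> 'a \<Rightarrow> 'e \<Rightarrow> real) \<Rightarrow> bool" where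
  "k_contact M \<eta> \<longleftrightarrow> smooth_manifold M \<and> (\<forall>\<alpha>. one_form M (\<eta> \<alpha>)) \<and>
     (\<exists>r. r + CARD('k) = dim (mspace M) \<and> regular_distribution M (\<lambda>x. \<Inter>\<alpha>. ker_form M (\<eta> \<alpha>) x) r) \<and>
     (\<forall>x\<in>pts M. (\<Inter>\<alpha>. ker_form M (\<eta> \<alpha>) x) \<noteq> {0}) \<and>
     regular_distribution M (\<lambda>x. \<Inter>\<alpha>. ker_d M (\<eta> \<alpha>) x) CARD('k) \<and>
     (\<forall>x\<in>pts M. (\<Inter>\<alpha>. ker_form M (\<eta> \<alpha>) x) \<inter> (\<Inter>\<alpha>. ker_d M (\<eta> \<alpha>) x) = {0})"

definition reeb_fields ::
    "('a, 'e::euclidean_space) mfd \<Rightarrow> ('k::finite \<Rightarrow> 'a \<Rightarrow> 'e \<Rightarrow> real) \<Rightarrow> ('k \<Rightarrow> 'a \<Rightarrow> 'e) \<Rightarrow> bool" where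
  "reeb_fields M \<eta> R \<longleftrightarrow> (\<forall>\<alpha>. vector_field M (R \<alpha>)) \<and>
     (\<forall>x\<in>pts M. \<forall>\<alpha> \<beta>. \<eta> \<beta> x (R \<alpha> x) = (if \<alpha> = \<beta> then 1 else 0) \<and>
        (\<forall>w\<in>tspace M x. ext_d M (\<eta> \<beta>) x (R \<alpha> x) w = 0))"

definition hamiltonian_k_field ::
    "('a, 'e::euclidean_space) mfd \<Rightarrow> ('k::finite \<Rightarrow> 'a \<Rightarrow> 'e \<Rightarrow> real) \<Rightarrow> ('k \<Rightarrow> 'a \<Rightarrow> 'e) \<Rightarrow> ('a \<Rightarrow> real) \<Rightarrow>
     ('k \<Rightarrow> 'a \<Rightarrow> 'e) \<Rightarrow> bool" where
  "hamiltonian_k_field M \<eta> R h X \<longleftrightarrow> (\<forall>\<alpha>. vector_field M (X \<alpha>)) \<and>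
     (\<forall>x\<in>pts M.
        (\<forall>w\<in>tspace M x. (\<Sum>\<alpha>\<in>UNIV. ext_d M (\<eta> \<alpha>) x (X \<alpha> x) w) =
           dfun M h x w - (\<Sum>\<alpha>\<in>UNIV. dfun M h x (R \<alpha> x) * \<eta> \<alpha> x w)) \<and>
        (\<Sum>\<alpha>\<in>UNIV. \<eta> \<alpha> x (X \<alpha> x)) = - h x)"

definition k_contact_action ::
    "'g monoid \<Rightarrow> ('g, 'l::euclidean_space) mfd \<Rightarrow> ('a, 'e::euclidean_space) mfd \<Rightarrow>
     ('k::finite \<Rightarrow> 'a \<Rightarrow> 'e \<Rightarrow> real) \<Rightarrow> ('g \<Rightarrow> 'a \<Rightarrow> 'a) \<Rightarrow> bool" where
  "k_contact_action G MG M \<eta> \<Phi> \<longleftrightarrow> lie_group_action G MG M \<Phi> \<and>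
     (\<forall>g\<in>carrier G. \<forall>\<alpha>. \<forall>x\<in>pts M. \<forall>v\<in>tspace M x. \<eta> \<alpha> (\<Phi> g x) (tmap M M (\<Phi> g) x v) = \<eta> \<alpha> x v)"

definition momentum_map ::
    "'g monoid \<Rightarrow> ('g, 'l::euclidean_space) mfd \<Rightarrow> ('a, 'e::euclidean_space) mfd \<Rightarrow>
     ('k::finite \<Rightarrow> 'a \<Rightarrow> 'e \<Rightarrow> real) \<Rightarrow> ('g \<Rightarrow> 'a \<Rightarrow> 'a) \<Rightarrow> ('k \<Rightarrow> 'a \<Rightarrow> 'l \<Rightarrow> real) \<Rightarrow> bool" where
  "momentum_map G MG M \<eta> \<Phi> J \<longleftrightarrow> (\<forall>\<alpha>. \<forall>x\<in>pts M. J \<alpha> x \<in> dual (lie_algebra G MG) \<and>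
     (\<forall>\<xi>\<in>lie_algebra G MG. J \<alpha> x \<xi> = \<eta> \<alpha> x (fundamental_field G MG M \<Phi> \<xi> x)))"

definition weak_regular_k_value ::
    "'g monoid \<Rightarrow> ('g, 'l::euclidean_space) mfd \<Rightarrow> ('a, 'e::euclidean_space) mfd \<Rightarrow>
     ('k::finite \<Rightarrow> 'a \<Rightarrow> 'l \<Rightarrow> real) \<Rightarrow> ('k \<Rightarrow> 'l \<Rightarrow> real) \<Rightarrow> bool" where
  "weak_regular_k_value G MG M J \<mu> \<longleftrightarrow>
     (\<forall>\<alpha>. weak_regular_value M (lie_algebra G MG) (J \<alpha>) (\<mu> \<alpha>)) \<and>
     weak_regular_value M (UNIV \<times> lie_algebra G MG) (\<lambda>x (\<alpha>, \<xi>). J \<alpha> x \<xi>) (\<lambda>(\<alpha>, \<xi>). \<mu> \<alpha> \<xi>)"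

definition ray_preimage ::
    "('a, 'e) mfd \<Rightarrow> ('k \<Rightarrow> 'a \<Rightarrow> 'l \<Rightarrow> real) \<Rightarrow> ('k \<Rightarrow> 'l \<Rightarrow> real) \<Rightarrow> 'k \<Rightarrow> 'a set" where
  "ray_preimage M J \<mu> \<alpha> = {x \<in> pts M. J \<alpha> x \<in> mult_ray (\<mu> \<alpha>)}"

definition k_ray_preimage ::
    "('a, 'e) mfd \<Rightarrow> ('k \<Rightarrow> 'a \<Rightarrow> 'l \<Rightarrow> real) \<Rightarrow> ('k \<Rightarrow> 'l \<Rightarrow> real) \<Rightarrow> 'a set" where
  "k_ray_preimage M J \<mu> = {x \<in> pts M. (\<lambda>\<alpha>. J \<alpha> x) \<in> mult_k_ray \<mu>}"

text \<open>The tangent vectors \<open>v\<close> at \<open>x\<close> with \<open>T J\<^sub>\<beta>(v) \<in> \<real> \<mu>\<^sup>\<beta>\<close>.\<close>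

definition ray_tangent ::
    "'g monoid \<Rightarrow> ('g, 'l::euclidean_space) mfd \<Rightarrow> ('a, 'e::euclidean_space) mfd \<Rightarrow>
     ('k \<Rightarrow> 'a \<Rightarrow> 'l \<Rightarrow> real) \<Rightarrow> ('k \<Rightarrow> 'l \<Rightarrow> real) \<Rightarrow> 'k \<Rightarrow> 'a \<Rightarrow> 'e set" where
  "ray_tangent G MG M J \<mu> \<beta> x = {v \<in> tspace M x.
     \<exists>r. \<forall>\<xi>\<in>lie_algebra G MG. dfun M (\<lambda>z. J \<beta> z \<xi>) x v = r * \<mu> \<beta> \<xi>}"

definition ray_preimages_regular ::
    "'g monoid \<Rightarrow> ('g, 'l::euclidean_space) mfd \<Rightarrow> ('a, 'e::euclidean_space) mfd \<Rightarrow>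
     ('k::finite \<Rightarrow> 'a \<Rightarrow> 'l \<Rightarrow> real) \<Rightarrow> ('k \<Rightarrow> 'l \<Rightarrow> real) \<Rightarrow> bool" where
  "ray_preimages_regular G MG M J \<mu> \<longleftrightarrow>
     submanifold M (k_ray_preimage M J \<mu>) \<and>
     (\<forall>x\<in>k_ray_preimage M J \<mu>.
        tangent_sub M (k_ray_preimage M J \<mu>) x = (\<Inter>\<beta>. ray_tangent G MG M J \<mu> \<beta> x)) \<and>
     (\<forall>\<alpha>. submanifold M (ray_preimage M J \<mu> \<alpha>) \<and>
        (\<forall>x\<in>ray_preimage M J \<mu> \<alpha>.
           tangent_sub M (ray_preimage M J \<mu> \<alpha>) x = ray_tangent G MG M J \<mu> \<alpha> x))"

end

theory Submission
  imports Defs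
begin

text \<open>
  Write \<open>N\<close> for the ray preimage and \<open>X\<close> for one component of the Hamiltonian field.  In a slice
  chart of \<open>N\<close> the distance of an integral curve of \<open>X\<close> to the slice satisfies a Gronwall
  inequality, because \<open>X\<close> is Lipschitz and tangent to the slice; so integral curves starting in \<open>N\<close>
  stay in \<open>N\<close> locally, and compactness of time intervals makes the domain of the restricted flow
  open in \<open>\<real> \<times> N\<close>.  Since \<open>X\<close> is \<open>K\<close>-invariant, \<open>\<Phi>\<^sub>g\<close> maps integral curves to integral curves, and
  by uniqueness and maximality the flow and its domain are \<open>K\<close>-equivariant.  Hence the flow descends
  to a map on orbits, which is smooth because the submersion \<open>\<pi>\<close> has smooth local sections (inverse
  function theorem).
\<close>

section \<open>Calculus of smooth functions on open sets\<close>

text \<open>Coordinates take values in relatively open subsets of linear subspaces, so a smooth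
  coordinate expression is given only through local extensions to open sets, and these are not
  unique. Smoothness is therefore handled as a germ that factors through a coordinate map, and
  derivatives in model directions are read off from curves, which do not see the choice of
  extension. The subspaces also stand in the way of the inverse function theorem, which needs a map
  between open sets of one space: the coordinate form of \<open>\<pi>\<close> has to be completed to
  such a map with identity derivative.

  \<open>N\<close> need not be closed, so a trajectory starting in \<open>N\<close> may leave it in
  finite time through a limit point outside \<open>N\<close>. Hence the restricted flow is only
  local, and the openness of its domain has to be proved. Uniqueness of the reduced flow rests on
  its domain consisting of the points \<open>(t, \<pi> x)\<close> with \<open>(t, x)\<close> in the
  upper domain; being extensional fixes the values elsewhere.\<close>

lemma Ck_on_subset: "Ck_on n U f \<Longrightarrow> T \<subseteq> U \<Longrightarrow> Ck_on n T f"
proof (induction n arbitrary: f)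
  case 0
  then show ?case using continuous_on_subset by auto
next
  case (Suc n)
  then show ?case by (auto simp: subset_iff)
qed

lemma frechet_derivative_cong_open:
  assumes "open U" "x \<in> U" "\<And>y. y \<in> U \<Longrightarrow> f y = g y"
  shows "frechet_derivative f (at x) = frechet_derivative g (at x)"
proof -
  have "(f has_derivative D) (at x) \<longleftrightarrow> (g has_derivative D) (at x)" for D
    using assms by (metis has_derivative_transform_within_open)
  then show ?thesis unfolding frechet_derivative_def by simp
qed

lemma Ck_on_cong:
  assumes "open U" "\<And>x. x \<in> U \<Longrightarrow> f x = g x" "Ck_on n U f"
  shows "Ck_on n U g"
  using assms(2,3)
proof (induction n arbitrary: f g)
  case 0
  then show ?case using continuous_on_cong by (metis Ck_on.simps(1))
next
  case (Suc n)
  have "g differentiable (at x)" if "x \<in> U" for x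
    using Suc.prems assms(1) that
    by (metis Ck_on.simps(2) differentiable_def has_derivative_transform_within_open)
  moreover have "Ck_on n U (\<lambda>x. frechet_derivative g (at x) v)" for v
  proof (rule Suc.IH)
    show "Ck_on n U (\<lambda>x. frechet_derivative f (at x) v)" using Suc.prems by simp
    show "frechet_derivative f (at x) v = frechet_derivative g (at x) v" if "x \<in> U" for x
      using frechet_derivative_cong_open[OF assms(1) that, of f g] Suc.prems(1) by simp
  qed
  ultimately show ?case by simp
qed

text \<open>Derivatives are unique, so an explicit formula may replace
  \<open>frechet_derivative\<close>; the two agree on \<open>U\<close> only, which suffices because
  \<open>U\<close> is open.\<close>

lemma Ck_on_SucI:
  assumes "open U" "\<And>x. x \<in> U \<Longrightarrow> (f has_derivative f' x) (at x)"
    "\<And>v. Ck_on n U (\<lambda>x. f' x v)"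
  shows "Ck_on (Suc n) U f"
proof -
  have "Ck_on n U (\<lambda>x. frechet_derivative f (at x) v)" for v
    by (rule Ck_on_cong[OF assms(1) _ assms(3)[of v]]) (use assms(2) frechet_derivative_at in metis)
  then show ?thesis using assms(2) by (auto simp: differentiable_def)
qed

lemma Ck_on_imp_continuous_on: "Ck_on n U f \<Longrightarrow> continuous_on U f"
  by (cases n)
    (auto intro!: differentiable_imp_continuous_on simp: differentiable_on_def differentiable_at_withinI)

lemma Ck_on_SucD: "Ck_on (Suc n) U f \<Longrightarrow> Ck_on n U f"
proof (induction n arbitrary: f)
  case 0
  then show ?case using Ck_on_imp_continuous_on by (metis Ck_on.simps(1))
next
  case (Suc n)
  then show ?case by (metis Ck_on.simps(2))
qed

lemma Ck_on_frechet:
  "Ck_on (Suc n) U f \<Longrightarrow> x \<in> U \<Longrightarrow> (f has_derivative frechet_derivative f (at x)) (at x)"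
  by (simp add: frechet_derivative_works[symmetric])

lemma Ck_on_const: "Ck_on n U (\<lambda>x. c)"
  by (induction n arbitrary: c) (auto simp: frechet_derivative_const)

lemma Ck_on_bounded_linear:
  assumes L: "bounded_linear L" and "open U" "Ck_on n U f"
  shows "Ck_on n U (\<lambda>x. L (f x))"
  using assms(3)
proof (induction n arbitrary: f)
  case 0
  then show ?case by (simp add: bounded_linear.continuous_on[OF L])
next
  case (Suc n)
  show ?case
  proof (rule Ck_on_SucI[OF assms(2)])
    show "((\<lambda>x. L (f x)) has_derivative (\<lambda>v. L (frechet_derivative f (at x) v))) (at x)" if "x \<in> U" for x
      using bounded_linear.has_derivative[OF L Ck_on_frechet[OF Suc.prems that]] .
    show "Ck_on n U (\<lambda>x. L (frechet_derivative f (at x) v))" for v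
      using Suc by simp
  qed
qed

lemma Ck_on_id: "open U \<Longrightarrow> Ck_on n U (\<lambda>x. x)"
proof (cases n)
  case (Suc m)
  assume "open U"
  then show ?thesis unfolding Suc
    by (rule Ck_on_SucI[where f' = "\<lambda>x v. v"]) (auto simp: Ck_on_const)
qed auto

lemma Ck_on_linear: "bounded_linear L \<Longrightarrow> open U \<Longrightarrow> Ck_on n U L"
  using Ck_on_bounded_linear[OF _ _ Ck_on_id] by blast

lemma Ck_on_add:
  assumes "open U" "Ck_on n U f" "Ck_on n U g"
  shows "Ck_on n U (\<lambda>x. f x + g x)"
  using assms(2,3)
proof (induction n arbitrary: f g)
  case 0
  then show ?case by (simp add: continuous_on_add)
next
  case (Suc n)
  show ?case
  proof (rule Ck_on_SucI[OF assms(1)])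
    show "((\<lambda>x. f x + g x) has_derivative
        (\<lambda>v. frechet_derivative f (at x) v + frechet_derivative g (at x) v)) (at x)" if "x \<in> U" for x
      using has_derivative_add[OF Ck_on_frechet[OF Suc.prems(1) that] Ck_on_frechet[OF Suc.prems(2) that]] .
    show "Ck_on n U (\<lambda>x. frechet_derivative f (at x) v + frechet_derivative g (at x) v)" for v
      using Suc by simp
  qed
qed

lemma Ck_on_sum:
  assumes "open U" "\<And>i. i \<in> I \<Longrightarrow> Ck_on n U (f i)"
  shows "Ck_on n U (\<lambda>x. \<Sum>i\<in>I. f i x)"
  using assms(2)
  by (induction I rule: infinite_finite_induct) (auto simp: Ck_on_const intro!: Ck_on_add[OF assms(1)])

lemma Ck_on_scaleR:
  fixes f :: "'a::real_normed_vector \<Rightarrow> real"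
  assumes "open U" "Ck_on n U f" "Ck_on n U g"
  shows "Ck_on n U (\<lambda>x. f x *\<^sub>R g x)"
  using assms(2,3)
proof (induction n arbitrary: f g)
  case 0
  then show ?case by (simp add: continuous_on_scaleR)
next
  case (Suc n)
  show ?case
  proof (rule Ck_on_SucI[OF assms(1)])
    show "((\<lambda>x. f x *\<^sub>R g x) has_derivative
        (\<lambda>v. f x *\<^sub>R frechet_derivative g (at x) v + frechet_derivative f (at x) v *\<^sub>R g x)) (at x)"
      if "x \<in> U" for x
      using has_derivative_scaleR[OF Ck_on_frechet[OF Suc.prems(1) that] Ck_on_frechet[OF Suc.prems(2) that]] .
    show "Ck_on n U (\<lambda>x. f x *\<^sub>R frechet_derivative g (at x) v + frechet_derivative f (at x) v *\<^sub>R g x)" for v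
      using Suc Ck_on_SucD[OF Suc.prems(1)] Ck_on_SucD[OF Suc.prems(2)]
      by (intro Ck_on_add[OF assms(1)] Suc.IH) auto
  qed
qed

text \<open>The chain rule gives the derivative of \<open>g\<close> at \<open>f x\<close> in the
  direction \<open>?f' x v\<close>, which varies with \<open>x\<close>, while \<open>Ck_on\<close>
  speaks of fixed directions. Expanding over the basis of the intermediate Euclidean space turns it
  into a sum of products whose factors are covered by the hypothesis on \<open>f\<close> and the
  induction hypothesis.\<close>

lemma Ck_on_compose:
  fixes f :: "'a::real_normed_vector \<Rightarrow> 'b::euclidean_space"
  assumes "open U" "open T" "f ` U \<subseteq> T" "Ck_on n U f" "Ck_on n T g"
  shows "Ck_on n U (\<lambda>x. g (f x))"
  using assms(3-5)
proof (induction n arbitrary: g)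
  case 0
  then show ?case by (auto intro: continuous_on_compose2)
next
  case (Suc n)
  let ?f' = "\<lambda>x. frechet_derivative f (at x)" and ?g' = "\<lambda>y. frechet_derivative g (at y)"
  show ?case
  proof (rule Ck_on_SucI[OF assms(1)])
    fix x assume x: "x \<in> U"
    then have "f x \<in> T" using Suc.prems by auto
    have g: "(g has_derivative ?g' (f x)) (at (f x))"
      using Ck_on_frechet[OF Suc.prems(3) \<open>f x \<in> T\<close>] .
    have exp: "?g' (f x) w = (\<Sum>b\<in>Basis. (w \<bullet> b) *\<^sub>R ?g' (f x) b)" for w
      using linear_sum[OF has_derivative_linear[OF g], of "\<lambda>b. (w \<bullet> b) *\<^sub>R b" Basis]
      by (simp add: euclidean_representation linear_scale[OF has_derivative_linear[OF g]])
    have "((\<lambda>x. g (f x)) has_derivative (\<lambda>v. ?g' (f x) (?f' x v))) (at x)"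
      using diff_chain_at[OF Ck_on_frechet[OF Suc.prems(2) x] g] by (simp add: o_def)
    moreover have "(\<lambda>v. ?g' (f x) (?f' x v)) = (\<lambda>v. \<Sum>b\<in>Basis. (?f' x v \<bullet> b) *\<^sub>R ?g' (f x) b)"
      by (rule ext) (rule exp)
    ultimately show "((\<lambda>x. g (f x)) has_derivative (\<lambda>v. \<Sum>b\<in>Basis. (?f' x v \<bullet> b) *\<^sub>R ?g' (f x) b)) (at x)"
      by metis
  next
    fix v
    show "Ck_on n U (\<lambda>x. \<Sum>b\<in>Basis. (?f' x v \<bullet> b) *\<^sub>R ?g' (f x) b)"
    proof (intro Ck_on_sum Ck_on_scaleR assms(1))
      show "Ck_on n U (\<lambda>x. ?f' x v \<bullet> b)" for b
        using Suc.prems(2) by (intro Ck_on_bounded_linear[OF bounded_linear_inner_left assms(1)]) simp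
      show "Ck_on n U (\<lambda>x. ?g' (f x) b)" for b
        using Suc.prems Ck_on_SucD[OF Suc.prems(2)] by (intro Suc.IH) auto
    qed
  qed
qed

lemma Ck_on_Pair:
  assumes "open U" "Ck_on n U f" "Ck_on n U g"
  shows "Ck_on n U (\<lambda>x. (f x, g x))"
proof -
  have "bounded_linear (\<lambda>x. (x, 0))" "bounded_linear (\<lambda>x. (0, x))"
    by (intro bounded_linear_Pair bounded_linear_zero bounded_linear_ident)+
  from Ck_on_add[OF assms(1) Ck_on_bounded_linear[OF this(1) assms(1,2)]
      Ck_on_bounded_linear[OF this(2) assms(1,3)]]
  show ?thesis by simp
qed

section \<open>Inverse operators, the smooth inverse function theorem and local sections\<close>

text \<open>Where one factor vanishes, the product rule needs only continuity of the other: the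
  remainder splits into the remainder of \<open>a\<close> times \<open>\<beta> y\<close>, and
  \<open>a' (y - x)\<close> times \<open>\<beta> y - \<beta> x\<close>. This differentiates an
  expression in the inverse operator at a stage where that operator is known only to be
  continuous.\<close>

lemma has_derivative_scaleR_vanishing:
  fixes a :: "'a::real_normed_vector \<Rightarrow> real"
  assumes a: "(a has_derivative a') (at x)" and "a x = 0" and \<beta>: "isCont \<beta> x"
  shows "((\<lambda>y. a y *\<^sub>R \<beta> y) has_derivative (\<lambda>h. a' h *\<^sub>R \<beta> x)) (at x)"
proof -
  have bl: "bounded_linear a'" using a has_derivative_bounded_linear by blast
  obtain C where C: "\<And>h. norm (a' h) \<le> norm h * C" using bounded_linear.bounded[OF bl] by blast
  have lim: "((\<lambda>y. (a y - a' (y - x)) /\<^sub>R norm (y - x)) \<longlongrightarrow> 0) (at x)"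
    using a assms(2) by (simp add: has_derivative_at_within divide_inverse_commute diff_diff_eq)
  have "((\<lambda>y. ((a y - a' (y - x)) /\<^sub>R norm (y - x)) *\<^sub>R \<beta> y
      + (a' (y - x) / norm (y - x)) *\<^sub>R (\<beta> y - \<beta> x)) \<longlongrightarrow> 0) (at x)"
  proof (rule tendsto_add_zero)
    show "((\<lambda>y. ((a y - a' (y - x)) /\<^sub>R norm (y - x)) *\<^sub>R \<beta> y) \<longlongrightarrow> 0) (at x)"
      using tendsto_scaleR[OF lim \<beta>[unfolded isCont_def]] by simp
    show "((\<lambda>y. (a' (y - x) / norm (y - x)) *\<^sub>R (\<beta> y - \<beta> x)) \<longlongrightarrow> 0) (at x)"
    proof (rule Lim_null_comparison)
      show "\<forall>\<^sub>F y in at x. norm ((a' (y - x) / norm (y - x)) *\<^sub>R (\<beta> y - \<beta> x)) \<le> C * norm (\<beta> y - \<beta> x)"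
      proof (rule eventuallyI)
        fix y
        have "norm (a' (y - x) / norm (y - x)) \<le> C" if "y \<noteq> x"
          using C[of "y - x"] that by (simp add: field_simps)
        then show "norm ((a' (y - x) / norm (y - x)) *\<^sub>R (\<beta> y - \<beta> x)) \<le> C * norm (\<beta> y - \<beta> x)"
          unfolding norm_scaleR real_norm_def[symmetric] by (cases "y = x") (simp, rule mult_right_mono, auto)
      qed
      have "((\<lambda>y. \<beta> y - \<beta> x) \<longlongrightarrow> 0) (at x)"
        using \<beta> by (simp add: isCont_def LIM_zero_iff)
      then show "((\<lambda>y. C * norm (\<beta> y - \<beta> x)) \<longlongrightarrow> 0) (at x)"
        by (intro tendsto_mult_right_zero tendsto_norm_zero)
    qed
  qed
  moreover have "((a y - a' (y - x)) /\<^sub>R norm (y - x)) *\<^sub>R \<beta> y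
      + (a' (y - x) / norm (y - x)) *\<^sub>R (\<beta> y - \<beta> x)
      = (a y *\<^sub>R \<beta> y - a x *\<^sub>R \<beta> x - a' (y - x) *\<^sub>R \<beta> x) /\<^sub>R norm (y - x)" for y
    by (simp add: assms(2) algebra_simps divide_inverse_commute)
  ultimately have "((\<lambda>y. (a y *\<^sub>R \<beta> y - a x *\<^sub>R \<beta> x - a' (y - x) *\<^sub>R \<beta> x) /\<^sub>R norm (y - x)) \<longlongrightarrow> 0) (at x)"
    by (simp only:)
  moreover have "bounded_linear (\<lambda>h. a' h *\<^sub>R \<beta> x)"
    using bounded_linear_compose[OF bounded_linear_scaleR_left bl] .
  ultimately show ?thesis
    by (simp add: has_derivative_at_within diff_diff_eq)
qed

text \<open>The bound \<open>C\<close>, uniform in \<open>x\<close>, makes \<open>B\<close>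
  continuous. After that the derivative of the inverse is minus \<open>B\<close>, the derivative of
  \<open>A\<close>, and \<open>B\<close> composed, so each order of smoothness of \<open>A\<close>
  carries over to \<open>B\<close> by induction.\<close>

lemma Ck_on_linear_inverse:
  fixes A B :: "'a::real_normed_vector \<Rightarrow> 'b::euclidean_space \<Rightarrow> 'b"
  assumes U: "open U" and lin: "\<And>x. x \<in> U \<Longrightarrow> linear (A x)"
    and AB: "\<And>x v. x \<in> U \<Longrightarrow> A x (B x v) = v" and BA: "\<And>x v. x \<in> U \<Longrightarrow> B x (A x v) = v"
    and bound: "\<And>x v. x \<in> U \<Longrightarrow> norm (B x v) \<le> C * norm v"
    and A: "\<And>v. Ck_on n U (\<lambda>x. A x v)"
  shows "Ck_on n U (\<lambda>x. B x v)"
  using A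
proof (induction n arbitrary: v)
  have linB: "linear (B x)" if "x \<in> U" for x
  proof
    show "B x (a + b) = B x a + B x b" for a b
      using linear_add[OF lin[OF that], of "B x a" "B x b"] AB[OF that] BA[OF that] by metis
    show "B x (r *\<^sub>R b) = r *\<^sub>R B x b" for r b
      using linear_scale[OF lin[OF that], of r "B x b"] AB[OF that] BA[OF that] by metis
  qed
  \<comment> \<open>This is the resolvent identity: the difference of two inverses expressed through
    the difference of the operators.\<close>
  have step: "B y v = B x v - B y (A y (B x v) - A x (B x v))" if "x \<in> U" "y \<in> U" for x y v
    using linear_diff[OF linB[OF that(2)], of "A y (B x v)" "A x (B x v)"] that by (simp add: AB BA)
  {
    case 0
    show ?case unfolding Ck_on.simps
    proof (rule continuous_at_imp_continuous_on, rule ballI)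
      fix x assume x: "x \<in> U"
      let ?w = "B x v"
      have "isCont (\<lambda>y. A y ?w) x" using 0 x U by (simp add: continuous_on_eq_continuous_at)
      then have "((\<lambda>y. C * norm (A y ?w - A x ?w)) \<longlongrightarrow> 0) (at x)"
        by (intro tendsto_mult_right_zero tendsto_norm_zero) (simp add: isCont_def LIM_zero_iff)
      moreover have "\<forall>\<^sub>F y in at x. norm (B y v - B x v) \<le> C * norm (A y ?w - A x ?w)"
        unfolding eventually_at_topological
      proof (intro exI conjI ballI impI)
        fix y assume "y \<in> U"
        then have "B y v - B x v = - B y (A y ?w - A x ?w)" using step[OF x, of y v] by simp
        then show "norm (B y v - B x v) \<le> C * norm (A y ?w - A x ?w)"
          using bound[OF \<open>y \<in> U\<close>, of "A y ?w - A x ?w"] by simp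
      qed (use U x in auto)
      ultimately have "((\<lambda>y. B y v - B x v) \<longlongrightarrow> 0) (at x)"
        by (rule Lim_null_comparison[rotated])
      then show "isCont (\<lambda>y. B y v) x" by (simp add: isCont_def LIM_zero_iff)
    qed
  next
    case (Suc n)
    have An: "Ck_on n U (\<lambda>x. A x v)" for v using Ck_on_SucD[OF Suc.prems] .
    let ?A' = "\<lambda>b x. frechet_derivative (\<lambda>y. A y b) (at x)"
    \<comment> \<open>The derivative at \<open>x\<close> of \<open>A y w\<close> in
      \<open>y\<close>, with \<open>w = B x v\<close> held fixed. Writing \<open>w\<close> in the
      basis leaves \<open>x\<close> only in the coefficients and in partial derivatives of fixed
      columns of \<open>A\<close>, so the induction hypothesis applies to it later.\<close>
    let ?\<phi>' = "\<lambda>x h. \<Sum>b\<in>Basis. (B x v \<bullet> b) *\<^sub>R ?A' b x h"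
    show ?case
    proof (rule Ck_on_SucI[OF U])
      fix x assume x: "x \<in> U"
      let ?w = "B x v"
      have "((\<lambda>y. \<Sum>b\<in>Basis. (?w \<bullet> b) *\<^sub>R A y b) has_derivative ?\<phi>' x) (at x)"
        using Ck_on_frechet[OF Suc.prems x] by (intro has_derivative_sum has_derivative_scaleR_right) auto
      moreover have expand: "(\<Sum>b\<in>Basis. (?w \<bullet> b) *\<^sub>R A y b) = A y ?w" if "y \<in> U" for y
        using linear_sum[OF lin[OF that], of "\<lambda>b. (?w \<bullet> b) *\<^sub>R b" Basis]
        by (simp add: euclidean_representation linear_scale[OF lin[OF that]])
      ultimately have \<phi>: "((\<lambda>y. A y ?w) has_derivative ?\<phi>' x) (at x)"
        using has_derivative_transform_within_open[OF _ U x] by (smt (verit, best))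
      have cont: "isCont (\<lambda>y. B y b) x" for b
        using Ck_on_imp_continuous_on[OF Suc.IH[OF An]] x U by (simp add: continuous_on_eq_continuous_at)
      \<comment> \<open>By \<open>step\<close> this expression is \<open>B y v\<close>. Its
        coefficients vanish at \<open>y = x\<close>, so continuity of the columns
        \<open>B y b\<close> is enough to differentiate it.\<close>
      have "((\<lambda>y. ?w - (\<Sum>b\<in>Basis. ((A y ?w - A x ?w) \<bullet> b) *\<^sub>R B y b)) has_derivative
          (\<lambda>h. 0 - (\<Sum>b\<in>Basis. (?\<phi>' x h \<bullet> b) *\<^sub>R B x b))) (at x)"
      proof (intro has_derivative_diff has_derivative_const has_derivative_sum
          has_derivative_scaleR_vanishing cont)
        fix b :: 'b
        show "((\<lambda>y. (A y ?w - A x ?w) \<bullet> b) has_derivative (\<lambda>h. ?\<phi>' x h \<bullet> b)) (at x)"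
          using has_derivative_inner_left[OF has_derivative_diff[OF \<phi> has_derivative_const[of "A x ?w"]], of b]
          by simp
      qed auto
      moreover have "?w - (\<Sum>b\<in>Basis. ((A y ?w - A x ?w) \<bullet> b) *\<^sub>R B y b) = B y v" if y: "y \<in> U" for y
      proof -
        let ?u = "A y ?w - A x ?w"
        have "(\<Sum>b\<in>Basis. (?u \<bullet> b) *\<^sub>R B y b) = B y ?u"
          using linear_sum[OF linB[OF y], of "\<lambda>b. (?u \<bullet> b) *\<^sub>R b" Basis]
          by (simp only: euclidean_representation linear_scale[OF linB[OF y]])
        then show ?thesis using step[OF x y, of v] by metis
      qed
      ultimately show "((\<lambda>y. B y v) has_derivative
          (\<lambda>h. 0 - (\<Sum>b\<in>Basis. (?\<phi>' x h \<bullet> b) *\<^sub>R B x b))) (at x)"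
        by (rule has_derivative_transform_within_open[OF _ U x])
    next
      fix h
      have "Ck_on n U (\<lambda>x. ?A' b x h)" for b using Suc.prems by simp
      then have "Ck_on n U (\<lambda>x. \<Sum>b\<in>Basis. (?\<phi>' x h \<bullet> b) *\<^sub>R B x b)"
        by (intro Ck_on_sum[OF U] Ck_on_scaleR[OF U] Suc.IH An
          Ck_on_bounded_linear[OF bounded_linear_inner_left U])
      from Ck_on_bounded_linear[OF bounded_linear_minus[OF bounded_linear_ident] U this]
      show "Ck_on n U (\<lambda>x. 0 - (\<Sum>b\<in>Basis. (?\<phi>' x h \<bullet> b) *\<^sub>R B x b))"
        by simp
    qed
  }
qed

text \<open>The inverse function theorem provides a differentiable inverse whose derivative at
  \<open>y\<close> is the inverse of the derivative of \<open>f\<close> at \<open>g y\<close>. If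
  \<open>g\<close> is of class n, so is this expression, hence \<open>g\<close> is of class n + 1.
  Normalising the derivative at \<open>x0\<close> to the identity gives the uniform bound on inverse
  operators that \<open>Ck_on_linear_inverse\<close> asks for.\<close>

lemma smooth_local_inverse:
  fixes f :: "'a::euclidean_space \<Rightarrow> 'a"
  assumes U: "open U" "x0 \<in> U" and f: "\<And>n. Ck_on n U f"
    and id: "(f has_derivative (\<lambda>v. v)) (at x0)"
  obtains U' V g where "open U'" "U' \<subseteq> U" "x0 \<in> U'" "open V" "f x0 \<in> V" "homeomorphism U' V f g"
    "\<And>n. Ck_on n V g"
proof -
  let ?D = "\<lambda>x. frechet_derivative f (at x)"
  define f' where "f' x = Blinfun (?D x)" for x
  have der: "(f has_derivative ?D x) (at x)" if "x \<in> U" for x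
    using Ck_on_frechet[OF f that] .
  have f': "blinfun_apply (f' x) = ?D x" if "x \<in> U" for x
    unfolding f'_def using der[OF that] by (intro bounded_linear_Blinfun_apply has_derivative_bounded_linear)
  have "continuous_on U (\<lambda>x. ?D x v)" for v
    using f[of "Suc 0"] by simp
  then have cont: "continuous_on U f'"
    using f' by (intro continuous_on_blinfun_componentwise) (simp cong: continuous_on_cong)
  \<comment> \<open>Within distance 1/2 of the identity, an invertible operator has an inverse of
    norm at most 2.\<close>
  define U1 where "U1 = {x\<in>U. norm (f' x - id_blinfun) < 1/2}"
  have "open U1"
  proof -
    have "continuous_on U (\<lambda>x. norm (f' x - id_blinfun))"
      by (intro continuous_intros cont)
    from continuous_open_preimage[OF this U(1) open_lessThan[of "1/2"]]
    show ?thesis by (simp add: U1_def vimage_def Int_def lessThan_def)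
  qed
  have "f' x0 = id_blinfun"
    using id U(2) by (intro blinfun_eqI) (simp add: f' frechet_derivative_at[OF id, symmetric])
  then have "x0 \<in> U1" using U by (simp add: U1_def)
  moreover have "id_blinfun o\<^sub>L f' x0 = id_blinfun"
    unfolding \<open>f' x0 = id_blinfun\<close> by (rule blinfun_eqI) simp
  moreover have "continuous_on U1 f'" by (rule continuous_on_subset[OF cont]) (auto simp: U1_def)
  moreover have "(f has_derivative blinfun_apply (f' x)) (at x)" if "x \<in> U1" for x
    using der f' that by (simp add: U1_def)
  ultimately obtain U' V g g' where *: "open U'" "U' \<subseteq> U1" "x0 \<in> U'" "open V" "f x0 \<in> V"
      "homeomorphism U' V f g" and g': "\<And>y. y \<in> V \<Longrightarrow> (g has_derivative g' y) (at y)"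
      "\<And>y. y \<in> V \<Longrightarrow> g' y = inv_into UNIV (blinfun_apply (f' (g y)))"
      "\<And>y. y \<in> V \<Longrightarrow> bij (blinfun_apply (f' (g y)))"
    using inverse_function_theorem[OF \<open>open U1\<close>] by metis
  have gV: "g ` V = U'" and fU': "f ` U' = V" and contg: "continuous_on V g"
    and gf: "\<And>x. x \<in> U' \<Longrightarrow> g (f x) = x"
    using *(6) by (auto simp: homeomorphism_def)
  have sub: "U' \<subseteq> U" using *(2) U1_def by auto
  define B where "B x = inv_into UNIV (?D x)" for x
  have bij: "bij (?D x)" if "x \<in> U'" for x
    using g'(3)[of "f x"] gf[OF that] f' that sub fU' by auto
  have smoothB: "Ck_on n U' (\<lambda>x. B x v)" for n v
  proof (rule Ck_on_linear_inverse[OF *(1)])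
    fix x v assume x: "x \<in> U'"
    show "linear (?D x)" using der x sub has_derivative_linear by blast
    show AB: "?D x (B x v) = v" unfolding B_def using bij[OF x] by (simp add: bij_is_surj surj_f_inv_f)
    show "B x (?D x v) = v" unfolding B_def using bij[OF x] by (simp add: bij_is_inj inv_f_f)
    \<comment> \<open>Applied to \<open>B x v\<close>, the operator \<open>f' x - id_blinfun\<close>
      gives \<open>v - B x v\<close>. So the norm of \<open>B x v\<close> is at most that of
      \<open>v\<close> plus half of itself, whence the constant 2.\<close>
    have "norm (f' x - id_blinfun) \<le> 1/2" using x *(2) U1_def by auto
    then have "norm (blinfun_apply (f' x - id_blinfun) (B x v)) \<le> 1/2 * norm (B x v)"
      by (meson norm_blinfun order_trans mult_right_mono norm_ge_zero)
    then have "norm (v - B x v) \<le> 1/2 * norm (B x v)"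
      using x sub AB by (simp add: blinfun.diff_left f' subset_iff)
    then show "norm (B x v) \<le> 2 * norm v"
      using norm_triangle_sub[of "B x v" v] by (simp add: norm_minus_commute)
  next
    show "Ck_on n U' (\<lambda>x. ?D x v)" for n v
      using f[of "Suc n"] by (intro Ck_on_subset[OF _ sub]) simp
  qed
  have "Ck_on n V g" for n
  proof (induction n)
    case 0
    then show ?case using contg by simp
  next
    case (Suc n)
    show ?case
    proof (rule Ck_on_SucI[OF *(4) g'(1)])
      have "Ck_on n V (\<lambda>y. B (g y) v)" for v
        using Ck_on_compose[OF *(4,1) _ Suc smoothB] gV by simp
      then show "Ck_on n V (\<lambda>y. g' y v)" for v
        by (rule Ck_on_cong[OF *(4), rotated])
          (use g'(2) f' gV sub in \<open>auto simp: B_def\<close>)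
    qed
  qed
  then show thesis using that[OF *(1) sub *(3-6)] by blast
qed

text \<open>The orthogonal projection, written in an orthonormal basis; both norm bounds are
  Pythagoras. In the invariance argument the first keeps the foot of a perpendicular inside a ball,
  and the second passes a Lipschitz bound on to normal components.\<close>

lemma subspace_projection:
  fixes V :: "'a::euclidean_space set"
  assumes "subspace V"
  obtains P where "bounded_linear P" "\<And>x. P x \<in> V" "\<And>x. x \<in> V \<Longrightarrow> P x = x"
    "\<And>x. norm (P x) \<le> norm x" "\<And>x. norm (x - P x) \<le> norm x"
proof -
  obtain B where B: "B \<subseteq> V" "pairwise orthogonal B" "\<And>x. x \<in> B \<Longrightarrow> norm x = 1"
    "independent B" "span B = V"
    using orthonormal_basis_subspace[OF assms] by metis
  have fin: "finite B" using B(4) independent_imp_finite by blast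
  define P where "P x = (\<Sum>b\<in>B. (x \<bullet> b) *\<^sub>R b)" for x
  have PV: "P x \<in> V" for x
    unfolding P_def using B assms by (intro subspace_sum subspace_scale) auto
  have inner: "P x \<bullet> c = x \<bullet> c" if "c \<in> B" for x c
  proof -
    have "P x \<bullet> c = (\<Sum>b\<in>B. if b = c then x \<bullet> c else 0)"
      unfolding P_def inner_sum_left
    proof (rule sum.cong)
      fix b assume "b \<in> B"
      then show "(x \<bullet> b) *\<^sub>R b \<bullet> c = (if b = c then x \<bullet> c else 0)"
        using B(2,3) that
        by (auto simp: pairwise_def orthogonal_def norm_eq_1)
    qed simp
    then show ?thesis using that fin by simp
  qed
  have orth: "(x - P x) \<bullet> v = 0" if "v \<in> V" for x v
  proof -
    have "orthogonal (x - P x) v"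
    proof (rule orthogonal_to_span)
      show "v \<in> span B" using that B by simp
      show "orthogonal (x - P x) c" if "c \<in> B" for c
        using inner[OF that] by (simp add: orthogonal_def inner_diff_left)
    qed
    then show ?thesis by (simp add: orthogonal_def)
  qed
  have pyth: "(norm x)\<^sup>2 = (norm (x - P x))\<^sup>2 + (norm (P x))\<^sup>2" for x
    using norm_add_Pythagorean[of "x - P x" "P x"] orth[OF PV] by (simp add: orthogonal_def)
  show thesis
  proof
    show "bounded_linear P" unfolding P_def
      by (intro bounded_linear_sum bounded_linear_scaleR_const bounded_linear_inner_left)
    show "P x = x" if "x \<in> V" for x
    proof -
      have "(x - P x) \<bullet> (x - P x) = 0" using orth[of "x - P x" x] that PV assms subspace_diff by blast
      then show ?thesis by simp
    qed
    show "norm (P x) \<le> norm x" for x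
      by (rule power2_le_imp_le[OF _ norm_ge_zero]) (simp add: pyth[of x])
    show "norm (x - P x) \<le> norm x" for x
      by (rule power2_le_imp_le[OF _ norm_ge_zero]) (simp add: pyth[of x])
  qed (rule PV)
qed

text \<open>The linear right inverse of the derivative gives an approximate section; the inverse
  function theorem corrects it to an exact one.\<close>

lemma smooth_local_section:
  fixes g :: "'a::euclidean_space \<Rightarrow> 'b::euclidean_space"
  assumes U: "open U" "p0 \<in> U" and g: "\<And>n. Ck_on n U g"
    and V: "subspace V" and W: "subspace W" and p0: "p0 \<in> V"
    and onto: "W \<subseteq> frechet_derivative g (at p0) ` V"
    and into: "\<And>p. p \<in> U \<Longrightarrow> p \<in> V \<Longrightarrow> g p \<in> W"
  obtains T \<sigma> where "open T" "g p0 \<in> T" "\<And>n. Ck_on n T \<sigma>" "\<sigma> ` T \<subseteq> U \<inter> V" "\<sigma> (g p0) = p0"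
    "\<And>q. q \<in> T \<Longrightarrow> q \<in> W \<Longrightarrow> g (\<sigma> q) = q"
proof -
  let ?D = "frechet_derivative g (at p0)"
  have der: "(g has_derivative ?D) (at p0)" using Ck_on_frechet[OF g U(2)] .
  have linD: "linear ?D" using der has_derivative_linear by blast
  obtain P where P: "bounded_linear P" "\<And>x. P x \<in> W" "\<And>x. x \<in> W \<Longrightarrow> P x = x"
    using subspace_projection[OF W] by metis
  obtain B where B: "B \<subseteq> W" "independent B" "W \<subseteq> span B"
    using basis_exists[of W] by metis
  have "\<forall>b\<in>B. \<exists>v\<in>V. ?D v = b" using onto B by blast
  then obtain l where l: "\<And>b. b \<in> B \<Longrightarrow> l b \<in> V \<and> ?D (l b) = b" by metis
  \<comment> \<open>\<open>L\<close> lifts a basis of \<open>W\<close> to preimages in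
    \<open>V\<close>, so on \<open>W\<close> it is a right inverse of \<open>?D\<close> with values
    in \<open>V\<close>.\<close>
  obtain L where L: "linear L" "\<And>b. b \<in> B \<Longrightarrow> L b = l b"
    using linear_independent_extend[OF B(2), of l] by blast
  have LV: "L w \<in> V" if "w \<in> W" for w
  proof -
    have "L w \<in> span (L ` B)" using that B linear_span_image[OF L(1)] by blast
    then show ?thesis using span_minimal[OF _ V, of "L ` B"] l L by auto
  qed
  have DL: "?D (L w) = w" if "w \<in> W" for w
    using linear_eq_on[OF linear_compose[OF L(1) linD] linear_id, of w B] that B l L by auto
  have blL: "bounded_linear L" using L(1) linear_conv_bounded_linear by blast
  \<comment> \<open>All values of \<open>e\<close> lie in \<open>V\<close>, so the section
    \<open>e\<close> after \<open>k\<close> stays in \<open>V\<close> without further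
    argument.\<close>
  define e where "e w = p0 + L (P w)" for w
  have eV: "e w \<in> V" for w unfolding e_def using V p0 LV P subspace_add by blast
  have bLP: "bounded_linear (\<lambda>w. L (P w))" using bounded_linear_compose[OF blL P(1)] .
  have Cke: "Ck_on n S e" if "open S" for n S
    unfolding e_def by (intro Ck_on_add that Ck_on_const Ck_on_linear[OF bLP])
  define U1 where "U1 = e -` U"
  have "open U1"
    unfolding U1_def using open_vimage[OF U(1)] Cke[OF open_UNIV, of 0] by simp
  have e0: "e 0 = p0" using linear_0[OF L(1)] linear_simps(3)[OF P(1)] by (simp add: e_def)
  then have "0 \<in> U1" using U(2) by (simp add: U1_def)
  \<comment> \<open>The summand \<open>w - P w\<close> supplies the identity on the complement of
    \<open>W\<close>. Together with \<open>?D (L w) = w\<close> on \<open>W\<close> it makes the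
    derivative of \<open>f\<close> at 0 the identity of the whole space.\<close>
  define f where "f w = P (g (e w)) + (w - P w)" for w
  have Ckf: "Ck_on n U1 f" for n
    unfolding f_def
  proof (intro Ck_on_add \<open>open U1\<close> Ck_on_bounded_linear[OF P(1)])
    show "Ck_on n U1 (\<lambda>w. g (e w))"
      by (rule Ck_on_compose[OF \<open>open U1\<close> U(1) _ Cke[OF \<open>open U1\<close>] g]) (auto simp: U1_def)
    show "Ck_on n U1 (\<lambda>w. w - P w)"
      by (intro Ck_on_linear bounded_linear_sub bounded_linear_ident P(1) \<open>open U1\<close>)
  qed
  have "(e has_derivative (\<lambda>v. 0 + L (P v))) (at 0)"
    unfolding e_def by (intro has_derivative_add has_derivative_const
        bounded_linear_imp_has_derivative bLP)
  then have "((\<lambda>w. g (e w)) has_derivative (\<lambda>v. ?D (L (P v)))) (at 0)"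
    using diff_chain_at[of e _ 0 g ?D] der e0 by (simp add: o_def)
  then have "(f has_derivative (\<lambda>v. P (?D (L (P v))) + (v - P v))) (at 0)"
    unfolding f_def by (intro has_derivative_add has_derivative_diff has_derivative_ident
        bounded_linear.has_derivative[OF P(1)] bounded_linear_imp_has_derivative P(1))
  then have "(f has_derivative (\<lambda>v. v)) (at 0)" using P DL by simp
  then obtain U' T k where k: "open U'" "U' \<subseteq> U1" "0 \<in> U'" "open T" "f 0 \<in> T" "homeomorphism U' T f k"
    "\<And>n. Ck_on n T k"
    by (rule smooth_local_inverse[OF \<open>open U1\<close> \<open>0 \<in> U1\<close> Ckf]) blast
  have gW: "g (e w) \<in> W" if "w \<in> U1" for w
    using into[OF _ eV] that by (simp add: U1_def)
  have f0: "f 0 = g p0"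
    using P(3)[OF gW[of 0]] e0 U(2) linear_simps(3)[OF P(1)] by (simp add: f_def U1_def)
  have kT: "k q \<in> U1" "f (k q) = q" if "q \<in> T" for q
    using k that by (auto simp: homeomorphism_def)
  show thesis
  proof (rule that[of T "\<lambda>q. e (k q)"])
    show "open T" "g p0 \<in> T" using k f0 by auto
    show "Ck_on n T (\<lambda>q. e (k q))" for n
      using Ck_on_compose[OF \<open>open T\<close> open_UNIV _ k(7) Cke[OF open_UNIV]] by simp
    show "(\<lambda>q. e (k q)) ` T \<subseteq> U \<inter> V"
      using kT eV by (auto simp: U1_def)
    show "e (k (g p0)) = p0"
      using k(3,6) f0 e0 by (metis homeomorphism_def)
    show "g (e (k q)) = q" if "q \<in> T" "q \<in> W" for q
    proof -
      \<comment> \<open>Applying \<open>P\<close> removes the auxiliary summand of \<open>f\<close>,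
        since \<open>P\<close> kills \<open>w - P w\<close>.\<close>
      have "q = P (f (k q))" using kT(2)[OF that(1)] P(3)[OF that(2)] by simp
      also have "\<dots> = P (g (e (k q)))"
        unfolding f_def using P by (simp add: linear_simps(1,2)[OF P(1)])
      also have "\<dots> = g (e (k q))" using P(3)[OF gW] kT(1)[OF that(1)] by simp
      finally show ?thesis ..
    qed
  qed
qed

section \<open>Gronwall and Lipschitz estimates\<close>

lemma vector_derivative_gronwall_zero:
  fixes u :: "real \<Rightarrow> 'a::real_inner"
  assumes I: "is_interval I"
    and u: "\<And>t. t \<in> I \<Longrightarrow> (u has_vector_derivative u' t) (at t)"
    and bound: "\<And>t. t \<in> I \<Longrightarrow> norm (u' t) \<le> L * norm (u t)"
    and t0: "t0 \<in> I" "u t0 = 0" and t: "t \<in> I"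
  shows "u t = 0"
proof -
  \<comment> \<open>The squared norm of \<open>u\<close> has derivative at most \<open>2 * L\<close>
    times itself in absolute value. The exponential weight with \<open>c = - 2 * L\<close> makes the
    product nonincreasing, which serves times after \<open>t0\<close>; with \<open>c = 2 * L\<close>
    it is nondecreasing, which serves times before \<open>t0\<close>. In both cases the product is
    nonnegative and vanishes at \<open>t0\<close>.\<close>
  define \<phi> where "\<phi> c s = (u s \<bullet> u s) * exp (c * s)" for c s
  have der: "(\<phi> c has_real_derivative (2 * (u s \<bullet> u' s) + c * (u s \<bullet> u s)) * exp (c * s)) (at s)"
    if "s \<in> I" for c s
  proof -
    have "((\<lambda>s. u s \<bullet> u s) has_derivative (\<lambda>h. u s \<bullet> (h *\<^sub>R u' s) + (h *\<^sub>R u' s) \<bullet> u s)) (at s)"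
      using u[OF that] by (intro has_derivative_inner) (simp_all add: has_vector_derivative_def)
    then have "((\<lambda>s. u s \<bullet> u s) has_real_derivative 2 * (u s \<bullet> u' s)) (at s)"
      by (simp add: has_field_derivative_def inner_commute mult_commute_abs algebra_simps)
    then show ?thesis unfolding \<phi>_def
      by (auto intro!: derivative_eq_intros simp: algebra_simps)
  qed
  have abs: "\<bar>2 * (u s \<bullet> u' s)\<bar> \<le> 2 * L * (u s \<bullet> u s)" if "s \<in> I" for s
  proof -
    have "\<bar>u s \<bullet> u' s\<bar> \<le> norm (u s) * norm (u' s)" by (rule Cauchy_Schwarz_ineq2)
    also have "\<dots> \<le> norm (u s) * (L * norm (u s))" by (intro mult_left_mono bound that) simp
    finally show ?thesis by (simp add: dot_square_norm power2_eq_square algebra_simps)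
  qed
  have seg: "s \<in> I" if "a \<le> s" "s \<le> b" "a \<in> I" "b \<in> I" for a b s
    using I that unfolding is_interval_1 by blast
  have "u t \<bullet> u t \<le> 0"
  proof (cases "t0 \<le> t")
    case True
    have "\<phi> (- 2 * L) t \<le> \<phi> (- 2 * L) t0"
    proof (rule DERIV_nonpos_imp_nonincreasing[OF True])
      fix s assume "t0 \<le> s" "s \<le> t"
      then have s: "s \<in> I" using seg t0 t by blast
      have "(2 * (u s \<bullet> u' s) + - 2 * L * (u s \<bullet> u s)) * exp (- 2 * L * s) \<le> 0"
        using abs[OF s] by (intro mult_nonpos_nonneg) auto
      then show "\<exists>y. (\<phi> (- 2 * L) has_real_derivative y) (at s) \<and> y \<le> 0" using der[OF s] by blast
    qed
    then show ?thesis using t0 by (simp add: \<phi>_def mult_le_0_iff)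
  next
    case False
    then have le: "t \<le> t0" by simp
    have "\<phi> (2 * L) t \<le> \<phi> (2 * L) t0"
    proof (rule DERIV_nonneg_imp_nondecreasing[OF le])
      fix s assume "t \<le> s" "s \<le> t0"
      then have s: "s \<in> I" using seg t0 t by blast
      have "0 \<le> (2 * (u s \<bullet> u' s) + 2 * L * (u s \<bullet> u s)) * exp (2 * L * s)"
        using abs[OF s] by (intro mult_nonneg_nonneg) auto
      then show "\<exists>y. (\<phi> (2 * L) has_real_derivative y) (at s) \<and> 0 \<le> y" using der[OF s] by blast
    qed
    then show ?thesis using t0 by (simp add: \<phi>_def mult_le_0_iff)
  qed
  then show ?thesis using inner_ge_zero[of "u t"] by (metis inner_eq_zero_iff order_antisym)
qed

lemma C1_locally_lipschitz:
  fixes f :: "'a::euclidean_space \<Rightarrow> 'b::real_normed_vector"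
  assumes "open U" "Ck_on (Suc 0) U f" "x \<in> U"
  obtains r L where "r > 0" "ball x r \<subseteq> U"
    "\<And>y z. y \<in> ball x r \<Longrightarrow> z \<in> ball x r \<Longrightarrow> norm (f y - f z) \<le> L * norm (y - z)"
proof -
  let ?D = "\<lambda>y. frechet_derivative f (at y)"
  \<comment> \<open>The sum of the norms of the partial derivatives dominates the operator norm and
    is visibly continuous; on a ball where it stays below \<open>B x + 1\<close>, the mean value
    inequality applies because balls are convex.\<close>
  define B where "B y = (\<Sum>b\<in>Basis. norm (?D y b))" for y
  have "continuous_on U B"
    unfolding B_def using assms(2) by (intro continuous_intros) simp
  then have "open (U \<inter> B -` {..<B x + 1})"
    by (rule continuous_open_preimage[OF _ assms(1)]) simp
  moreover have "x \<in> U \<inter> B -` {..<B x + 1}" using assms(3) by simp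
  ultimately obtain r where r: "r > 0" "ball x r \<subseteq> U \<inter> B -` {..<B x + 1}"
    using openE by blast
  have "norm (f y - f z) \<le> (B x + 1) * norm (y - z)" if "y \<in> ball x r" "z \<in> ball x r" for y z
  proof (rule differentiable_bound[of "ball x r" f ?D])
    fix w assume w: "w \<in> ball x r"
    then have der: "(f has_derivative ?D w) (at w)" using r Ck_on_frechet[OF assms(2)] by blast
    then show "(f has_derivative ?D w) (at w within ball x r)" by (rule has_derivative_at_withinI)
    have lin: "linear (?D w)" using der has_derivative_linear by blast
    show "onorm (?D w) \<le> B x + 1"
    proof (rule onorm_le)
      fix v
      have "?D w v = (\<Sum>b\<in>Basis. (v \<bullet> b) *\<^sub>R ?D w b)"
        using linear_sum[OF lin, of "\<lambda>b. (v \<bullet> b) *\<^sub>R b" Basis]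
        by (simp add: euclidean_representation linear_scale[OF lin])
      also have "norm \<dots> \<le> (\<Sum>b\<in>Basis. norm v * norm (?D w b))"
        by (rule sum_norm_le) (simp add: Basis_le_norm mult_right_mono)
      also have "\<dots> = B w * norm v" by (simp add: B_def sum_distrib_left mult.commute)
      also have "\<dots> \<le> (B x + 1) * norm v" using r w by (intro mult_right_mono) auto
      finally show "norm (?D w v) \<le> (B x + 1) * norm v" .
    qed
  qed (use that in auto)
  with r show thesis using that[of r "B x + 1"] by blast
qed

section \<open>Germs of smooth functions in coordinates\<close>

text \<open>Smoothness without an inverse of \<open>\<phi>\<close>: the germ of \<open>f\<close>
  factors through \<open>\<phi>\<close>. In this form it composes without tracking chart images, and
  it passes to submanifolds with the same factor \<open>g\<close>, since only the topology
  changes.\<close>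

definition smooth_in ::
    "'a topology \<Rightarrow> ('a \<Rightarrow> 'e::euclidean_space) \<Rightarrow> ('a \<Rightarrow> 'b::real_normed_vector) \<Rightarrow> 'a \<Rightarrow> bool" where
  "smooth_in T \<phi> f x \<longleftrightarrow> (\<exists>U g A. open U \<and> (\<forall>n. Ck_on n U g) \<and> openin T A \<and> x \<in> A \<and> \<phi> ` A \<subseteq> U \<and>
     (\<forall>y\<in>A. f y = g (\<phi> y)))"

text \<open>Continuity at one point with no domain attached, to accompany \<open>smooth_in\<close>.
  It is vacuous when \<open>F x\<close> lies outside the target space, so membership in the target
  is always tracked separately.\<close>

definition continuous_germ :: "'a topology \<Rightarrow> 'b topology \<Rightarrow> ('a \<Rightarrow> 'b) \<Rightarrow> 'a \<Rightarrow> bool" where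
  "continuous_germ T T' F x \<longleftrightarrow>
     (\<forall>B. openin T' B \<and> F x \<in> B \<longrightarrow> (\<exists>A. openin T A \<and> x \<in> A \<and> F ` A \<subseteq> B))"

lemma continuous_germI:
  assumes "continuous_map (subtopology T D) T' F" "openin T D" "x \<in> D"
  shows "continuous_germ T T' F x"
  unfolding continuous_germ_def
proof (intro allI impI)
  fix B assume B: "openin T' B \<and> F x \<in> B"
  have "openin (subtopology T D) {y \<in> topspace (subtopology T D). F y \<in> B}"
    using assms(1) B openin_continuous_map_preimage by blast
  then have "openin T {y \<in> topspace (subtopology T D). F y \<in> B}"
    using assms(2) openin_trans_full by blast
  moreover have "x \<in> topspace (subtopology T D)"
    using assms(2,3) openin_subset by fastforce
  ultimately show "\<exists>A. openin T A \<and> x \<in> A \<and> F ` A \<subseteq> B" using B by blast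
qed

text \<open>Continuity of \<open>F\<close> is a separate hypothesis because smoothness of
  \<open>\<psi> \<circ> F\<close> alone does not put \<open>F y\<close> into the neighbourhood where
  \<open>f\<close> factors through \<open>\<psi>\<close>: coordinate maps are arbitrary outside
  their chart domains.\<close>

lemma smooth_in_compose:
  assumes F: "continuous_germ T T' F x" and \<psi>: "smooth_in T \<phi> (\<psi> \<circ> F) x" and f: "smooth_in T' \<psi> f (F x)"
  shows "smooth_in T \<phi> (f \<circ> F) x"
proof -
  obtain U g A where g: "open U" "\<And>n. Ck_on n U g" "openin T' A" "F x \<in> A" "\<psi> ` A \<subseteq> U"
      "\<And>y. y \<in> A \<Longrightarrow> f y = g (\<psi> y)"
    using f unfolding smooth_in_def by blast
  obtain U1 g1 A1 where g1: "open U1" "\<And>n. Ck_on n U1 g1" "openin T A1" "x \<in> A1" "\<phi> ` A1 \<subseteq> U1"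
      "\<And>y. y \<in> A1 \<Longrightarrow> \<psi> (F y) = g1 (\<phi> y)"
    using \<psi> unfolding smooth_in_def comp_def by blast
  obtain A2 where A2: "openin T A2" "x \<in> A2" "F ` A2 \<subseteq> A"
    using F g(3,4) unfolding continuous_germ_def by blast
  define U' where "U' = U1 \<inter> g1 -` U"
  have "open U'"
    unfolding U'_def using continuous_open_preimage[OF Ck_on_imp_continuous_on[OF g1(2)] g1(1) g(1)] .
  moreover have "Ck_on n U' (\<lambda>p. g (g1 p))" for n
    by (rule Ck_on_compose[OF \<open>open U'\<close> g(1) _ Ck_on_subset[OF g1(2)] g(2)]) (auto simp: U'_def)
  moreover have "openin T (A1 \<inter> A2)" "x \<in> A1 \<inter> A2" using g1 A2 by auto
  moreover have "\<phi> ` (A1 \<inter> A2) \<subseteq> U'"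
  proof
    fix p assume "p \<in> \<phi> ` (A1 \<inter> A2)"
    then obtain y where y: "y \<in> A1" "y \<in> A2" "p = \<phi> y" by blast
    then have "\<psi> (F y) \<in> U" using A2 g by blast
    then show "p \<in> U'" unfolding U'_def using y g1(5) g1(6)[OF y(1)] by auto
  qed
  moreover have "(f \<circ> F) y = g (g1 (\<phi> y))" if "y \<in> A1 \<inter> A2" for y
  proof -
    have "F y \<in> A" using that A2 by blast
    then show ?thesis using g(6) g1(6)[of y] that by simp
  qed
  ultimately show ?thesis unfolding smooth_in_def by blast
qed

lemma smooth_in_trans:
  assumes "smooth_in T \<phi> \<psi> x" "smooth_in T \<psi> f x"
  shows "smooth_in T \<phi> f x"
proof -
  have "continuous_germ T T (\<lambda>y. y) x" unfolding continuous_germ_def by blast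
  from smooth_in_compose[OF this, of \<phi> \<psi> f] assms show ?thesis by (simp add: o_def)
qed

lemma smooth_in_cong:
  assumes "smooth_in T \<phi> f x" "openin T A" "x \<in> A" "\<And>y. y \<in> A \<Longrightarrow> f y = f' y"
  shows "smooth_in T \<phi> f' x"
proof -
  obtain U g B where *: "open U" "\<forall>n. Ck_on n U g" "openin T B" "x \<in> B" "\<phi> ` B \<subseteq> U"
      "\<And>y. y \<in> B \<Longrightarrow> f y = g (\<phi> y)"
    using assms(1) unfolding smooth_in_def by blast
  show ?thesis unfolding smooth_in_def
    by (intro exI[of _ U] exI[of _ g] exI[of _ "A \<inter> B"]) (use * assms in fastforce)
qed

lemma smooth_in_subtopology:
  assumes "smooth_in T \<phi> f x" "x \<in> S"
  shows "smooth_in (subtopology T S) \<phi> f x"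
proof -
  obtain U g B where *: "open U" "\<forall>n. Ck_on n U g" "openin T B" "x \<in> B" "\<phi> ` B \<subseteq> U"
      "\<forall>y\<in>B. f y = g (\<phi> y)"
    using assms(1) unfolding smooth_in_def by blast
  show ?thesis unfolding smooth_in_def
    by (intro exI[of _ U] exI[of _ g] exI[of _ "B \<inter> S"]) (use * assms in \<open>auto intro: openin_subtopology_Int\<close>)
qed

lemma smooth_in_map_prod:
  assumes "smooth_in T \<phi> f x"
  shows "smooth_in (prod_topology euclideanreal T) (map_prod (\<lambda>t. t) \<phi>) (map_prod (\<lambda>t. t) f) (t, x)"
proof -
  obtain U g B where *: "open U" "\<And>n. Ck_on n U g" "openin T B" "x \<in> B" "\<phi> ` B \<subseteq> U"
      "\<And>y. y \<in> B \<Longrightarrow> f y = g (\<phi> y)"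
    using assms(1) unfolding smooth_in_def by blast
  have "open ((UNIV :: real set) \<times> U)" using *(1) by (simp add: open_Times)
  moreover have "Ck_on n (UNIV \<times> U) (map_prod (\<lambda>t::real. t) g)" for n
  proof -
    have "Ck_on n (UNIV \<times> U) (\<lambda>z::real \<times> 'b. g (snd z))"
      by (rule Ck_on_compose[OF \<open>open (UNIV \<times> U)\<close> *(1) _ Ck_on_linear[OF bounded_linear_snd \<open>open (UNIV \<times> U)\<close>] *(2)]) auto
    then have "Ck_on n (UNIV \<times> U) (\<lambda>z::real \<times> 'b. (fst z, g (snd z)))"
      by (rule Ck_on_Pair[OF \<open>open (UNIV \<times> U)\<close> Ck_on_linear[OF bounded_linear_fst \<open>open (UNIV \<times> U)\<close>]])
    then show ?thesis by (simp add: map_prod_def case_prod_unfold)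
  qed
  moreover have "openin (prod_topology euclideanreal T) (UNIV \<times> B)"
    using *(3) by (simp add: openin_prod_Times_iff)
  ultimately show ?thesis unfolding smooth_in_def
    by (intro exI[of _ "UNIV \<times> U"] exI[of _ "map_prod (\<lambda>t::real. t) g"] exI[of _ "UNIV \<times> B"])
      (use *(4-6) in auto)
qed

section \<open>Charts\<close>

lemma is_chart_facts:
  assumes "is_chart M c"
  shows "openin (mtop M) (fst c)" "inj_on (snd c) (fst c)"
    "continuous_map (subtopology (mtop M) (fst c)) euclidean (snd c)"
    "continuous_map (top_of_set (snd c ` fst c)) (subtopology (mtop M) (fst c)) (cinv c)"
    "\<And>A. openin (mtop M) A \<Longrightarrow> A \<subseteq> fst c \<Longrightarrow> openin (top_of_set (mspace M)) (snd c ` A)"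
proof -
  show op: "openin (mtop M) (fst c)" using assms is_chart_def by blast
  have hom: "homeomorphic_map (subtopology (mtop M) (fst c)) (top_of_set (snd c ` fst c)) (snd c)"
    using assms is_chart_def by blast
  have ts: "topspace (subtopology (mtop M) (fst c)) = fst c"
    using op openin_subset by fastforce
  show inj: "inj_on (snd c) (fst c)" using hom ts by (metis homeomorphic_imp_injective_map)
  have *: "continuous_map (subtopology (mtop M) (fst c)) (top_of_set (snd c ` fst c)) (snd c)"
    using hom homeomorphic_imp_continuous_map by blast
  then show "continuous_map (subtopology (mtop M) (fst c)) euclidean (snd c)"
    using continuous_map_in_subtopology by blast
  obtain g where g: "homeomorphic_maps (subtopology (mtop M) (fst c)) (top_of_set (snd c ` fst c)) (snd c) g"
    using hom homeomorphic_map_maps by blast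
  have "g p = cinv c p" if "p \<in> snd c ` fst c" for p
    using g that inj ts by (auto simp: homeomorphic_maps_def)
  then show "continuous_map (top_of_set (snd c ` fst c)) (subtopology (mtop M) (fst c)) (cinv c)"
    using g unfolding homeomorphic_maps_def by (auto intro: continuous_map_eq)
  show "openin (top_of_set (mspace M)) (snd c ` A)" if A: "openin (mtop M) A" "A \<subseteq> fst c" for A
  proof -
    have "openin (subtopology (mtop M) (fst c)) A" using A openin_subset_topspace_eq
      by (metis openin_open_subtopology op)
    then have "openin (top_of_set (snd c ` fst c)) (snd c ` A)"
      using hom homeomorphic_imp_open_map open_map_def by blast
    then show ?thesis using assms is_chart_def openin_trans by blast
  qed
qed

lemma is_chartI:
  assumes "openin (mtop M) (fst c)" "inj_on (snd c) (fst c)"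
    "continuous_map (subtopology (mtop M) (fst c)) euclidean (snd c)"
    "\<And>A. openin (mtop M) A \<Longrightarrow> A \<subseteq> fst c \<Longrightarrow> openin (top_of_set (mspace M)) (snd c ` A)"
  shows "is_chart M c"
proof -
  have ts: "topspace (subtopology (mtop M) (fst c)) = fst c"
    using assms(1) openin_subset by fastforce
  have "homeomorphic_map (subtopology (mtop M) (fst c)) (top_of_set (snd c ` fst c)) (snd c)"
  proof (rule bijective_open_imp_homeomorphic_map)
    show "continuous_map (subtopology (mtop M) (fst c)) (top_of_set (snd c ` fst c)) (snd c)"
      using assms(3) ts by (auto simp: continuous_map_in_subtopology)
    show "open_map (subtopology (mtop M) (fst c)) (top_of_set (snd c ` fst c)) (snd c)"
      unfolding open_map_def
    proof (intro allI impI)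
      fix A assume "openin (subtopology (mtop M) (fst c)) A"
      then have A: "openin (mtop M) A" "A \<subseteq> fst c"
        using assms(1) openin_open_subtopology by blast+
      then have "openin (top_of_set (mspace M)) (snd c ` A)" by (rule assms(4))
      then have "openin (subtopology (top_of_set (mspace M)) (snd c ` fst c)) (snd c ` A)"
        using A(2) by (metis image_mono inf.absorb1 openin_subtopology_Int)
      moreover have "snd c ` fst c \<subseteq> mspace M"
        using openin_subset[OF assms(4)[OF assms(1) order_refl]] by simp
      ultimately show "openin (top_of_set (snd c ` fst c)) (snd c ` A)"
        by (simp add: subtopology_subtopology inf_absorb2)
    qed
    show "snd c ` topspace (subtopology (mtop M) (fst c)) = topspace (top_of_set (snd c ` fst c))"
      using ts by simp
    show "inj_on (snd c) (topspace (subtopology (mtop M) (fst c)))" using ts assms(2) by simp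
  qed
  then show ?thesis unfolding is_chart_def using assms by blast
qed

text \<open>The bridge between smoothness through the inverse chart and the germ form. An extension
  in coordinates pulls back along the continuous chart; conversely, openness of the chart as a map
  into the model space brings a neighbourhood of the point back into coordinates.\<close>

lemma smooth_on_chart_iff:
  assumes c: "is_chart M c" and A: "openin (mtop M) A" "A \<subseteq> fst c"
  shows "smooth_on (snd c ` A) (f \<circ> cinv c) \<longleftrightarrow> (\<forall>x\<in>A. smooth_in (mtop M) (snd c) f x)"
proof
  note inj = is_chart_facts(2)[OF c]
  assume *: "smooth_on (snd c ` A) (f \<circ> cinv c)"
  show "\<forall>x\<in>A. smooth_in (mtop M) (snd c) f x"
  proof
    fix x assume x: "x \<in> A"
    obtain U g where g: "open U" "snd c x \<in> U" "\<forall>n. Ck_on n U g"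
        "\<forall>y\<in>snd c ` A \<inter> U. g y = (f \<circ> cinv c) y"
      using bspec[OF *[unfolded smooth_on_def] imageI[OF x]] by (elim exE conjE)
    define B where "B = A \<inter> {y \<in> topspace (subtopology (mtop M) (fst c)). snd c y \<in> U}"
    have "openin (subtopology (mtop M) (fst c)) {y \<in> topspace (subtopology (mtop M) (fst c)). snd c y \<in> U}"
      by (rule openin_continuous_map_preimage[OF is_chart_facts(3)[OF c]]) (use g(1) open_openin in blast)
    from openin_Int[OF A(1) openin_trans_full[OF this is_chart_facts(1)[OF c]]]
    have "openin (mtop M) B" unfolding B_def .
    moreover have "x \<in> B" unfolding B_def using x A g openin_subset[OF A(1)] by auto
    moreover have "snd c ` B \<subseteq> U" unfolding B_def by auto
    moreover have "f y = g (snd c y)" if "y \<in> B" for y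
    proof -
      have y: "y \<in> A" "snd c y \<in> U" using that B_def by auto
      then have "g (snd c y) = f (cinv c (snd c y))" using bspec[OF g(4), of "snd c y"] by simp
      then show ?thesis using y A inj by (simp add: subset_iff)
    qed
    ultimately show "smooth_in (mtop M) (snd c) f x" unfolding smooth_in_def using g by blast
  qed
next
  note inj = is_chart_facts(2)[OF c]
  assume *: "\<forall>x\<in>A. smooth_in (mtop M) (snd c) f x"
  show "smooth_on (snd c ` A) (f \<circ> cinv c)" unfolding smooth_on_def
  proof
    fix p assume "p \<in> snd c ` A"
    then obtain x where x: "x \<in> A" "p = snd c x" by blast
    then obtain U g B where g: "open U" "\<forall>n. Ck_on n U g" "openin (mtop M) B" "x \<in> B" "snd c ` B \<subseteq> U"
        "\<forall>y\<in>B. f y = g (snd c y)"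
      using bspec[OF * x(1), unfolded smooth_in_def] by (elim exE conjE)
    have "openin (mtop M) (A \<inter> B)" using A g by blast
    then have "openin (top_of_set (mspace M)) (snd c ` (A \<inter> B))"
      using is_chart_facts(5)[OF c] A by blast
    \<comment> \<open>Cutting down by \<open>W\<close> guarantees that the remaining coordinate
      points come from \<open>B\<close>, where \<open>g\<close> represents \<open>f\<close>.\<close>
    then obtain W where W: "open W" "snd c ` (A \<inter> B) = mspace M \<inter> W" using openin_open by blast
    have Am: "snd c ` A \<subseteq> mspace M" using openin_subset[OF is_chart_facts(5)[OF c A]] by simp
    show "\<exists>U g. open U \<and> p \<in> U \<and> (\<forall>n. Ck_on n U g) \<and> (\<forall>y\<in>snd c ` A \<inter> U. g y = (f \<circ> cinv c) y)"
    proof (intro exI conjI allI ballI)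
      show "open (U \<inter> W)" using g W by blast
      have "p \<in> snd c ` (A \<inter> B)" using x g by blast
      then show "p \<in> U \<inter> W" using x g(4,5) W by auto
      show "Ck_on n (U \<inter> W) g" for n using Ck_on_subset[OF spec[OF g(2)]] by blast
      fix q assume q: "q \<in> snd c ` A \<inter> (U \<inter> W)"
      then have "q \<in> snd c ` (A \<inter> B)" using Am W by blast
      then obtain y where y: "y \<in> A" "y \<in> B" "q = snd c y" by blast
      then show "g q = (f \<circ> cinv c) q" using g(6) inj A by (simp add: subset_iff)
    qed
  qed
qed

lemma smooth_inE:
  assumes "smooth_in T \<phi> f x"
  obtains U g A where "open U" "\<And>n. Ck_on n U g" "openin T A" "x \<in> A" "\<phi> ` A \<subseteq> U"
    "\<And>y. y \<in> A \<Longrightarrow> f y = g (\<phi> y)"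
  using assms unfolding smooth_in_def by blast

lemma is_chart_prod:
  assumes "is_chart M c" "is_chart M' c'"
  shows "is_chart (prod_mfd M M') (fst c \<times> fst c', map_prod (snd c) (snd c'))"
proof -
  obtain g where g: "homeomorphic_maps (subtopology (mtop M) (fst c)) (top_of_set (snd c ` fst c)) (snd c) g"
    using assms(1) homeomorphic_map_maps unfolding is_chart_def by blast
  obtain g' where g': "homeomorphic_maps (subtopology (mtop M') (fst c')) (top_of_set (snd c' ` fst c')) (snd c') g'"
    using assms(2) homeomorphic_map_maps unfolding is_chart_def by blast
  have "homeomorphic_maps
      (prod_topology (subtopology (mtop M) (fst c)) (subtopology (mtop M') (fst c')))
      (prod_topology (top_of_set (snd c ` fst c)) (top_of_set (snd c' ` fst c')))
      (\<lambda>(x, y). (snd c x, snd c' y)) (\<lambda>(x, y). (g x, g' y))"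
    using g g' homeomorphic_maps_prod by blast
  then have "homeomorphic_map (subtopology (prod_topology (mtop M) (mtop M')) (fst c \<times> fst c'))
      (top_of_set (snd c ` fst c \<times> snd c' ` fst c')) (map_prod (snd c) (snd c'))"
    by (subst homeomorphic_map_maps) (auto simp: subtopology_Times map_prod_def)
  moreover have "openin (top_of_set (mspace M \<times> mspace M')) (snd c ` fst c \<times> snd c' ` fst c')"
    using assms by (auto simp: is_chart_def openin_Times)
  ultimately show ?thesis
    using assms by (auto simp: is_chart_def prod_mfd_def openin_prod_Times_iff map_prod_surj_on[OF refl refl])
qed

lemma is_chart_real: "c \<in> atlas real_mfd \<Longrightarrow> is_chart real_mfd c"
  by (auto simp: real_mfd_def is_chart_def homeomorphic_map_id[unfolded id_def] subtopology_UNIV)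

lemma smooth_map_on_iff:
  assumes M: "\<And>c. c \<in> atlas M \<Longrightarrow> is_chart M c" and M': "\<And>c. c \<in> atlas M' \<Longrightarrow> is_chart M' c"
  shows "smooth_map_on D M M' F \<longleftrightarrow> openin (mtop M) D \<and>
     continuous_map (subtopology (mtop M) D) (mtop M') F \<and>
     (\<forall>c\<in>atlas M. \<forall>c'\<in>atlas M'. \<forall>x\<in>fst c \<inter> D. F x \<in> fst c' \<longrightarrow> smooth_in (mtop M) (snd c) (snd c' \<circ> F) x)"
proof -
  have "smooth_on (snd c ` {x \<in> fst c \<inter> D. F x \<in> fst c'}) (snd c' \<circ> F \<circ> cinv c) \<longleftrightarrow>
      (\<forall>x\<in>fst c \<inter> D. F x \<in> fst c' \<longrightarrow> smooth_in (mtop M) (snd c) (snd c' \<circ> F) x)"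
    if D: "openin (mtop M) D" and F: "continuous_map (subtopology (mtop M) D) (mtop M') F"
      and c: "c \<in> atlas M" and c': "c' \<in> atlas M'" for c c'
  proof -
    note op = is_chart_facts(1)[OF M[OF c]] is_chart_facts(1)[OF M'[OF c']]
    have "openin (mtop M) {x \<in> topspace (subtopology (mtop M) D). F x \<in> fst c'}"
      using openin_trans_full[OF openin_continuous_map_preimage[OF F op(2)] D] .
    from openin_Int[OF op(1) this] openin_subset[OF D]
    have "openin (mtop M) {x \<in> fst c \<inter> D. F x \<in> fst c'}"
      by (auto elim!: back_subst[of "openin (mtop M)"])
    from smooth_on_chart_iff[OF M[OF c] this, of "snd c' \<circ> F"] show ?thesis by auto
  qed
  then show ?thesis unfolding smooth_map_on_def by blast
qed

lemma smooth_manifold_facts: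
  assumes "smooth_manifold M"
  shows "\<And>c. c \<in> atlas M \<Longrightarrow> is_chart M c" "\<And>x. x \<in> pts M \<Longrightarrow> \<exists>c\<in>atlas M. x \<in> fst c"
    "subspace (mspace M)" "Hausdorff_space (mtop M)"
    "\<And>x. x \<in> pts M \<Longrightarrow> chart_at M x \<in> atlas M \<and> x \<in> fst (chart_at M x)"
proof -
  show 1: "\<exists>c\<in>atlas M. x \<in> fst c" if "x \<in> pts M" for x
    using assms that unfolding smooth_manifold_def by blast
  show "chart_at M x \<in> atlas M \<and> x \<in> fst (chart_at M x)" if "x \<in> pts M" for x
    unfolding chart_at_def using someI_ex[of "\<lambda>c. c \<in> atlas M \<and> x \<in> fst c"] 1[OF that] by blast
qed (use assms in \<open>auto simp: smooth_manifold_def\<close>)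

lemma atlas_subset_max_atlas: "smooth_manifold M \<Longrightarrow> atlas M \<subseteq> max_atlas M"
  by (auto simp: smooth_manifold_def max_atlas_def)

lemma max_atlas_is_chart: "c \<in> max_atlas M \<Longrightarrow> is_chart M c"
  by (simp add: max_atlas_def)

lemma compatible_iff:
  assumes c: "is_chart M c" and c': "is_chart M c'"
  shows "compatible c c' \<longleftrightarrow> (\<forall>x\<in>fst c \<inter> fst c'. smooth_in (mtop M) (snd c) (snd c') x) \<and>
    (\<forall>x\<in>fst c \<inter> fst c'. smooth_in (mtop M) (snd c') (snd c) x)"
proof -
  have "openin (mtop M) (fst c \<inter> fst c')"
    using is_chart_facts(1)[OF c] is_chart_facts(1)[OF c'] by blast
  from smooth_on_chart_iff[OF c this, of "snd c'"] smooth_on_chart_iff[OF c' this, of "snd c"]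
  show ?thesis unfolding compatible_def by simp
qed

text \<open>Charts of the maximal atlas are by definition compatible with atlas charts only, so the
  change of coordinates is factored through an atlas chart around \<open>x\<close>.\<close>

lemma max_atlas_change:
  assumes M: "smooth_manifold M" and c: "c \<in> max_atlas M" "c' \<in> max_atlas M" and x: "x \<in> fst c" "x \<in> fst c'"
  shows "smooth_in (mtop M) (snd c) (snd c') x"
proof -
  note ch = c[THEN max_atlas_is_chart]
  have "x \<in> pts M" using openin_subset[OF is_chart_facts(1)[OF ch(1)]] x by blast
  then obtain c0 where c0: "c0 \<in> atlas M" "x \<in> fst c0" using smooth_manifold_facts(2)[OF M] by blast
  note c0' = smooth_manifold_facts(1)[OF M c0(1)]
  have "compatible c c0" "compatible c' c0" using c c0 by (auto simp: max_atlas_def)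
  then have "smooth_in (mtop M) (snd c) (snd c0) x" "smooth_in (mtop M) (snd c0) (snd c') x"
    using compatible_iff ch c0' x c0 by blast+
  then show ?thesis by (rule smooth_in_trans)
qed

lemma smooth_in_max_atlas_target:
  assumes "smooth_manifold M" "c0 \<in> max_atlas M" "c \<in> max_atlas M" "F x \<in> fst c0" "F x \<in> fst c"
    "continuous_germ T (mtop M) F x" "smooth_in T \<phi> (snd c0 \<circ> F) x"
  shows "smooth_in T \<phi> (snd c \<circ> F) x"
  using smooth_in_compose[OF assms(6,7)] max_atlas_change[OF assms(1-5)] by blast

section \<open>Derivatives along curves\<close>

text \<open>The chain rule for a local factorisation through \<open>\<phi>\<close>. The extension
  \<open>g\<close> may be any one: its derivative enters only in the direction of the coordinate
  velocity.\<close>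

lemma curve_derivative:
  assumes g: "Ck_on (Suc 0) U g" and A: "openin T A" "\<gamma> t \<in> A" "\<phi> ` A \<subseteq> U"
    and fg: "\<And>y. y \<in> A \<Longrightarrow> f y = g (\<phi> y)"
    and \<gamma>: "continuous_germ euclideanreal T \<gamma> t" "((\<phi> \<circ> \<gamma>) has_vector_derivative v) (at t)"
  shows "((f \<circ> \<gamma>) has_vector_derivative frechet_derivative g (at (\<phi> (\<gamma> t))) v) (at t)"
proof -
  let ?D = "frechet_derivative g (at (\<phi> (\<gamma> t)))"
  obtain S where S: "openin euclideanreal S" "t \<in> S" "\<gamma> ` S \<subseteq> A"
    using \<gamma>(1) A(1,2) unfolding continuous_germ_def by blast
  have "\<phi> (\<gamma> t) \<in> U" using A by blast
  then have D: "(g has_derivative ?D) (at ((\<phi> \<circ> \<gamma>) t))" using Ck_on_frechet[OF g] by simp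
  have "?D (h *\<^sub>R v) = h *\<^sub>R ?D v" for h
    using linear_scale[OF has_derivative_linear[OF D]] by simp
  then have "((g \<circ> (\<phi> \<circ> \<gamma>)) has_vector_derivative ?D v) (at t)"
    using diff_chain_at[OF \<gamma>(2)[unfolded has_vector_derivative_def] D]
    by (simp add: has_vector_derivative_def o_def)
  then show ?thesis
    by (rule has_vector_derivative_transform_within_open[of _ _ _ S]) (use S fg in auto)
qed

text \<open>Every model vector is the velocity of a continuous curve, namely of a coordinate line.
  This allows \<open>dfun\<close>, a directional derivative along such a line, to be computed by the
  chain rule for curves.\<close>

lemma line_curve:
  assumes c: "is_chart M c" and V: "subspace (mspace M)" and x: "x \<in> fst c" and v: "v \<in> mspace M"
  defines "\<gamma> \<equiv> \<lambda>s. cinv c (snd c x + s *\<^sub>R v)"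
  shows "\<gamma> 0 = x" "continuous_germ euclideanreal (mtop M) \<gamma> 0"
    "((snd c \<circ> \<gamma>) has_vector_derivative v) (at 0)"
proof -
  note inj = is_chart_facts(2)[OF c]
  show \<gamma>0: "\<gamma> 0 = x" unfolding \<gamma>_def using inj x by simp
  \<comment> \<open>The line stays in the model space and the image of \<open>B\<close> is
    relatively open there, so for small \<open>s\<close> the line is the coordinate image of a point
    of \<open>B\<close>. For other \<open>s\<close>, \<open>cinv\<close> may return an unrelated
    point.\<close>
  have near: "\<exists>S. open S \<and> 0 \<in> S \<and> (\<forall>s\<in>S. \<gamma> s \<in> B \<and> snd c (\<gamma> s) = snd c x + s *\<^sub>R v)"
    if B: "openin (mtop M) B" "x \<in> B" "B \<subseteq> fst c" for B
  proof -
    obtain W where W: "open W" "snd c ` B = mspace M \<inter> W"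
      using is_chart_facts(5)[OF c B(1,3)] openin_open by blast
    define S where "S = (\<lambda>s::real. snd c x + s *\<^sub>R v) -` W"
    have "open S" unfolding S_def by (intro open_vimage W(1) continuous_intros)
    moreover have xm: "snd c x \<in> mspace M" "snd c x \<in> W" using B(2) W(2) by blast+
    moreover have "\<gamma> s \<in> B \<and> snd c (\<gamma> s) = snd c x + s *\<^sub>R v" if "s \<in> S" for s
    proof -
      have "snd c x + s *\<^sub>R v \<in> mspace M"
        using V v xm by (intro subspace_add subspace_scale)
      then have "snd c x + s *\<^sub>R v \<in> snd c ` B" using that W(2) by (simp add: S_def)
      then obtain y where "y \<in> B" "snd c x + s *\<^sub>R v = snd c y" by blast
      then show ?thesis unfolding \<gamma>_def using inj B(3) by (simp add: subset_iff)
    qed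
    ultimately show ?thesis by (intro exI[of _ S]) (auto simp: S_def)
  qed
  show "continuous_germ euclideanreal (mtop M) \<gamma> 0" unfolding continuous_germ_def \<gamma>0
  proof (intro allI impI)
    fix B assume "openin (mtop M) B \<and> x \<in> B"
    then have "openin (mtop M) (B \<inter> fst c)" "x \<in> B \<inter> fst c" using is_chart_facts(1)[OF c] x by auto
    from near[OF this] obtain S where "open S" "0 \<in> S" "\<forall>s\<in>S. \<gamma> s \<in> B \<inter> fst c" by auto
    then show "\<exists>A. openin euclideanreal A \<and> 0 \<in> A \<and> \<gamma> ` A \<subseteq> B"
      by (intro exI[of _ S]) (auto simp flip: open_openin)
  qed
  obtain S where S: "open S" "0 \<in> S" "\<forall>s\<in>S. \<gamma> s \<in> fst c \<and> snd c (\<gamma> s) = snd c x + s *\<^sub>R v"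
    using near[OF is_chart_facts(1)[OF c] x order_refl] by blast
  have "((\<lambda>s. snd c x + s *\<^sub>R v) has_vector_derivative v) (at 0)"
    by (auto intro!: derivative_eq_intros)
  then show "((snd c \<circ> \<gamma>) has_vector_derivative v) (at 0)"
    by (rule has_vector_derivative_transform_within_open[of "\<lambda>s. snd c x + s *\<^sub>R v" _ 0 S])
      (use S in auto)
qed

text \<open>In model directions the derivative of an extension is determined by \<open>f\<close>,
  whichever extension is taken, because the coordinate line remains in the chart image.\<close>

lemma dfun_eq_frechet:
  assumes M: "smooth_manifold M" and x: "x \<in> pts M" and v: "v \<in> mspace M"
    and g: "Ck_on (Suc 0) U g" "openin (mtop M) A" "x \<in> A" "snd (chart_at M x) ` A \<subseteq> U"
    "\<And>y. y \<in> A \<Longrightarrow> f y = g (snd (chart_at M x) y)"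
  shows "dfun M f x v = frechet_derivative g (at (snd (chart_at M x) x)) v"
proof -
  let ?c = "chart_at M x"
  let ?\<gamma> = "\<lambda>s. cinv ?c (snd ?c x + s *\<^sub>R v)"
  have c: "is_chart M ?c" "x \<in> fst ?c" using smooth_manifold_facts[OF M] x by auto
  note l = line_curve[OF c(1) smooth_manifold_facts(3)[OF M] c(2) v]
  have "((f \<circ> ?\<gamma>) has_vector_derivative frechet_derivative g (at (snd ?c (?\<gamma> 0))) v) (at 0)"
    by (rule curve_derivative[OF g(1,2) _ g(4,5) l(2,3)]) (use g(3) l(1) in simp)
  then show ?thesis using l(1) unfolding dfun_def ddir_def
    by (simp add: o_def vector_derivative_at)
qed

lemma dfun_curve:
  assumes M: "smooth_manifold M" and x: "\<gamma> t \<in> pts M" and v: "v \<in> mspace M"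
    and f: "smooth_in (mtop M) (snd (chart_at M (\<gamma> t))) f (\<gamma> t)"
    and \<gamma>: "continuous_germ euclideanreal (mtop M) \<gamma> t"
      "((snd (chart_at M (\<gamma> t)) \<circ> \<gamma>) has_vector_derivative v) (at t)"
  shows "((f \<circ> \<gamma>) has_vector_derivative dfun M f (\<gamma> t) v) (at t)"
proof -
  obtain U g A where g: "Ck_on (Suc 0) U g" "openin (mtop M) A" "\<gamma> t \<in> A"
      "snd (chart_at M (\<gamma> t)) ` A \<subseteq> U" "\<And>y. y \<in> A \<Longrightarrow> f y = g (snd (chart_at M (\<gamma> t)) y)"
    using f by (rule smooth_inE) blast
  have "dfun M f (\<gamma> t) v = frechet_derivative g (at (snd (chart_at M (\<gamma> t)) (\<gamma> t))) v"
    by (rule dfun_eq_frechet[OF M x v]) (rule g, assumption?)+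
  then show ?thesis
    by (rule ssubst) (rule curve_derivative[where f = f and g = g and \<phi> = "snd (chart_at M (\<gamma> t))", OF g \<gamma>])
qed

lemma smooth_in_chart_at:
  assumes "smooth_manifold M" "c \<in> max_atlas M" "x \<in> fst c"
  shows "smooth_in (mtop M) (snd (chart_at M x)) (snd c) x"
proof -
  have "x \<in> pts M" using openin_subset[OF is_chart_facts(1)[OF max_atlas_is_chart[OF assms(2)]]] assms(3) by blast
  then show ?thesis
    using max_atlas_change[OF assms(1) _ assms(2) _ assms(3)] smooth_manifold_facts(5)[OF assms(1)]
      atlas_subset_max_atlas[OF assms(1)] by blast
qed

text \<open>\<open>vector_field\<close> asks for smooth coordinates in atlas charts, while slice
  charts belong to the maximal atlas. The coordinates of \<open>X\<close> in \<open>c\<close> arise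
  from those in an atlas chart \<open>c0\<close> by the derivative of the coordinate change
  \<open>k\<close>.\<close>

lemma vector_field_smooth_in:
  assumes M: "smooth_manifold M" and X: "vector_field M X" and c: "c \<in> max_atlas M" and y0: "y0 \<in> fst c"
  shows "smooth_in (mtop M) (snd c) (\<lambda>y. dfun M (snd c) y (X y)) y0"
proof -
  have opc: "openin (mtop M) (fst c)" using is_chart_facts(1)[OF max_atlas_is_chart[OF c]] .
  then have "y0 \<in> pts M" using openin_subset y0 by blast
  then obtain c0 where c0: "c0 \<in> atlas M" "y0 \<in> fst c0" using smooth_manifold_facts(2)[OF M] by blast
  note ch0 = smooth_manifold_facts(1)[OF M c0(1)]
  have c0m: "c0 \<in> max_atlas M" using atlas_subset_max_atlas[OF M] c0 by blast
  have op0: "openin (mtop M) (fst c0)" using is_chart_facts(1)[OF ch0] .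
  let ?X = "\<lambda>c y. dfun M (snd c) y (X y)"
  have "field_rep M c0 X = ?X c0 \<circ> cinv c0" unfolding field_rep_def by (simp add: fun_eq_iff)
  moreover have "fst c0 \<inter> pts M = fst c0" using openin_subset[OF op0] by blast
  ultimately have "smooth_on (snd c0 ` fst c0) (?X c0 \<circ> cinv c0)"
    using X c0(1) unfolding vector_field_on_def by metis
  then have "smooth_in (mtop M) (snd c0) (?X c0) y0"
    using smooth_on_chart_iff[OF ch0 op0 order_refl] c0(2) by blast
  then obtain U \<xi> A where \<xi>: "open U" "\<And>n. Ck_on n U \<xi>" "openin (mtop M) A" "y0 \<in> A" "snd c0 ` A \<subseteq> U"
      "\<And>y. y \<in> A \<Longrightarrow> ?X c0 y = \<xi> (snd c0 y)" by (rule smooth_inE) blast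
  obtain U' k A' where k: "open U'" "\<And>n. Ck_on n U' k" "openin (mtop M) A'" "y0 \<in> A'" "snd c0 ` A' \<subseteq> U'"
      "\<And>y. y \<in> A' \<Longrightarrow> snd c y = k (snd c0 y)"
    using max_atlas_change[OF M c0m c c0(2) y0] by (rule smooth_inE) blast
  let ?B = "A \<inter> A' \<inter> fst c \<inter> fst c0"
  let ?W = "U \<inter> U'"
  let ?k' = "\<lambda>p. frechet_derivative k (at p)"
  \<comment> \<open>One curve with velocity \<open>X y\<close> is read in both charts; uniqueness of
    its derivative at 0 gives the transformation law.\<close>
  have trans: "?X c y = ?k' (snd c0 y) (\<xi> (snd c0 y))" if y: "y \<in> ?B" for y
  proof -
    let ?cy = "chart_at M y"
    have ym: "y \<in> pts M" using y openin_subset[OF opc] by blast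
    have Xy: "X y \<in> mspace M" using X ym unfolding vector_field_on_def by blast
    have cy: "is_chart M ?cy" "y \<in> fst ?cy" using smooth_manifold_facts[OF M] ym by auto
    define \<gamma> where "\<gamma> = (\<lambda>s. cinv ?cy (snd ?cy y + s *\<^sub>R X y))"
    have \<gamma>: "\<gamma> 0 = y" "continuous_germ euclideanreal (mtop M) \<gamma> 0"
        "((snd ?cy \<circ> \<gamma>) has_vector_derivative X y) (at 0)"
      using line_curve[OF cy(1) smooth_manifold_facts(3)[OF M] cy(2) Xy] unfolding \<gamma>_def by auto
    have d: "((snd c \<circ> \<gamma>) has_vector_derivative ?X c y) (at 0)"
        "((snd c0 \<circ> \<gamma>) has_vector_derivative ?X c0 y) (at 0)"
      using dfun_curve[OF M, of \<gamma> 0 "X y"] \<gamma> ym Xy smooth_in_chart_at[OF M c] smooth_in_chart_at[OF M c0m] y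
      by auto
    have "((snd c \<circ> \<gamma>) has_vector_derivative ?k' (snd c0 (\<gamma> 0)) (?X c0 y)) (at 0)"
      by (rule curve_derivative[OF k(2,3) _ k(5,6) \<gamma>(2) d(2)]) (use y \<gamma>(1) in auto)
    from vector_derivative_unique_at[OF d(1) this] show ?thesis using \<gamma>(1) y \<xi>(6) by simp
  qed
  have oW: "open ?W" using \<xi>(1) k(1) by blast
  have lin: "?k' p w = (\<Sum>b\<in>Basis. (w \<bullet> b) *\<^sub>R ?k' p b)" if "p \<in> ?W" for p w
  proof -
    have l: "linear (?k' p)" using Ck_on_frechet[OF k(2)] that has_derivative_linear by blast
    show ?thesis using linear_sum[OF l, of "\<lambda>b. (w \<bullet> b) *\<^sub>R b" Basis]
      by (simp only: euclidean_representation linear_scale[OF l])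
  qed
  \<comment> \<open>The direction \<open>\<xi> p\<close> varies with \<open>p\<close>, so the
    derivative of \<open>k\<close> is expanded over the basis to leave fixed directions.\<close>
  have "Ck_on n ?W (\<lambda>p. \<Sum>b\<in>Basis. (\<xi> p \<bullet> b) *\<^sub>R ?k' p b)" for n
  proof (intro Ck_on_sum Ck_on_scaleR oW)
    show "Ck_on n ?W (\<lambda>p. \<xi> p \<bullet> b)" for b
      by (rule Ck_on_bounded_linear[OF bounded_linear_inner_left oW Ck_on_subset[OF \<xi>(2)]]) blast
    show "Ck_on n ?W (\<lambda>p. ?k' p b)" for b
      by (rule Ck_on_subset[of _ U']) (use k(2)[of "Suc n"] in simp_all)
  qed
  moreover have "?X c y = (\<Sum>b\<in>Basis. (\<xi> (snd c0 y) \<bullet> b) *\<^sub>R ?k' (snd c0 y) b)" if y: "y \<in> ?B" for y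
  proof -
    have "snd c0 y \<in> ?W" using y \<xi>(5) k(5) by blast
    from lin[OF this] show ?thesis using trans[OF y] by metis
  qed
  ultimately have "smooth_in (mtop M) (snd c0) (?X c) y0"
    unfolding smooth_in_def
    by (intro exI[of _ ?W] exI[of _ "\<lambda>p. \<Sum>b\<in>Basis. (\<xi> p \<bullet> b) *\<^sub>R ?k' p b"] exI[of _ ?B])
      (use oW \<xi>(3-5) k(3-5) opc op0 y0 c0(2) in auto)
  with max_atlas_change[OF M c c0m y0 c0(2)] show ?thesis by (rule smooth_in_trans)
qed

section \<open>Integral curves\<close>

text \<open>Distances are measured in the coordinates \<open>\<phi>\<close>, the form in which
  Gronwall compares two points of one chart. Shrinking to a coordinate ball provides the convexity
  behind the estimate.\<close>

lemma smooth_in_locally_lipschitz: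
  assumes "smooth_in T \<phi> f x" and "continuous_germ T euclidean \<phi> x"
  obtains A L where "openin T A" "x \<in> A"
    "\<And>y z. y \<in> A \<Longrightarrow> z \<in> A \<Longrightarrow> norm (f y - f z) \<le> L * norm (\<phi> y - \<phi> z)"
proof -
  obtain U g B where g: "open U" "\<And>n. Ck_on n U g" "openin T B" "x \<in> B" "\<phi> ` B \<subseteq> U"
      "\<And>y. y \<in> B \<Longrightarrow> f y = g (\<phi> y)"
    using assms(1) by (rule smooth_inE) blast
  have "\<phi> x \<in> U" using g by blast
  then obtain r L where r: "r > 0" "\<And>y z. y \<in> ball (\<phi> x) r \<Longrightarrow> z \<in> ball (\<phi> x) r \<Longrightarrow> norm (g y - g z) \<le> L * norm (y - z)"
    using C1_locally_lipschitz[OF g(1) g(2)] by metis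
  have "\<exists>A. openin T A \<and> x \<in> A \<and> \<phi> ` A \<subseteq> ball (\<phi> x) r"
    using assms(2) r(1) unfolding continuous_germ_def by (simp add: open_openin[symmetric])
  then obtain A where A: "openin T A" "x \<in> A" "\<phi> ` A \<subseteq> ball (\<phi> x) r" by blast
  show thesis
  proof (rule that[of "A \<inter> B" L])
    show "openin T (A \<inter> B)" "x \<in> A \<inter> B" using A g by auto
    show "norm (f y - f z) \<le> L * norm (\<phi> y - \<phi> z)" if "y \<in> A \<inter> B" "z \<in> A \<inter> B" for y z
    proof -
      have "\<phi> y \<in> ball (\<phi> x) r" "\<phi> z \<in> ball (\<phi> x) r" using A(3) that by blast+
      from r(2)[OF this] show ?thesis using that g(6) by simp
    qed
  qed
qed

lemma chart_continuous_germ: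
  assumes "is_chart M c" "x \<in> fst c"
  shows "continuous_germ (mtop M) euclidean (snd c) x"
  using continuous_germI[OF is_chart_facts(3)[OF assms(1)] is_chart_facts(1)[OF assms(1)] assms(2)] .

lemma chart_preimage_open:
  assumes "is_chart M c" "open W"
  shows "openin (mtop M) {y \<in> fst c. snd c y \<in> W}"
proof -
  note op = is_chart_facts(1)[OF assms(1)]
  have "openin (subtopology (mtop M) (fst c)) {y \<in> topspace (subtopology (mtop M) (fst c)). snd c y \<in> W}"
    by (rule openin_continuous_map_preimage[OF is_chart_facts(3)[OF assms(1)]])
      (use assms(2) open_openin in blast)
  moreover have "{y \<in> topspace (subtopology (mtop M) (fst c)). snd c y \<in> W} = {y \<in> fst c. snd c y \<in> W}"
    using openin_subset[OF op] by auto
  ultimately show ?thesis using openin_trans_full[OF _ op] by metis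
qed

lemma integral_curve_germ:
  assumes "integral_curve M X I \<gamma>" "t \<in> I"
  shows "continuous_germ euclideanreal (mtop M) \<gamma> t" "\<gamma> t \<in> pts M"
proof -
  have *: "continuous_map (subtopology euclideanreal I) (mtop M) \<gamma>" "openin euclideanreal I"
    using assms unfolding integral_curve_def by (auto simp flip: open_openin)
  show "continuous_germ euclideanreal (mtop M) \<gamma> t" by (rule continuous_germI[OF * assms(2)])
  show "\<gamma> t \<in> pts M" using *(1) assms(2) by (auto simp: continuous_map_def)
qed

lemma integral_curve_subset:
  assumes "integral_curve M X I \<gamma>" "open J" "is_interval J" "J \<subseteq> I"
  shows "integral_curve M X J \<gamma>"
  using assms unfolding integral_curve_def
  by (auto intro: continuous_map_from_subtopology_mono)

lemma integral_curve_chart: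
  assumes M: "smooth_manifold M" and X: "vector_field M X" and \<gamma>: "integral_curve M X I \<gamma>" and t: "t \<in> I"
    and c: "c \<in> max_atlas M" "\<gamma> t \<in> fst c"
  shows "((snd c \<circ> \<gamma>) has_vector_derivative dfun M (snd c) (\<gamma> t) (X (\<gamma> t))) (at t)"
proof (rule dfun_curve[where f = "snd c" and \<gamma> = \<gamma> and t = t, OF M _ _ smooth_in_chart_at[OF M c]])
  show "continuous_germ euclideanreal (mtop M) \<gamma> t" "\<gamma> t \<in> pts M"
    using integral_curve_germ[OF \<gamma> t] .
  then show "X (\<gamma> t) \<in> mspace M" using X unfolding vector_field_on_def by blast
  show "((snd (chart_at M (\<gamma> t)) \<circ> \<gamma>) has_vector_derivative X (\<gamma> t)) (at t)"
    using \<gamma> t unfolding integral_curve_def by blast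
qed

text \<open>The set \<open>E\<close> of times of agreement is open by Gronwall in a chart, and its
  complement in \<open>I\<close> is open because \<open>M\<close> is Hausdorff. Connectedness of
  \<open>I\<close> and \<open>t0\<close> in \<open>E\<close> leave only
  \<open>E = I\<close>.\<close>

theorem integral_curve_unique:
  assumes M: "smooth_manifold M" and X: "vector_field M X"
    and \<gamma>: "integral_curve M X I \<gamma>1" "integral_curve M X I \<gamma>2"
    and t0: "t0 \<in> I" "\<gamma>1 t0 = \<gamma>2 t0" and t: "t \<in> I"
  shows "\<gamma>1 t = \<gamma>2 t"
proof -
  define E where "E = {t \<in> I. \<gamma>1 t = \<gamma>2 t}"
  have I: "open I" "is_interval I" using \<gamma> unfolding integral_curve_def by auto
  have "open E"
  proof (subst open_contains_ball, rule ballI)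
    fix t assume "t \<in> E"
    then have tI: "t \<in> I" and eq: "\<gamma>1 t = \<gamma>2 t" by (auto simp: E_def)
    define c where "c = chart_at M (\<gamma>1 t)"
    have pt: "\<gamma>1 t \<in> pts M" using integral_curve_germ(2)[OF \<gamma>(1) tI] .
    have c: "c \<in> max_atlas M" "\<gamma>1 t \<in> fst c"
      using smooth_manifold_facts(5)[OF M pt] atlas_subset_max_atlas[OF M] by (auto simp: c_def)
    note ch = max_atlas_is_chart[OF c(1)]
    let ?X = "\<lambda>y. dfun M (snd c) y (X y)"
    obtain A L where A: "openin (mtop M) A" "\<gamma>1 t \<in> A"
        "\<And>y z. y \<in> A \<Longrightarrow> z \<in> A \<Longrightarrow> norm (?X y - ?X z) \<le> L * norm (snd c y - snd c z)"
      by (rule smooth_in_locally_lipschitz[OF vector_field_smooth_in[OF M X c] chart_continuous_germ[OF ch c(2)]]) blast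
    have A': "openin (mtop M) (A \<inter> fst c)" "\<gamma>1 t \<in> A \<inter> fst c"
      using A is_chart_facts(1)[OF ch] c by auto
    obtain S1 where S1: "openin euclideanreal S1" "t \<in> S1" "\<gamma>1 ` S1 \<subseteq> A \<inter> fst c"
      using integral_curve_germ(1)[OF \<gamma>(1) tI] A' unfolding continuous_germ_def by blast
    obtain S2 where S2: "openin euclideanreal S2" "t \<in> S2" "\<gamma>2 ` S2 \<subseteq> A \<inter> fst c"
      using integral_curve_germ(1)[OF \<gamma>(2) tI] A' unfolding continuous_germ_def eq by blast
    have "open (I \<inter> S1 \<inter> S2)" "t \<in> I \<inter> S1 \<inter> S2"
      using I S1 S2 tI by (auto simp: open_openin[symmetric])
    then obtain e where e: "e > 0" "ball t e \<subseteq> I \<inter> S1 \<inter> S2" using openE by blast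
    have "ball t e \<subseteq> E"
    proof
      fix s assume s: "s \<in> ball t e"
      have in1: "\<gamma>1 r \<in> A" "\<gamma>1 r \<in> fst c" and in2: "\<gamma>2 r \<in> A" "\<gamma>2 r \<in> fst c" and rI: "r \<in> I"
        if "r \<in> ball t e" for r
        using that e S1 S2 by blast+
      have "snd c (\<gamma>1 s) - snd c (\<gamma>2 s) = 0"
      proof (rule vector_derivative_gronwall_zero[of "ball t e" "\<lambda>r. snd c (\<gamma>1 r) - snd c (\<gamma>2 r)"
            "\<lambda>r. ?X (\<gamma>1 r) - ?X (\<gamma>2 r)" L t])
        fix r assume r: "r \<in> ball t e"
        show "((\<lambda>r. snd c (\<gamma>1 r) - snd c (\<gamma>2 r)) has_vector_derivative ?X (\<gamma>1 r) - ?X (\<gamma>2 r)) (at r)"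
          using has_vector_derivative_diff[OF
              integral_curve_chart[OF M X \<gamma>(1) rI[OF r] c(1) in1(2)[OF r]]
              integral_curve_chart[OF M X \<gamma>(2) rI[OF r] c(1) in2(2)[OF r]]] by (simp add: o_def)
        show "norm (?X (\<gamma>1 r) - ?X (\<gamma>2 r)) \<le> L * norm (snd c (\<gamma>1 r) - snd c (\<gamma>2 r))"
          using A(3) in1[OF r] in2[OF r] by blast
      qed (use e s eq in \<open>auto simp: is_interval_ball_real\<close>)
      then show "s \<in> E" unfolding E_def
        using is_chart_facts(2)[OF ch] in1[OF s] in2[OF s] rI[OF s] by (auto dest: inj_onD)
    qed
    then show "\<exists>e>0. ball t e \<subseteq> E" using e by blast
  qed
  moreover have "open (I - E)"
  proof (subst open_subopen, rule ballI)
    fix t assume "t \<in> I - E"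
    then have tI: "t \<in> I" and ne: "\<gamma>1 t \<noteq> \<gamma>2 t" by (auto simp: E_def)
    obtain A B where AB: "openin (mtop M) A" "openin (mtop M) B" "\<gamma>1 t \<in> A" "\<gamma>2 t \<in> B" "disjnt A B"
      using smooth_manifold_facts(4)[OF M] integral_curve_germ(2)[OF \<gamma>(1) tI]
        integral_curve_germ(2)[OF \<gamma>(2) tI] ne
      unfolding Hausdorff_space_def by metis
    obtain S1 where S1: "openin euclideanreal S1" "t \<in> S1" "\<gamma>1 ` S1 \<subseteq> A"
      using integral_curve_germ(1)[OF \<gamma>(1) tI] AB unfolding continuous_germ_def by blast
    obtain S2 where S2: "openin euclideanreal S2" "t \<in> S2" "\<gamma>2 ` S2 \<subseteq> B"
      using integral_curve_germ(1)[OF \<gamma>(2) tI] AB unfolding continuous_germ_def by blast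
    have "s \<in> I - E" if "s \<in> I \<inter> S1 \<inter> S2" for s
    proof -
      have "\<gamma>1 s \<in> A" "\<gamma>2 s \<in> B" using that S1 S2 by blast+
      then have "\<gamma>1 s \<noteq> \<gamma>2 s" using AB(5) unfolding disjnt_def by auto
      then show ?thesis using that by (simp add: E_def)
    qed
    moreover have "open (I \<inter> S1 \<inter> S2)" using I S1 S2 by (auto simp: open_openin[symmetric])
    ultimately show "\<exists>T. open T \<and> t \<in> T \<and> T \<subseteq> I - E" using tI S1 S2 by blast
  qed
  moreover have "connected I" using I is_interval_connected by blast
  moreover have "E \<subseteq> I" by (auto simp: E_def)
  ultimately have "E \<inter> I = {} \<or> (I - E) \<inter> I = {}"
    by (intro connectedD) auto
  then show ?thesis using t0 t by (auto simp: E_def)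
qed

section \<open>Embedded submanifolds\<close>

lemma submfd_simps:
  "mtop (submfd M N) = subtopology (mtop M) N"
  "atlas (submfd M N) = {(fst c \<inter> N, snd c) | c. slice_chart M N (mspace (submfd M N)) c}"
  by (simp_all add: submfd_def Let_def)

lemma atlas_submfdE:
  assumes "c \<in> atlas (submfd M N)"
  obtains c' where "c = (fst c' \<inter> N, snd c')" "slice_chart M N (mspace (submfd M N)) c'" "c' \<in> max_atlas M"
proof -
  from assms obtain c' where "c = (fst c' \<inter> N, snd c')" "slice_chart M N (mspace (submfd M N)) c'"
    unfolding submfd_simps(2) by blast
  then show thesis using that unfolding slice_chart_def by blast
qed

lemma atlas_submfdI:
  "slice_chart M N (mspace (submfd M N)) c \<Longrightarrow> (fst c \<inter> N, snd c) \<in> atlas (submfd M N)"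
  unfolding submfd_simps(2) by blast

lemma slice_space_submfd:
  assumes "submanifold M N"
  shows "slice_space M N (mspace (submfd M N))"
  using someI_ex[of "slice_space M N"] assms by (simp add: submfd_def Let_def submanifold_def)

lemma slice_chart_mem_iff:
  assumes c: "slice_chart M N V c" and y: "y \<in> fst c"
  shows "y \<in> N \<longleftrightarrow> snd c y \<in> V"
proof -
  have "inj_on (snd c) (fst c)" "snd c ` (fst c \<inter> N) = snd c ` fst c \<inter> V"
    using c is_chart_facts(2)[of M c] max_atlas_is_chart[of c M] by (simp_all add: slice_chart_def)
  then show ?thesis using y by (smt (verit) IntE IntI image_iff inj_onD)
qed

lemma is_chart_slice:
  assumes c: "slice_chart M N (mspace (submfd M N)) c" and "mspace (submfd M N) \<subseteq> mspace M"
  shows "is_chart (submfd M N) (fst c \<inter> N, snd c)"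
proof (rule is_chartI)
  let ?V = "mspace (submfd M N)"
  have ch: "is_chart M c" using c max_atlas_is_chart[of c M] by (simp add: slice_chart_def)
  note facts = is_chart_facts[OF ch]
  show "openin (mtop (submfd M N)) (fst (fst c \<inter> N, snd c))"
    using facts(1) by (simp add: submfd_simps openin_subtopology_Int)
  show "inj_on (snd (fst c \<inter> N, snd c)) (fst (fst c \<inter> N, snd c))"
    using facts(2) by (auto intro: inj_on_subset)
  show "continuous_map (subtopology (mtop (submfd M N)) (fst (fst c \<inter> N, snd c))) euclidean
      (snd (fst c \<inter> N, snd c))"
    using facts(3) by (auto simp: submfd_simps subtopology_subtopology intro: continuous_map_from_subtopology_mono)
  fix A assume A: "openin (mtop (submfd M N)) A" "A \<subseteq> fst (fst c \<inter> N, snd c)"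
  then obtain B where B: "openin (mtop M) B" "A = B \<inter> N"
    by (auto simp: submfd_simps openin_subtopology)
  have "openin (top_of_set (mspace M)) (snd c ` (B \<inter> fst c))"
    using facts(1,5) B by blast
  then have "openin (subtopology (top_of_set (mspace M)) ?V) (snd c ` (B \<inter> fst c) \<inter> ?V)"
    by (rule openin_subtopology_Int)
  moreover have "snd c ` (B \<inter> fst c) \<inter> ?V = snd c ` A"
    using A(2) B(2) slice_chart_mem_iff[OF c] by auto
  ultimately show "openin (top_of_set (mspace (submfd M N))) (snd (fst c \<inter> N, snd c) ` A)"
    using assms(2) by (simp add: subtopology_subtopology inf_absorb2)
qed

text \<open>Compatibility is inherited from \<open>M\<close>: a coordinate change that factors
  smoothly near a point of \<open>N\<close> does so after restriction to \<open>N\<close>, with the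
  same smooth factor.\<close>

lemma smooth_manifold_submfd:
  assumes M: "smooth_manifold M" and N: "submanifold M N"
  shows "smooth_manifold (submfd M N)"
proof -
  let ?S = "submfd M N"
  have V: "subspace (mspace ?S)" "mspace ?S \<subseteq> mspace M"
      "\<And>x. x \<in> N \<Longrightarrow> \<exists>c. x \<in> fst c \<and> slice_chart M N (mspace ?S) c"
    using slice_space_submfd[OF N] unfolding slice_space_def by auto
  have NM: "N \<subseteq> pts M" using N unfolding submanifold_def by (rule conjunct1)
  show ?thesis unfolding smooth_manifold_def
  proof (intro conjI ballI)
    show "Hausdorff_space (mtop ?S)" "second_countable (mtop ?S)"
      using M by (auto simp: submfd_simps smooth_manifold_def intro: Hausdorff_space_subtopology second_countable_subtopology)
    show "(\<Union>c\<in>atlas ?S. fst c) = pts ?S"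
    proof
      show "(\<Union>c\<in>atlas ?S. fst c) \<subseteq> pts ?S"
        using NM by (auto simp: submfd_simps)
      show "pts ?S \<subseteq> (\<Union>c\<in>atlas ?S. fst c)"
      proof
        fix x assume "x \<in> pts ?S"
        then have x: "x \<in> N" by (simp add: submfd_simps(1))
        then obtain c where "x \<in> fst c" "slice_chart M N (mspace ?S) c" using V(3)[OF x] by blast
        then have "(fst c \<inter> N, snd c) \<in> atlas ?S" "x \<in> fst (fst c \<inter> N, snd c)"
          using x by (auto intro: atlas_submfdI[of M N c])
        then show "x \<in> (\<Union>c\<in>atlas ?S. fst c)" by blast
      qed
    qed
    show chart: "is_chart ?S c" if "c \<in> atlas ?S" for c
      using that by (rule atlas_submfdE) (use is_chart_slice[OF _ V(2)] in blast)
    fix c1 c2 assume c12: "c1 \<in> atlas ?S" "c2 \<in> atlas ?S"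
    obtain d1 d2 where d: "c1 = (fst d1 \<inter> N, snd d1)" "c2 = (fst d2 \<inter> N, snd d2)"
        "d1 \<in> max_atlas M" "d2 \<in> max_atlas M"
      using atlas_submfdE[OF c12(1)] atlas_submfdE[OF c12(2)] by metis
    show "compatible c1 c2"
      unfolding compatible_iff[OF chart[OF c12(1)] chart[OF c12(2)]]
      using max_atlas_change[OF M d(3,4)] max_atlas_change[OF M d(4,3)]
      by (auto simp: d(1,2) submfd_simps(1) intro!: smooth_in_subtopology)
  qed (rule V)
qed

text \<open>Projecting onto \<open>V\<close> does not change \<open>u\<close> near \<open>t\<close>,
  so the projected derivative is a derivative of \<open>u\<close> as well, and
  \<open>d = P d\<close>.\<close>

lemma has_vector_derivative_in_subspace:
  fixes u :: "real \<Rightarrow> 'a::euclidean_space"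
  assumes V: "subspace V" and u: "(u has_vector_derivative d) (at t)"
    and S: "open S" "t \<in> S" "\<And>s. s \<in> S \<Longrightarrow> u s \<in> V"
  shows "d \<in> V"
proof -
  obtain P where P: "bounded_linear P" "\<And>x. P x \<in> V" "\<And>x. x \<in> V \<Longrightarrow> P x = x"
    using subspace_projection[OF V] by metis
  have "((\<lambda>s. P (u s)) has_vector_derivative P d) (at t)"
    using bounded_linear.has_vector_derivative[OF P(1) u] .
  then have "(u has_vector_derivative P d) (at t)"
    by (rule has_vector_derivative_transform_within_open[OF _ S(1,2)]) (use S P in auto)
  then have "d = P d" using vector_derivative_unique_at u by blast
  then show ?thesis using P(2)[of d] by simp
qed

lemma continuous_germ_subtopology:
  assumes "continuous_germ T (subtopology T' S) F x" "F x \<in> S"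
  shows "continuous_germ T T' F x"
  unfolding continuous_germ_def
proof (intro allI impI)
  fix B assume "openin T' B \<and> F x \<in> B"
  then have "openin (subtopology T' S) (B \<inter> S)" "F x \<in> B \<inter> S"
    using assms(2) by (auto intro: openin_subtopology_Int)
  then show "\<exists>A. openin T A \<and> x \<in> A \<and> F ` A \<subseteq> B"
    using assms(1)[unfolded continuous_germ_def, rule_format, of "B \<inter> S"] by auto
qed

text \<open>A tangent vector of \<open>N\<close> is the velocity of a curve in \<open>N\<close>. The
  slice coordinates of that curve run in the model space of \<open>N\<close>, and so does their
  derivative.\<close>

lemma tangent_sub_slice:
  assumes M: "smooth_manifold M" and N: "submanifold M N" and x: "x \<in> N"
    and v: "v \<in> tangent_sub M N x" "v \<in> mspace M"
    and c: "slice_chart M N (mspace (submfd M N)) c" "x \<in> fst c"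
  shows "dfun M (snd c) x v \<in> mspace (submfd M N)"
proof -
  let ?S = "submfd M N"
  note S = smooth_manifold_submfd[OF M N]
  have xM: "x \<in> pts M" using N x unfolding submanifold_def by blast
  then have xS: "x \<in> pts ?S" using x by (simp add: submfd_simps(1))
  obtain w where w: "w \<in> mspace ?S" "v = dfun ?S (snd (chart_at M x) \<circ> (\<lambda>y. y)) x w"
    using v(1) by (auto simp: tangent_in_def tmap_def)
  let ?c = "chart_at ?S x"
  have cS: "?c \<in> atlas ?S" "x \<in> fst ?c" using smooth_manifold_facts(5)[OF S xS] by auto
  obtain c1 where c1: "?c = (fst c1 \<inter> N, snd c1)" "c1 \<in> max_atlas M"
    using atlas_submfdE[OF cS(1)] by metis
  have cM: "chart_at M x \<in> max_atlas M" "x \<in> fst (chart_at M x)"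
    using smooth_manifold_facts(5)[OF M xM] atlas_subset_max_atlas[OF M] by auto
  \<comment> \<open>A coordinate line of the submanifold itself. Its continuity in the subspace
    topology keeps it in \<open>N\<close> near 0 and makes it a continuous curve of \<open>M\<close>
    with velocity \<open>v\<close>.\<close>
  define \<gamma> where "\<gamma> = (\<lambda>s. cinv ?c (snd ?c x + s *\<^sub>R w))"
  have \<gamma>: "\<gamma> 0 = x" "continuous_germ euclideanreal (mtop ?S) \<gamma> 0"
      "((snd ?c \<circ> \<gamma>) has_vector_derivative w) (at 0)"
    using line_curve[OF smooth_manifold_facts(1)[OF S cS(1)] smooth_manifold_facts(3)[OF S] cS(2) w(1)]
    unfolding \<gamma>_def by auto
  have "x \<in> fst c1" using c1 cS by simp
  then have "smooth_in (mtop ?S) (snd ?c) (snd (chart_at M x)) x"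
    using smooth_in_subtopology[OF max_atlas_change[OF M c1(2) cM(1) _ cM(2)] x] by (simp add: c1(1) submfd_simps(1))
  then have dv: "((snd (chart_at M x) \<circ> \<gamma>) has_vector_derivative v) (at 0)"
    using dfun_curve[OF S, of \<gamma> 0 w "snd (chart_at M x)"] \<gamma> xS w by (simp add: o_def)
  have germM: "continuous_germ euclideanreal (mtop M) \<gamma> 0"
    using continuous_germ_subtopology[of euclideanreal "mtop M" N \<gamma> 0] \<gamma>(1,2) x by (simp add: submfd_simps(1))
  have cm: "c \<in> max_atlas M" using c by (simp add: slice_chart_def)
  have d: "((snd c \<circ> \<gamma>) has_vector_derivative dfun M (snd c) x v) (at 0)"
    using dfun_curve[OF M, of \<gamma> 0 v "snd c"] \<gamma>(1) xM v(2) smooth_in_chart_at[OF M cm c(2)] germM dv by simp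
  have "openin (mtop ?S) (fst c \<inter> N)"
    using is_chart_facts(1)[OF max_atlas_is_chart[OF cm]] by (simp add: submfd_simps(1) openin_subtopology_Int)
  then obtain Z where Z: "openin euclideanreal Z" "0 \<in> Z" "\<gamma> ` Z \<subseteq> fst c \<inter> N"
    using \<gamma>(1,2) c(2) x unfolding continuous_germ_def by blast
  show ?thesis
  proof (rule has_vector_derivative_in_subspace[OF smooth_manifold_facts(3)[OF S] d])
    show "open Z" "0 \<in> Z" using Z by (auto simp: open_openin[symmetric])
    show "(snd c \<circ> \<gamma>) s \<in> mspace ?S" if "s \<in> Z" for s
    proof -
      have "\<gamma> s \<in> fst c" "\<gamma> s \<in> N" using Z that by blast+
      then show ?thesis using slice_chart_mem_iff[OF c(1)] by simp
    qed
  qed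
qed

text \<open>In a slice chart, the distance \<open>u\<close> of an integral curve to the slice satisfies
  \<open>\<bar>u'\<bar> \<le> L\<bar>u\<bar>\<close>, since the field is Lipschitz and tangent to the slice; hence \<open>u\<close> vanishes
  identically once it vanishes at one time.\<close>

lemma tangent_field_locally_invariant:
  assumes M: "smooth_manifold M" and X: "vector_field M X" and N: "submanifold M N"
    and tangent: "\<And>x. x \<in> N \<Longrightarrow> X x \<in> tangent_sub M N x" and y0: "y0 \<in> N"
  obtains A where "openin (mtop M) A" "y0 \<in> A"
    "\<And>I \<gamma> s t. integral_curve M X I \<gamma> \<Longrightarrow> \<gamma> ` I \<subseteq> A \<Longrightarrow> s \<in> I \<Longrightarrow> t \<in> I \<Longrightarrow> \<gamma> s \<in> N \<Longrightarrow> \<gamma> t \<in> N"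
proof -
  define V where "V = mspace (submfd M N)"
  have V: "subspace V" "V \<subseteq> mspace M" "\<exists>c. y0 \<in> fst c \<and> slice_chart M N V c"
    using slice_space_submfd[OF N] y0 unfolding slice_space_def V_def by auto
  have NM: "N \<subseteq> pts M" using N unfolding submanifold_def by (rule conjunct1)
  obtain c where c: "y0 \<in> fst c" "slice_chart M N V c" using V(3) by blast
  have cm: "c \<in> max_atlas M" using c(2) by (simp add: slice_chart_def)
  note ch = max_atlas_is_chart[OF cm]
  note facts = is_chart_facts[OF ch]
  let ?X = "\<lambda>y. dfun M (snd c) y (X y)"
  obtain P where P: "bounded_linear P" "\<And>x. P x \<in> V" "\<And>x. x \<in> V \<Longrightarrow> P x = x"
      "\<And>x. norm (P x) \<le> norm x" "\<And>x. norm (x - P x) \<le> norm x"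
    using subspace_projection[OF V(1)] by blast
  obtain A0 L where A0: "openin (mtop M) A0" "y0 \<in> A0"
      "\<And>y z. y \<in> A0 \<Longrightarrow> z \<in> A0 \<Longrightarrow> norm (?X y - ?X z) \<le> L * norm (snd c y - snd c z)"
    by (rule smooth_in_locally_lipschitz[OF vector_field_smooth_in[OF M X cm c(1)] chart_continuous_germ[OF ch c(1)]]) blast
  define A1 where "A1 = A0 \<inter> fst c"
  have A1: "openin (mtop M) A1" "y0 \<in> A1" "A1 \<subseteq> fst c" using A0 facts(1) c(1) by (auto simp: A1_def)
  obtain W where W: "open W" "snd c ` A1 = mspace M \<inter> W"
    using facts(5)[OF A1(1,3)] openin_open by blast
  have p0W: "snd c y0 \<in> W" and p0V: "snd c y0 \<in> V"
    using W(2) A1(2) slice_chart_mem_iff[OF c(2,1)] y0 by blast+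
  obtain r where r: "r > 0" "ball (snd c y0) r \<subseteq> W" using openE[OF W(1) p0W] by blast
  \<comment> \<open>The ball is centred at a point of \<open>V\<close>, so orthogonal projection
    maps it into itself, hence into \<open>W\<close>. Thus the projection of the coordinates of any
    point of \<open>A\<close> is again the coordinate of a point of \<open>A1\<close>, and that
    point lies in \<open>N\<close>.\<close>
  define A where "A = A1 \<inter> {y \<in> fst c. snd c y \<in> ball (snd c y0) r}"
  have Pball: "P p \<in> ball (snd c y0) r" if "p \<in> ball (snd c y0) r" for p
  proof -
    have "snd c y0 - P p = P (snd c y0 - p)"
      using P(3)[OF p0V] linear_simps(2)[OF P(1)] by simp
    then show ?thesis using P(4)[of "snd c y0 - p"] that by (simp add: dist_norm)
  qed
  have foot: "\<exists>z. z \<in> A1 \<and> z \<in> N \<and> snd c z = P (snd c y)" if "y \<in> A" for y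
  proof -
    have "P (snd c y) \<in> mspace M \<inter> W"
      using that Pball[of "snd c y"] r(2) P(2)[of "snd c y"] V(2) by (auto simp: A_def)
    then obtain z where z: "z \<in> A1" "snd c z = P (snd c y)" using W(2) by (metis imageE)
    then have "z \<in> N" using slice_chart_mem_iff[OF c(2)] A1(3) P(2)[of "snd c y"] by auto
    with z show ?thesis by blast
  qed
  show thesis
  proof (rule that[of A])
    show "openin (mtop M) A" unfolding A_def
      using A1(1) chart_preimage_open[OF ch open_ball] by blast
    show "y0 \<in> A" using A1(2) c(1) r(1) by (simp add: A_def)
    fix I \<gamma> s t
    assume \<gamma>: "integral_curve M X I \<gamma>" and I: "\<gamma> ` I \<subseteq> A" "s \<in> I" "t \<in> I" and sN: "\<gamma> s \<in> N"
    let ?u = "\<lambda>r. snd c (\<gamma> r) - P (snd c (\<gamma> r))"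
    let ?u' = "\<lambda>r. ?X (\<gamma> r) - P (?X (\<gamma> r))"
    have inc: "\<gamma> r \<in> A" "\<gamma> r \<in> fst c" if "r \<in> I" for r using I(1) that A_def by auto
    have "?u t = 0"
    proof (rule vector_derivative_gronwall_zero[of I ?u ?u' L s])
      show "is_interval I" using \<gamma> by (simp add: integral_curve_def)
      show "?u s = 0" using P(3) slice_chart_mem_iff[OF c(2) inc(2)[OF I(2)]] sN by simp
      fix r assume r: "r \<in> I"
      have d: "((\<lambda>r. snd c (\<gamma> r)) has_vector_derivative ?X (\<gamma> r)) (at r)"
        using integral_curve_chart[OF M X \<gamma> r cm inc(2)[OF r]] by (simp add: o_def)
      show "(?u has_vector_derivative ?u' r) (at r)"
        by (rule has_vector_derivative_diff[OF d bounded_linear.has_vector_derivative[OF P(1) d]])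
      obtain z where z: "z \<in> A1" "z \<in> N" "snd c z = P (snd c (\<gamma> r))" using foot[OF inc(1)[OF r]] by blast
      have zc: "z \<in> fst c" using z(1) A1(3) by blast
      have "X z \<in> mspace M" using X NM z(2) unfolding vector_field_on_def by blast
      then have "?X z \<in> V"
        using tangent_sub_slice[OF M N z(2) tangent[OF z(2)] _ c(2)[unfolded V_def] zc] by (simp add: V_def)
      \<comment> \<open>At the foot \<open>z\<close> the field is tangent, so \<open>P\<close> fixes
        \<open>?X z\<close> and this vector can be subtracted without changing the normal component.
        The Lipschitz bound is then in terms of the distance to \<open>z\<close>, which is exactly
        the norm of \<open>?u r\<close>.\<close>
      then have "?u' r = (?X (\<gamma> r) - ?X z) - P (?X (\<gamma> r) - ?X z)"
        using P(3) linear_simps(2)[OF P(1)] by simp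
      then have "norm (?u' r) \<le> norm (?X (\<gamma> r) - ?X z)" using P(5) by metis
      also have "\<dots> \<le> L * norm (snd c (\<gamma> r) - snd c z)"
        using A0(3) inc(1)[OF r] z(1) by (simp add: A_def A1_def)
      finally show "norm (?u' r) \<le> L * norm (?u r)" by (simp add: z(3))
    qed (rule I)+
    then have "snd c (\<gamma> t) = P (snd c (\<gamma> t))" by simp
    then have "snd c (\<gamma> t) \<in> V" using P(2)[of "snd c (\<gamma> t)"] by simp
    then show "\<gamma> t \<in> N" using slice_chart_mem_iff[OF c(2) inc(2)[OF I(3)]] by blast
  qed
qed

section \<open>The flow on an invariant submanifold\<close>

lemma openin_prod_topologyE:
  assumes "openin (prod_topology T T') S" "(x, y) \<in> S"
  obtains A B where "openin T A" "openin T' B" "x \<in> A" "y \<in> B" "A \<times> B \<subseteq> S"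
  using assms(1)[unfolded openin_prod_topology_alt, rule_format, OF assms(2)] by (elim exE conjE)

lemma prod_real_mfd_simps:
  "mtop (prod_mfd real_mfd M) = prod_topology euclideanreal (mtop M)"
  "mspace (prod_mfd real_mfd M) = UNIV \<times> mspace M"
  "atlas (prod_mfd real_mfd M) = {(UNIV \<times> fst c, map_prod (\<lambda>t. t) (snd c)) | c. c \<in> atlas M}"
  by (auto simp: prod_mfd_def real_mfd_def)

lemma is_chart_prod_real:
  assumes "smooth_manifold M" "c \<in> atlas (prod_mfd real_mfd M)"
  shows "is_chart (prod_mfd real_mfd M) c"
proof -
  obtain c' where c': "c = (UNIV \<times> fst c', map_prod (\<lambda>t. t) (snd c'))" "c' \<in> atlas M"
    using assms(2) unfolding prod_real_mfd_simps by blast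
  have "is_chart real_mfd (UNIV, \<lambda>t. t)" by (rule is_chart_real) (simp add: real_mfd_def)
  from is_chart_prod[OF this smooth_manifold_facts(1)[OF assms(1) c'(2)]]
  show ?thesis by (simp add: c'(1))
qed

lemma time_map_iff:
  assumes M: "smooth_manifold M" and M': "smooth_manifold M'"
  shows "smooth_map_on D (prod_mfd real_mfd M) M' F \<longleftrightarrow>
     openin (prod_topology euclideanreal (mtop M)) D \<and>
     continuous_map (subtopology (prod_topology euclideanreal (mtop M)) D) (mtop M') F \<and>
     (\<forall>c\<in>atlas M. \<forall>c'\<in>atlas M'. \<forall>(t, x)\<in>D. x \<in> fst c \<longrightarrow> F (t, x) \<in> fst c' \<longrightarrow>
        smooth_in (prod_topology euclideanreal (mtop M)) (map_prod (\<lambda>t. t) (snd c)) (snd c' \<circ> F) (t, x))"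
    (is "?L \<longleftrightarrow> ?R")
proof -
  let ?C = "\<lambda>c. (UNIV \<times> fst c, map_prod (\<lambda>t::real. t) (snd c))"
  have "?L \<longleftrightarrow> openin (prod_topology euclideanreal (mtop M)) D \<and>
     continuous_map (subtopology (prod_topology euclideanreal (mtop M)) D) (mtop M') F \<and>
     (\<forall>c\<in>atlas (prod_mfd real_mfd M). \<forall>c'\<in>atlas M'. \<forall>x\<in>fst c \<inter> D. F x \<in> fst c' \<longrightarrow>
        smooth_in (prod_topology euclideanreal (mtop M)) (snd c) (snd c' \<circ> F) x)"
    by (subst smooth_map_on_iff[OF is_chart_prod_real[OF M] smooth_manifold_facts(1)[OF M']])
      (simp_all add: prod_real_mfd_simps(1))
  also have "\<dots> \<longleftrightarrow> ?R"
  proof -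
    have eq: "atlas (prod_mfd real_mfd M) = ?C ` atlas M" unfolding prod_real_mfd_simps(3) by blast
    have key: "(\<forall>z\<in>fst (?C c) \<inter> D. F z \<in> fst c' \<longrightarrow>
          smooth_in (prod_topology euclideanreal (mtop M)) (snd (?C c)) (snd c' \<circ> F) z) \<longleftrightarrow>
        (\<forall>(t, x)\<in>D. x \<in> fst c \<longrightarrow> F (t, x) \<in> fst c' \<longrightarrow>
          smooth_in (prod_topology euclideanreal (mtop M)) (map_prod (\<lambda>t. t) (snd c)) (snd c' \<circ> F) (t, x))" for c c'
      by auto
    show ?thesis by (simp only: eq ball_simps key)
  qed
  finally show ?thesis .
qed

lemma time_mapD:
  assumes "smooth_manifold M" "smooth_manifold M'" "smooth_map_on D (prod_mfd real_mfd M) M' F"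
  shows "openin (prod_topology euclideanreal (mtop M)) D"
    "continuous_map (subtopology (prod_topology euclideanreal (mtop M)) D) (mtop M') F"
  using assms(3) unfolding time_map_iff[OF assms(1,2)] by simp_all

text \<open>Smoothness is given in atlas charts; slice charts, needed for the restricted flow, lie
  in the maximal atlas. The charts at the source and at the target are changed separately, time
  being left alone.\<close>

lemma time_map_smooth_in:
  assumes M: "smooth_manifold M" and M': "smooth_manifold M'"
    and F: "smooth_map_on D (prod_mfd real_mfd M) M' F"
    and tx: "(t, x) \<in> D" and c: "c \<in> max_atlas M" "x \<in> fst c" and c': "c' \<in> max_atlas M'" "F (t, x) \<in> fst c'"
  shows "smooth_in (prod_topology euclideanreal (mtop M)) (map_prod (\<lambda>t. t) (snd c)) (snd c' \<circ> F) (t, x)"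
proof -
  let ?T = "prod_topology euclideanreal (mtop M)"
  have FD: "openin ?T D" "continuous_map (subtopology ?T D) (mtop M') F"
    using time_mapD[OF M M' F] .
  have germ: "continuous_germ ?T (mtop M') F (t, x)" by (rule continuous_germI[OF FD(2,1) tx])
  have "x \<in> pts M" using openin_subset[OF is_chart_facts(1)[OF max_atlas_is_chart[OF c(1)]]] c(2) by blast
  then obtain c0 where c0: "c0 \<in> atlas M" "x \<in> fst c0" using smooth_manifold_facts(2)[OF M] by blast
  have "F (t, x) \<in> pts M'"
    using openin_subset[OF is_chart_facts(1)[OF max_atlas_is_chart[OF c'(1)]]] c'(2) by blast
  then obtain c1 where c1: "c1 \<in> atlas M'" "F (t, x) \<in> fst c1" using smooth_manifold_facts(2)[OF M'] by blast
  have sub: "c0 \<in> max_atlas M" "c1 \<in> max_atlas M'"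
    using c0 c1 atlas_subset_max_atlas[OF M] atlas_subset_max_atlas[OF M'] by blast+
  have "smooth_in ?T (map_prod (\<lambda>t. t) (snd c0)) (snd c1 \<circ> F) (t, x)"
    using F c0 c1 tx unfolding time_map_iff[OF M M'] by blast
  then have "smooth_in ?T (map_prod (\<lambda>t. t) (snd c0)) (snd c' \<circ> F) (t, x)"
    by (rule smooth_in_max_atlas_target[OF M' sub(2) c'(1) c1(2) c'(2) germ])
  with smooth_in_map_prod[OF max_atlas_change[OF M c(1) sub(1) c(2) c0(2)]]
  show ?thesis by (rule smooth_in_trans)
qed

lemma flowD:
  assumes "flow M D F"
  shows "smooth_map_on D (prod_mfd real_mfd M) M F"
    "\<And>x. x \<in> pts M \<Longrightarrow> is_interval {t. (t, x) \<in> D}"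
    "\<And>x. x \<in> pts M \<Longrightarrow> (0, x) \<in> D"
    "\<And>x. x \<in> pts M \<Longrightarrow> F (0, x) = x"
    "\<And>s t x. (s, x) \<in> D \<Longrightarrow> (t, F (s, x)) \<in> D \<Longrightarrow> (t + s, x) \<in> D \<Longrightarrow> F (t, F (s, x)) = F (t + s, x)"
  using assms unfolding flow_def by simp_all

lemma flow_ofD:
  assumes "flow_of M X D F"
  shows "flow M D F" "\<And>x. x \<in> pts M \<Longrightarrow> integral_curve M X {t. (t, x) \<in> D} (\<lambda>t. F (t, x))"
  using assms unfolding flow_of_def by simp_all

section \<open>Restriction of the flow to the submanifold\<close>

lemma flow_domain_in_open:
  assumes M: "smooth_manifold M" and X: "vector_field M X" and N: "submanifold M N"
    and tangent: "\<And>x. x \<in> N \<Longrightarrow> X x \<in> tangent_sub M N x" and F: "flow_of M X D F"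
  shows "openin (prod_topology euclideanreal (subtopology (mtop M) N)) (flow_domain_in N D F)"
proof -
  let ?T = "prod_topology euclideanreal (mtop M)"
  have NM: "N \<subseteq> pts M" using N unfolding submanifold_def by (rule conjunct1)
  note fl = flow_ofD(1)[OF F] and curve = flow_ofD(2)[OF F]
  note FD = time_mapD[OF M M flowD(1)[OF fl]] and F0 = flowD(4)[OF fl]
  have "\<exists>I W. openin euclideanreal I \<and> openin (subtopology (mtop M) N) W \<and> t0 \<in> I \<and> x0 \<in> W \<and>
      I \<times> W \<subseteq> flow_domain_in N D F"
    if "(t0, x0) \<in> flow_domain_in N D F" for t0 x0
  proof -
    define seg where "seg = closed_segment 0 t0"
    have x0: "x0 \<in> N" "(t0, x0) \<in> D" and segN: "\<And>s. s \<in> seg \<Longrightarrow> F (s, x0) \<in> N"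
      using that by (auto simp: flow_domain_in_def seg_def)
    have x0M: "x0 \<in> pts M" using NM x0(1) by blast
    have "closed_segment 0 t0 \<subseteq> {t. (t, x0) \<in> D}"
      using flowD(2,3)[OF fl x0M] x0(2) by (intro closed_segment_subset) (auto simp: is_interval_convex)
    then have segD: "(s, x0) \<in> D" if "s \<in> seg" for s using that unfolding seg_def by blast
    \<comment> \<open>For a nearby \<open>x\<close> it is known at time 0 only that the trajectory
      lies in \<open>N\<close>. A box therefore records a dichotomy: throughout its time ball, the
      trajectory of \<open>x\<close> is in \<open>N\<close> either always or never.\<close>
    define box where "box s \<delta> W \<longleftrightarrow> \<delta> > 0 \<and> openin (mtop M) W \<and> x0 \<in> W \<and> ball s \<delta> \<times> W \<subseteq> D \<and>
        (\<forall>x\<in>W. \<forall>r\<in>ball s \<delta>. \<forall>r'\<in>ball s \<delta>. F (r, x) \<in> N \<longrightarrow> F (r', x) \<in> N)" for s \<delta> W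
    have "\<exists>\<delta> W. box s \<delta> W"
      if s: "s \<in> seg" for s
    proof -
      obtain A where A: "openin (mtop M) A" "F (s, x0) \<in> A"
          "\<And>I \<gamma> r t. integral_curve M X I \<gamma> \<Longrightarrow> \<gamma> ` I \<subseteq> A \<Longrightarrow> r \<in> I \<Longrightarrow> t \<in> I \<Longrightarrow> \<gamma> r \<in> N \<Longrightarrow> \<gamma> t \<in> N"
        using tangent_field_locally_invariant[OF M X N tangent segN[OF s]] by blast
      let ?B = "{z \<in> topspace (subtopology ?T D). F z \<in> A}"
      have "openin ?T ?B"
        using openin_trans_full[OF openin_continuous_map_preimage[OF FD(2) A(1)] FD(1)] .
      moreover have "(s, x0) \<in> ?B" using segD[OF s] A(2) openin_subset[OF FD(1)] by auto
      ultimately obtain S W where SW: "openin euclideanreal S" "openin (mtop M) W" "s \<in> S" "x0 \<in> W" "S \<times> W \<subseteq> ?B"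
        by (rule openin_prod_topologyE)
      have "open S" using SW(1) by (simp add: open_openin[symmetric])
      then obtain \<delta> where \<delta>: "\<delta> > 0" "ball s \<delta> \<subseteq> S" using SW(3) openE by blast
      have inB: "(r, x) \<in> D" "F (r, x) \<in> A" if "r \<in> ball s \<delta>" "x \<in> W" for r x
      proof -
        have "(r, x) \<in> ?B" using that \<delta> SW(5) by blast
        then show "(r, x) \<in> D" "F (r, x) \<in> A" by auto
      qed
      have "F (r', x) \<in> N" if x: "x \<in> W" and r: "r \<in> ball s \<delta>" "r' \<in> ball s \<delta>" and rN: "F (r, x) \<in> N" for x r r'
      proof -
        have xM: "x \<in> pts M" using openin_subset[OF SW(2)] x by blast
        have "integral_curve M X (ball s \<delta>) (\<lambda>t. F (t, x))"
          by (rule integral_curve_subset[OF curve[OF xM]]) (use inB x in \<open>auto simp: is_interval_ball_real\<close>)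
        from A(3)[OF this _ r] rN inB(2)[OF _ x] show ?thesis by blast
      qed
      moreover have "ball s \<delta> \<times> W \<subseteq> D" using inB(1) by blast
      ultimately have "box s \<delta> W" unfolding box_def using \<delta>(1) SW(2,4) by blast
      then show ?thesis by blast
    qed
    then obtain \<delta> W where "\<forall>s\<in>seg. box s (\<delta> s) (W s)" by metis
    then have \<delta>W: "\<And>s. s \<in> seg \<Longrightarrow> \<delta> s > 0 \<and> openin (mtop M) (W s) \<and> x0 \<in> W s \<and>
        ball s (\<delta> s) \<times> W s \<subseteq> D \<and>
        (\<forall>x\<in>W s. \<forall>r\<in>ball s (\<delta> s). \<forall>r'\<in>ball s (\<delta> s). F (r, x) \<in> N \<longrightarrow> F (r', x) \<in> N)"
      unfolding box_def by blast
    have "compact seg" by (simp add: seg_def)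
    moreover have "seg \<subseteq> (\<Union>s\<in>seg. ball s (\<delta> s))" using \<delta>W by (auto intro!: bexI)
    ultimately obtain C where C: "C \<subseteq> seg" "finite C" "seg \<subseteq> (\<Union>s\<in>C. ball s (\<delta> s))"
      using compactE_image[of seg seg "\<lambda>s. ball s (\<delta> s)"] by (metis open_ball)
    define I where "I = (\<Union>s\<in>C. ball s (\<delta> s))"
    define W' where "W' = (\<Inter>s\<in>C. W s)"
    have C0: "C \<noteq> {}" "0 \<in> seg" using C(3) by (auto simp: seg_def)
    have oI: "open I" unfolding I_def by blast
    \<comment> \<open>Each ball is joined to \<open>seg\<close> at its centre. Since the balls cover
      \<open>seg\<close>, adding \<open>seg\<close> to each of them does not change their union
      \<open>I\<close>, which is thus seen to be connected.\<close>
    have "connected (\<Union>s\<in>C. seg \<union> ball s (\<delta> s))"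
    proof (rule connected_Union)
      fix S assume "S \<in> (\<lambda>s. seg \<union> ball s (\<delta> s)) ` C"
      then obtain s where s: "s \<in> C" "S = seg \<union> ball s (\<delta> s)" by blast
      then have "s \<in> seg \<inter> ball s (\<delta> s)" using C(1) \<delta>W by auto
      then show "connected S" unfolding s(2) by (intro connected_Un) (auto simp: seg_def)
    qed (use C0 in auto)
    moreover have "(\<Union>s\<in>C. seg \<union> ball s (\<delta> s)) = I" using C(3) C0(1) unfolding I_def by blast
    ultimately have cI: "connected I" by simp
    then have "convex I" by (simp add: is_interval_connected_1[symmetric] is_interval_convex_1)
    moreover have I0: "0 \<in> I" using C(3) C0(2) unfolding I_def by blast
    ultimately have segI: "closed_segment 0 t \<subseteq> I" if "t \<in> I" for t
      using that by (intro closed_segment_subset)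
    have W': "openin (mtop M) W'"
      unfolding W'_def
    proof (rule openin_INT2[OF C(2) C0(1)])
      show "openin (mtop M) (W s)" if "s \<in> C" for s using \<delta>W[of s] C(1) that by blast
    qed
    have inN: "F (t, x) \<in> N" if x: "x \<in> W'" "x \<in> N" and t: "t \<in> I" for t x
    proof -
      \<comment> \<open>By the dichotomy both \<open>E\<close> and its complement in
        \<open>I\<close> are unions of the covering balls, hence open. Time 0 belongs to
        \<open>E\<close> because \<open>x\<close> is in \<open>N\<close>.\<close>
      define E where "E = {r \<in> I. F (r, x) \<in> N}"
      have same: "F (r, x) \<in> N \<longleftrightarrow> F (s, x) \<in> N" if "s \<in> C" "r \<in> ball s (\<delta> s)" for r s
      proof -
        have s: "s \<in> seg" "x \<in> W s" using that(1) C(1) x(1) unfolding W'_def by blast+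
        then have "s \<in> ball s (\<delta> s)" using \<delta>W[OF s(1)] by simp
        then show ?thesis using \<delta>W[OF s(1)] s(2) that(2) by blast
      qed
      have "E = (\<Union>s\<in>{s\<in>C. F (s, x) \<in> N}. ball s (\<delta> s))" "I - E = (\<Union>s\<in>{s\<in>C. F (s, x) \<notin> N}. ball s (\<delta> s))"
        unfolding E_def I_def using same by blast+
      then have "open E" "open (I - E)" by auto
      then have "E \<inter> I = {} \<or> (I - E) \<inter> I = {}"
        using cI by (intro connectedD) auto
      moreover have "0 \<in> E" using I0 F0[of x] x(2) NM unfolding E_def by auto
      ultimately have "I \<subseteq> E" using I0 by blast
      then show ?thesis using t by (auto simp: E_def)
    qed
    have "I \<times> (W' \<inter> N) \<subseteq> flow_domain_in N D F"
    proof clarify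
      fix t x assume t: "t \<in> I" and x: "x \<in> W'" "x \<in> N"
      have "(t, x) \<in> D"
      proof -
        obtain s where "s \<in> C" "t \<in> ball s (\<delta> s)" using t I_def by blast
        then show ?thesis using \<delta>W[of s] C(1) x(1) unfolding W'_def by blast
      qed
      then show "(t, x) \<in> flow_domain_in N D F"
        using inN[OF x] segI[OF t] x(2) by (auto simp: flow_domain_in_def)
    qed
    moreover have "t0 \<in> I" using C(3) ends_in_segment(2)[of t0 0] unfolding I_def seg_def by blast
    moreover have "x0 \<in> W' \<inter> N" using \<delta>W C(1) x0(1) by (auto simp: W'_def)
    moreover have "openin (subtopology (mtop M) N) (W' \<inter> N)" using W' by (rule openin_subtopology_Int)
    moreover have "openin euclideanreal I" using oI by (simp flip: open_openin)
    ultimately show ?thesis by blast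
  qed
  then show ?thesis unfolding openin_prod_topology_alt by blast
qed

lemma flow_submfd:
  assumes M: "smooth_manifold M" and X: "vector_field M X" and N: "submanifold M N"
    and tangent: "\<And>x. x \<in> N \<Longrightarrow> X x \<in> tangent_sub M N x" and F: "flow_of M X D F"
  shows "flow (submfd M N) (flow_domain_in N D F) F"
proof -
  let ?S = "submfd M N" and ?T = "prod_topology euclideanreal (mtop M)"
  let ?DN = "flow_domain_in N D F"
  have NM: "N \<subseteq> pts M" using N unfolding submanifold_def by (rule conjunct1)
  then have ptsS: "pts ?S = N" by (auto simp: submfd_simps(1))
  note S = smooth_manifold_submfd[OF M N]
  note fl = flow_ofD(1)[OF F]
  note sm = flowD(1)[OF fl]
  have DN: "?DN \<subseteq> D" "\<And>t x. (t, x) \<in> ?DN \<Longrightarrow> F (t, x) \<in> N" "\<And>t x. (t, x) \<in> ?DN \<Longrightarrow> x \<in> N"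
    by (auto simp: flow_domain_in_def)
  \<comment> \<open>The product with the submanifold carries the subspace topology of the full
    product, so a smooth germ of \<open>F\<close> in slice charts restricts with the same smooth
    factor.\<close>
  have top: "mtop (prod_mfd real_mfd ?S) = subtopology ?T (UNIV \<times> N)"
    using subtopology_Times[of euclideanreal "mtop M" UNIV N] by (simp add: prod_real_mfd_simps submfd_simps(1))
  have smooth: "smooth_map_on ?DN (prod_mfd real_mfd ?S) ?S F"
    unfolding time_map_iff[OF S S]
  proof (intro conjI ballI)
    show "openin (prod_topology euclideanreal (mtop ?S)) ?DN"
      using flow_domain_in_open[OF M X N tangent F] by (simp add: submfd_simps(1))
    note time_mapD(2)[OF M M sm]
    then have "continuous_map (subtopology ?T ?DN) (mtop M) F"
      using DN(1) continuous_map_from_subtopology_mono by blast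
    moreover have "F \<in> topspace (subtopology ?T ?DN) \<rightarrow> N" using DN(2) by auto
    moreover have "subtopology (prod_topology euclideanreal (mtop ?S)) ?DN = subtopology ?T ?DN"
    proof -
      have "(UNIV \<times> N) \<inter> ?DN = ?DN" using DN(3) by auto
      then show ?thesis using top by (simp add: prod_real_mfd_simps subtopology_subtopology)
    qed
    ultimately show "continuous_map (subtopology (prod_topology euclideanreal (mtop ?S)) ?DN) (mtop ?S) F"
      by (simp add: submfd_simps(1) continuous_map_in_subtopology image_subset_iff_funcset)
    fix c c' z
    assume c: "c \<in> atlas ?S" and c': "c' \<in> atlas ?S" and z: "z \<in> ?DN"
    obtain d where d: "c = (fst d \<inter> N, snd d)" "d \<in> max_atlas M" using atlas_submfdE[OF c] by metis
    obtain d' where d': "c' = (fst d' \<inter> N, snd d')" "d' \<in> max_atlas M" using atlas_submfdE[OF c'] by metis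
    obtain t x where tx: "z = (t, x)" by (cases z)
    have "smooth_in (prod_topology euclideanreal (mtop ?S)) (map_prod (\<lambda>t. t) (snd c)) (snd c' \<circ> F) (t, x)"
      if "x \<in> fst c" "F (t, x) \<in> fst c'"
    proof -
      have "smooth_in ?T (map_prod (\<lambda>t. t) (snd d)) (snd d' \<circ> F) (t, x)"
        using time_map_smooth_in[OF M M sm _ d(2) _ d'(2)] that z DN(1) tx d(1) d'(1) by auto
      from smooth_in_subtopology[OF this, of "UNIV \<times> N"] that d(1) show ?thesis
        using top d d' by (simp add: prod_real_mfd_simps)
    qed
    then show "case z of (t, x) \<Rightarrow> x \<in> fst c \<longrightarrow> F (t, x) \<in> fst c' \<longrightarrow>
        smooth_in (prod_topology euclideanreal (mtop ?S)) (map_prod (\<lambda>t. t) (snd c)) (snd c' \<circ> F) (t, x)"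
      by (simp add: tx)
  qed
  have fibre: "is_interval {t. (t, x) \<in> ?DN}" "(0, x) \<in> ?DN" "F (0, x) = x" if x: "x \<in> N" for x
  proof -
    have xM: "x \<in> pts M" using NM x by blast
    note * = flowD(2,3)[OF fl xM] and F0 = flowD(4)[OF fl xM]
    show "F (0, x) = x" by (rule F0)
    show "(0, x) \<in> ?DN" using * F0 x by (auto simp: flow_domain_in_def)
    \<comment> \<open>The time domain is star-shaped about 0, because staying in \<open>N\<close> is
      demanded on the whole segment from 0. A star-shaped set of reals is an interval.\<close>
    have sub: "s \<in> {t. (t, x) \<in> ?DN}" if "s \<in> closed_segment 0 t" "(t, x) \<in> ?DN" for s t
    proof -
      have t: "(t, x) \<in> D" "\<forall>s\<in>closed_segment 0 t. F (s, x) \<in> N" using that(2) by (auto simp: flow_domain_in_def)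
      have "closed_segment 0 t \<subseteq> {t. (t, x) \<in> D}"
        using * t(1) is_interval_convex by (intro closed_segment_subset) auto
      moreover have "closed_segment 0 s \<subseteq> closed_segment 0 t"
        using that(1) by (intro closed_segment_subset) auto
      ultimately show ?thesis using that(1) t(2) x by (auto simp: flow_domain_in_def)
    qed
    show "is_interval {t. (t, x) \<in> ?DN}" unfolding is_interval_1
    proof (intro ballI allI impI)
      fix a b s assume ab: "a \<in> {t. (t, x) \<in> ?DN}" "b \<in> {t. (t, x) \<in> ?DN}" "a \<le> s \<and> s \<le> b"
      have "s \<in> closed_segment 0 a \<or> s \<in> closed_segment 0 b"
        using ab(3) by (auto simp: closed_segment_eq_real_ivl)
      then show "s \<in> {t. (t, x) \<in> ?DN}" using sub ab(1,2) by blast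
    qed
  qed
  have law: "F (t, F (s, x)) = F (t + s, x)" if "(s, x) \<in> ?DN" "(t, F (s, x)) \<in> ?DN" "(t + s, x) \<in> ?DN" for s t x
    using flowD(5)[OF fl] that DN(1) by blast
  show ?thesis unfolding flow_def ptsS
    by (intro conjI ballI allI impI) (use smooth fibre law in simp_all)
qed

section \<open>Symmetries of a vector field and its flow\<close>

lemma continuous_map_germI:
  assumes "\<And>x. x \<in> topspace T \<Longrightarrow> f x \<in> topspace T'"
    and "\<And>x. x \<in> topspace T \<Longrightarrow> continuous_germ T T' f x"
  shows "continuous_map T T' f"
  unfolding continuous_map_alt
proof (intro conjI allI impI)
  show "f \<in> topspace T \<rightarrow> topspace T'" using assms(1) by blast
  fix B assume B: "openin T' B"
  show "openin T (f -` B \<inter> topspace T)"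
  proof (subst openin_subopen, rule ballI)
    fix x assume "x \<in> f -` B \<inter> topspace T"
    then have "x \<in> topspace T" "f x \<in> B" by auto
    then obtain A where "openin T A" "x \<in> A" "f ` A \<subseteq> B"
      using assms(2)[of x] B unfolding continuous_germ_def by blast
    then show "\<exists>A. openin T A \<and> x \<in> A \<and> A \<subseteq> f -` B \<inter> topspace T"
      using openin_subset by (intro exI[of _ A]) blast
  qed
qed

lemma continuous_germ_compose:
  assumes "continuous_germ T T' f x" "continuous_germ T' T'' g (f x)"
  shows "continuous_germ T T'' (g \<circ> f) x"
  unfolding continuous_germ_def
proof (intro allI impI)
  fix C assume "openin T'' C \<and> (g \<circ> f) x \<in> C"
  then obtain B where B: "openin T' B" "f x \<in> B" "g ` B \<subseteq> C"
    using assms(2) unfolding continuous_germ_def by auto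
  then obtain A where "openin T A" "x \<in> A" "f ` A \<subseteq> B"
    using assms(1) unfolding continuous_germ_def by auto
  then show "\<exists>A. openin T A \<and> x \<in> A \<and> (g \<circ> f) ` A \<subseteq> C"
    using B(3) by (intro exI[of _ A]) auto
qed

lemma continuous_germ_cong:
  assumes "continuous_germ T T' f x" "openin T A" "x \<in> A" "\<And>y. y \<in> A \<Longrightarrow> f y = g y"
  shows "continuous_germ T T' g x"
  unfolding continuous_germ_def
proof (intro allI impI)
  fix B assume "openin T' B \<and> g x \<in> B"
  then have "openin T' B" "f x \<in> B" using assms(3,4) by auto
  then obtain C where "openin T C" "x \<in> C" "f ` C \<subseteq> B"
    using assms(1) unfolding continuous_germ_def by auto
  then show "\<exists>A. openin T A \<and> x \<in> A \<and> g ` A \<subseteq> B"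
    using assms(2-4) by (intro exI[of _ "A \<inter> C"]) auto
qed

lemma continuous_germ_from_subtopology:
  assumes "continuous_germ T T' f x" "x \<in> S"
  shows "continuous_germ (subtopology T S) T' f x"
  unfolding continuous_germ_def
proof (intro allI impI)
  fix B assume "openin T' B \<and> f x \<in> B"
  then obtain A where "openin T A" "x \<in> A" "f ` A \<subseteq> B"
    using assms(1) unfolding continuous_germ_def by auto
  then show "\<exists>A. openin (subtopology T S) A \<and> x \<in> A \<and> f ` A \<subseteq> B"
    using assms(2) by (intro exI[of _ "A \<inter> S"]) (auto intro: openin_subtopology_Int)
qed

text \<open>Continuity and the differential equation are local in time; this glues curves that agree
  on overlaps.\<close>

lemma integral_curve_localI:
  assumes I: "open I" "is_interval I"
    and loc: "\<And>t. t \<in> I \<Longrightarrow> \<exists>J \<gamma>'. t \<in> J \<and> integral_curve M X J \<gamma>' \<and> (\<forall>s\<in>J. \<gamma>' s = \<gamma> s)"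
  shows "integral_curve M X I \<gamma>"
proof -
  have *: "continuous_germ euclideanreal (mtop M) \<gamma> t \<and> \<gamma> t \<in> pts M \<and>
      ((snd (chart_at M (\<gamma> t)) \<circ> \<gamma>) has_vector_derivative X (\<gamma> t)) (at t)" if t: "t \<in> I" for t
  proof -
    obtain J \<gamma>' where J: "t \<in> J" "integral_curve M X J \<gamma>'" "\<And>s. s \<in> J \<Longrightarrow> \<gamma>' s = \<gamma> s"
      using loc[OF t] by blast
    have oJ: "open J" using J(2) by (simp add: integral_curve_def)
    have eq: "\<gamma>' t = \<gamma> t" using J(1,3) by blast
    have "((snd (chart_at M (\<gamma> t)) \<circ> \<gamma>') has_vector_derivative X (\<gamma> t)) (at t)"
      using J(1,2) unfolding integral_curve_def eq[symmetric] by blast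
    then have "((snd (chart_at M (\<gamma> t)) \<circ> \<gamma>) has_vector_derivative X (\<gamma> t)) (at t)"
      by (rule has_vector_derivative_transform_within_open[OF _ oJ J(1)]) (simp add: J(3))
    moreover have "continuous_germ euclideanreal (mtop M) \<gamma> t"
      using continuous_germ_cong[OF integral_curve_germ(1)[OF J(2,1)] _ J(1,3)] oJ
      by (simp flip: open_openin)
    ultimately show ?thesis using integral_curve_germ(2)[OF J(2,1)] eq by simp
  qed
  have "continuous_map (top_of_set I) (mtop M) \<gamma>"
    by (rule continuous_map_germI) (use * in \<open>auto intro: continuous_germ_from_subtopology\<close>)
  then show ?thesis unfolding integral_curve_def using I * by (intro conjI ballI) auto
qed

text \<open>Maximality in \<open>flow_of\<close> concerns extensions of the trajectory only, whereas
  \<open>I\<close> may neither contain its time domain nor lie in it. Gluing the two curves yields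
  an extension, so the union of their domains is already the maximal one.\<close>

lemma integral_curve_eq_flow:
  assumes M: "smooth_manifold M" and X: "vector_field M X" and F: "flow_of M X D F"
    and x: "x \<in> pts M" and \<gamma>: "integral_curve M X I \<gamma>" "0 \<in> I" "\<gamma> 0 = x" and t: "t \<in> I"
  shows "(t, x) \<in> D" "\<gamma> t = F (t, x)"
proof -
  let ?D = "{t. (t, x) \<in> D}" and ?F = "\<lambda>t. F (t, x)"
  note fl = flow_ofD(1)[OF F] and cF = flow_ofD(2)[OF F x]
  have oD: "open ?D" "is_interval ?D" and oI: "open I" "is_interval I"
    using cF \<gamma>(1) unfolding integral_curve_def by simp_all
  have 0: "0 \<in> ?D" "?F 0 = x" using flowD(3,4)[OF fl x] by auto
  have J: "open (I \<inter> ?D)" "is_interval (I \<inter> ?D)" using oD oI by (auto intro: is_interval_Int)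
  have agree: "\<gamma> s = ?F s" if "s \<in> I" "s \<in> ?D" for s
    by (rule integral_curve_unique[OF M X, of "I \<inter> ?D" _ _ 0])
      (use that 0 \<gamma> integral_curve_subset[OF \<gamma>(1) J] integral_curve_subset[OF cF J] in auto)
  \<comment> \<open>On the overlap, an interval containing 0, both curves agree by uniqueness, so
    the preference given to \<open>?F\<close> there is harmless.\<close>
  define \<delta> where "\<delta> s = (if s \<in> ?D then ?F s else \<gamma> s)" for s
  have "connected (I \<union> ?D)"
    using oI(2) oD(2) \<gamma>(2) 0(1) by (intro connected_Un) (auto simp: is_interval_connected_1)
  then have "is_interval (I \<union> ?D)" by (simp add: is_interval_connected_1)
  then have \<delta>: "integral_curve M X (I \<union> ?D) \<delta>"
  proof (intro integral_curve_localI open_Un oI oD)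
    fix s assume "s \<in> I \<union> ?D"
    then show "\<exists>J \<gamma>'. s \<in> J \<and> integral_curve M X J \<gamma>' \<and> (\<forall>s\<in>J. \<gamma>' s = \<delta> s)"
    proof
      assume "s \<in> I"
      then show ?thesis using \<gamma>(1) agree by (intro exI[of _ I] exI[of _ \<gamma>]) (simp add: \<delta>_def)
    next
      assume "s \<in> ?D"
      then show ?thesis using cF by (intro exI[of _ ?D] exI[of _ ?F]) (simp add: \<delta>_def)
    qed
  qed
  have "I \<union> ?D = ?D"
  proof -
    have "\<forall>I \<gamma>. integral_curve M X I \<gamma> \<and> ?D \<subseteq> I \<and> (\<forall>t. (t, x) \<in> D \<longrightarrow> \<gamma> t = F (t, x)) \<longrightarrow> I = ?D"
      using F x unfolding flow_of_def by simp
    from this[rule_format, of "I \<union> ?D" \<delta>] \<delta> show ?thesis by (simp add: \<delta>_def)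
  qed
  then show "(t, x) \<in> D" using t by blast
  then show "\<gamma> t = F (t, x)" using agree t by simp
qed

section \<open>Equivariance under smooth maps preserving the field\<close>

text \<open>Only the chart property of the atlases is assumed, so that the result applies to the
  product of group and manifold as soon as product charts are known to be charts.\<close>

lemma smooth_map_onD:
  assumes "\<forall>c\<in>atlas M. is_chart M c" "\<forall>c\<in>atlas M'. is_chart M' c" "smooth_map_on D M M' F"
  shows "continuous_map (subtopology (mtop M) D) (mtop M') F"
    "\<forall>c\<in>atlas M. \<forall>c'\<in>atlas M'. \<forall>x\<in>fst c \<inter> D. F x \<in> fst c' \<longrightarrow> smooth_in (mtop M) (snd c) (snd c' \<circ> F) x"
proof -
  have "openin (mtop M) D \<and> continuous_map (subtopology (mtop M) D) (mtop M') F \<and>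
     (\<forall>c\<in>atlas M. \<forall>c'\<in>atlas M'. \<forall>x\<in>fst c \<inter> D. F x \<in> fst c' \<longrightarrow> smooth_in (mtop M) (snd c) (snd c' \<circ> F) x)"
    using assms(3) by (subst (asm) smooth_map_on_iff) (use assms(1,2) in simp_all)
  then show "continuous_map (subtopology (mtop M) D) (mtop M') F"
    "\<forall>c\<in>atlas M. \<forall>c'\<in>atlas M'. \<forall>x\<in>fst c \<inter> D. F x \<in> fst c' \<longrightarrow> smooth_in (mtop M) (snd c) (snd c' \<circ> F) x"
    by - (elim conjE, assumption)+
qed

lemma smooth_manifold_map_iff:
  assumes "smooth_manifold M" "smooth_manifold M'"
  shows "smooth_map_on D M M' F \<longleftrightarrow> openin (mtop M) D \<and>
     continuous_map (subtopology (mtop M) D) (mtop M') F \<and>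
     (\<forall>c\<in>atlas M. \<forall>c'\<in>atlas M'. \<forall>x\<in>fst c \<inter> D. F x \<in> fst c' \<longrightarrow> smooth_in (mtop M) (snd c) (snd c' \<circ> F) x)"
  by (rule smooth_map_on_iff; rule smooth_manifold_facts(1)[OF assms(1)] smooth_manifold_facts(1)[OF assms(2)])

lemma smooth_mapD:
  assumes "smooth_manifold M" "smooth_manifold M'" "smooth_map M M' \<Psi>"
  shows "continuous_map (mtop M) (mtop M') \<Psi>"
    "\<And>x. x \<in> pts M \<Longrightarrow> \<Psi> x \<in> pts M'"
    "\<And>x. x \<in> pts M \<Longrightarrow> continuous_germ (mtop M) (mtop M') \<Psi> x"
    "\<And>c c' x. c \<in> atlas M \<Longrightarrow> c' \<in> atlas M' \<Longrightarrow> x \<in> fst c \<Longrightarrow> \<Psi> x \<in> fst c' \<Longrightarrow>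
       smooth_in (mtop M) (snd c) (snd c' \<circ> \<Psi>) x"
proof -
  note iff = smooth_manifold_map_iff[OF assms(1,2)]
  have c: "continuous_map (subtopology (mtop M) (pts M)) (mtop M') \<Psi>"
    using assms(3) unfolding iff by blast
  then show c': "continuous_map (mtop M) (mtop M') \<Psi>" by simp
  show "\<Psi> x \<in> pts M'" if "x \<in> pts M" for x
    using continuous_map_image_subset_topspace[OF c'] that by blast
  show "continuous_germ (mtop M) (mtop M') \<Psi> x" if "x \<in> pts M" for x
    by (rule continuous_germI[OF c _ that]) simp
  show "smooth_in (mtop M) (snd c) (snd c' \<circ> \<Psi>) x"
    if "c \<in> atlas M" "c' \<in> atlas M'" "x \<in> fst c" "\<Psi> x \<in> fst c'" for c c' x
  proof -
    have "x \<in> pts M"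
      using openin_subset[OF is_chart_facts(1)[OF smooth_manifold_facts(1)[OF assms(1) that(1)]]] that(3) by blast
    then show ?thesis using assms(3) that unfolding iff by blast
  qed
qed

lemma integral_curve_image:
  assumes M: "smooth_manifold M" and X: "vector_field M X" and \<Psi>: "smooth_map M M \<Psi>"
    and pres: "\<forall>x\<in>pts M. tmap M M \<Psi> x (X x) = X (\<Psi> x)" and \<gamma>: "integral_curve M X I \<gamma>"
  shows "integral_curve M X I (\<Psi> \<circ> \<gamma>)"
  unfolding integral_curve_def
proof (intro conjI ballI)
  show "open I" "is_interval I" using \<gamma> by (auto simp: integral_curve_def)
  have "continuous_map (top_of_set I) (mtop M) \<gamma>" using \<gamma> by (simp add: integral_curve_def)
  then show "continuous_map (top_of_set I) (mtop M) (\<Psi> \<circ> \<gamma>)"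
    using smooth_mapD(1)[OF M M \<Psi>] by (rule continuous_map_compose)
  fix t assume t: "t \<in> I"
  note germ = integral_curve_germ[OF \<gamma> t]
  have "X (\<gamma> t) \<in> mspace M" using X germ(2) unfolding vector_field_on_def by blast
  moreover have "((snd (chart_at M (\<gamma> t)) \<circ> \<gamma>) has_vector_derivative X (\<gamma> t)) (at t)"
    using \<gamma> t unfolding integral_curve_def by blast
  moreover have "smooth_in (mtop M) (snd (chart_at M (\<gamma> t))) (snd (chart_at M (\<Psi> (\<gamma> t))) \<circ> \<Psi>) (\<gamma> t)"
    using smooth_manifold_facts(5)[OF M germ(2)] smooth_manifold_facts(5)[OF M smooth_mapD(2)[OF M M \<Psi> germ(2)]]
    by (intro smooth_mapD(4)[OF M M \<Psi>]) auto
  ultimately have "((snd (chart_at M (\<Psi> (\<gamma> t))) \<circ> \<Psi> \<circ> \<gamma>) has_vector_derivative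
      tmap M M \<Psi> (\<gamma> t) (X (\<gamma> t))) (at t)"
    unfolding tmap_def using dfun_curve[where \<gamma> = \<gamma> and t = t, OF M germ(2)] germ(1) by blast
  then show "((snd (chart_at M ((\<Psi> \<circ> \<gamma>) t)) \<circ> (\<Psi> \<circ> \<gamma>)) has_vector_derivative X ((\<Psi> \<circ> \<gamma>) t)) (at t)"
    using bspec[OF pres germ(2)] by (simp add: comp_assoc)
qed

text \<open>The image of a trajectory under \<open>\<Psi>\<close> is an integral curve starting at
  \<open>\<Psi> x\<close>. Comparing it with the maximal one yields at once that \<open>t\<close> is
  admissible for \<open>\<Psi> x\<close> and that the values agree.\<close>

lemma flow_equivariant:
  assumes M: "smooth_manifold M" and X: "vector_field M X" and \<Psi>: "smooth_map M M \<Psi>"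
    and pres: "\<forall>x\<in>pts M. tmap M M \<Psi> x (X x) = X (\<Psi> x)" and F: "flow_of M X D F"
    and x: "x \<in> pts M" and t: "(t, x) \<in> D"
  shows "(t, \<Psi> x) \<in> D" "F (t, \<Psi> x) = \<Psi> (F (t, x))"
proof -
  note fl = flow_ofD(1)[OF F]
  note c = integral_curve_image[OF M X \<Psi> pres flow_ofD(2)[OF F x]]
  have "(\<Psi> \<circ> (\<lambda>t. F (t, x))) 0 = \<Psi> x" using flowD(4)[OF fl x] by simp
  from integral_curve_eq_flow[OF M X F smooth_mapD(2)[OF M M \<Psi> x] c _ this, of t] t flowD(3)[OF fl x]
  show "(t, \<Psi> x) \<in> D" "F (t, \<Psi> x) = \<Psi> (F (t, x))" by auto
qed

text \<open>Membership in the restricted domain concerns all intermediate times, so equivariance is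
  applied along the whole segment from 0 to \<open>t\<close>.\<close>

lemma flow_domain_in_equivariant:
  assumes M: "smooth_manifold M" and X: "vector_field M X" and \<Psi>: "smooth_map M M \<Psi>"
    and pres: "\<forall>x\<in>pts M. tmap M M \<Psi> x (X x) = X (\<Psi> x)" and F: "flow_of M X D F"
    and N: "N \<subseteq> pts M" "\<Psi> ` N \<subseteq> N" and t: "(t, x) \<in> flow_domain_in N D F"
  shows "(t, \<Psi> x) \<in> flow_domain_in N D F" "F (t, \<Psi> x) = \<Psi> (F (t, x))"
proof -
  note fl = flow_ofD(1)[OF F]
  have tx: "x \<in> N" "(t, x) \<in> D" "\<And>s. s \<in> closed_segment 0 t \<Longrightarrow> F (s, x) \<in> N"
    using t by (auto simp: flow_domain_in_def)
  have x: "x \<in> pts M" using tx(1) N(1) by blast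
  note eqv = flow_equivariant[OF M X \<Psi> pres F x]
  have "closed_segment 0 t \<subseteq> {t. (t, x) \<in> D}"
    using flowD(2,3)[OF fl x] tx(2) by (intro closed_segment_subset) (auto simp: is_interval_convex)
  then have "F (s, \<Psi> x) \<in> N" if "s \<in> closed_segment 0 t" for s
    using eqv(2)[of s] tx(3)[OF that] that N(2) by auto
  then show "(t, \<Psi> x) \<in> flow_domain_in N D F" using eqv(1)[OF tx(2)] tx(1) N(2) by (auto simp: flow_domain_in_def)
  show "F (t, \<Psi> x) = \<Psi> (F (t, x))" using eqv(2)[OF tx(2)] .
qed

lemma smooth_in_Pair_const:
  assumes "x \<in> topspace T"
  shows "smooth_in T \<phi> (\<lambda>y. (a, \<phi> y)) x"
  unfolding smooth_in_def
  by (intro exI[of _ UNIV] exI[of _ "\<lambda>p. (a, p)"] exI[of _ "topspace T"])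
    (auto simp: assms intro!: Ck_on_Pair Ck_on_const Ck_on_id)

text \<open>Freezing the group element composes the joint action map with the smooth inclusion
  \<open>?P\<close>, whose first coordinate is constant.\<close>

lemma smooth_map_action:
  assumes act: "lie_group_action G MG M \<Phi>" and g: "g \<in> carrier G"
  shows "smooth_map M M (\<Phi> g)"
proof -
  have M: "smooth_manifold M" and MG: "smooth_manifold MG" "pts MG = carrier G"
    using act unfolding lie_group_action_def lie_group_def by blast+
  let ?T = "prod_topology (mtop MG) (mtop M)" and ?\<Phi> = "\<lambda>(g, x). \<Phi> g x" and ?P = "\<lambda>x. (g, x)"
  have chP: "is_chart (prod_mfd MG M) c" if "c \<in> atlas (prod_mfd MG M)" for c
  proof -
    have "c \<in> {(fst a \<times> fst b, map_prod (snd a) (snd b)) | a b. a \<in> atlas MG \<and> b \<in> atlas M}"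
      using that by (simp add: prod_mfd_def)
    then obtain a b where ab: "c = (fst a \<times> fst b, map_prod (snd a) (snd b))" "a \<in> atlas MG" "b \<in> atlas M"
      by blast
    show ?thesis unfolding ab(1)
      by (rule is_chart_prod[OF smooth_manifold_facts(1)[OF MG(1) ab(2)] smooth_manifold_facts(1)[OF M ab(3)]])
  qed
  have top: "mtop (prod_mfd MG M) = ?T" by (simp add: prod_mfd_def)
  have sm: "smooth_map (prod_mfd MG M) M ?\<Phi>" using act unfolding lie_group_action_def by blast
  have chM: "\<forall>c\<in>atlas M. is_chart M c" "\<forall>c\<in>atlas (prod_mfd MG M). is_chart (prod_mfd MG M) c"
    using smooth_manifold_facts(1)[OF M] chP by auto
  note sm' = smooth_map_onD[OF chM(2,1) sm, unfolded top]
  have cont: "continuous_map ?T (mtop M) ?\<Phi>" using sm'(1) unfolding subtopology_topspace .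
  have gG: "g \<in> pts MG" using g MG(2) by simp
  have P: "continuous_map (mtop M) ?T ?P"
    using gG by (intro continuous_map_pairedI) auto
  show ?thesis
    unfolding smooth_manifold_map_iff[OF M M]
  proof (intro conjI ballI impI)
    show "openin (mtop M) (pts M)" by simp
    have "continuous_map (mtop M) (mtop M) (\<Phi> g)"
      using continuous_map_compose[OF P cont] by (simp add: o_def)
    then show "continuous_map (subtopology (mtop M) (pts M)) (mtop M) (\<Phi> g)" by simp
    fix c c' x assume c: "c \<in> atlas M" "c' \<in> atlas M" and x: "x \<in> fst c \<inter> pts M" "\<Phi> g x \<in> fst c'"
    obtain cg where cg: "cg \<in> atlas MG" "g \<in> fst cg" using smooth_manifold_facts(2)[OF MG(1) gG] by blast
    let ?c = "(fst cg \<times> fst c, map_prod (snd cg) (snd c))"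
    have "?c \<in> atlas (prod_mfd MG M)" unfolding prod_mfd_def mfd.simps using cg(1) c(1) by blast
    moreover have "(g, x) \<in> fst ?c \<inter> topspace ?T" using cg(2) gG x(1) by auto
    ultimately have f: "smooth_in ?T (snd ?c) (snd c' \<circ> ?\<Phi>) (?P x)"
      using sm'(2)[rule_format, of ?c c' "(g, x)"] c(2) x(2) by simp
    have p: "smooth_in (mtop M) (snd c) (snd ?c \<circ> ?P) x"
      using smooth_in_Pair_const[of x "mtop M" "snd c" "snd cg g"] x(1) by (simp add: o_def)
    have "continuous_germ (mtop M) ?T ?P x"
      by (rule continuous_germI[of _ "pts M"]) (use P x(1) in \<open>simp_all add: subtopology_topspace\<close>)
    from smooth_in_compose[OF this p f]
    show "smooth_in (mtop M) (snd c) (snd c' \<circ> \<Phi> g) x" by (simp add: o_def)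
  qed
qed

section \<open>Descent of a flow along a submersion\<close>

text \<open>The section of the coordinate representation, transported by charts. Surjectivity of the
  tangent map is exactly the surjectivity required of the derivative of the representing function on
  the model space.\<close>

lemma submersion_local_section:
  assumes S: "smooth_manifold S" and Q: "smooth_manifold Q" and \<pi>: "smooth_submersion S Q \<pi>"
    and x: "x \<in> pts S"
  obtains B s where "openin (mtop Q) B" "\<pi> x \<in> B" "s (\<pi> x) = x"
    "continuous_map (subtopology (mtop Q) B) (mtop S) s" "\<And>q. q \<in> B \<Longrightarrow> \<pi> (s q) = q"
    "smooth_in (mtop Q) (snd (chart_at Q (\<pi> x))) (snd (chart_at S x) \<circ> s) (\<pi> x)"
proof -
  define c where "c = chart_at S x"
  define c' where "c' = chart_at Q (\<pi> x)"
  have sm: "smooth_map S Q \<pi>" and onto: "tmap S Q \<pi> x ` mspace S = mspace Q"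
    using \<pi> x unfolding smooth_submersion_def by blast+
  note \<pi>D = smooth_mapD[OF S Q sm]
  have c: "c \<in> atlas S" "x \<in> fst c" and c': "c' \<in> atlas Q" "\<pi> x \<in> fst c'"
    using smooth_manifold_facts(5)[OF S x] smooth_manifold_facts(5)[OF Q \<pi>D(2)[OF x]]
    by (auto simp: c_def c'_def)
  note ch = smooth_manifold_facts(1)[OF S c(1)] and ch' = smooth_manifold_facts(1)[OF Q c'(1)]
  note fc = is_chart_facts[OF ch] and fc' = is_chart_facts[OF ch']
  obtain U g A0 where g: "open U" "\<And>n. Ck_on n U g" "openin (mtop S) A0" "x \<in> A0" "snd c ` A0 \<subseteq> U"
      "\<And>y. y \<in> A0 \<Longrightarrow> (snd c' \<circ> \<pi>) y = g (snd c y)"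
    using \<pi>D(4)[OF c(1) c'(1) c(2) c'(2)] by (rule smooth_inE) blast
  define A where "A = A0 \<inter> fst c \<inter> {y \<in> pts S. \<pi> y \<in> fst c'}"
  have A: "openin (mtop S) A" "x \<in> A" "A \<subseteq> A0" "A \<subseteq> fst c" "\<And>y. y \<in> A \<Longrightarrow> \<pi> y \<in> fst c'"
    using g(3,4) fc(1) c(2) c'(2) x openin_continuous_map_preimage[OF \<pi>D(1) fc'(1)] by (auto simp: A_def)
  obtain W where W: "open W" "snd c ` A = mspace S \<inter> W" using fc(5)[OF A(1,4)] openin_open by blast
  have cx: "snd c x \<in> mspace S" "snd c x \<in> W" using W(2) A(2) by blast+
  \<comment> \<open>Every model point in \<open>U \<inter> W\<close> is the coordinate of a point of
    \<open>A\<close>, so the values of \<open>\<sigma>\<close> can be carried back to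
    \<open>S\<close> by \<open>cinv c\<close>.\<close>
  have mem: "\<exists>y\<in>A. snd c y = p" if "p \<in> U \<inter> W" "p \<in> mspace S" for p
  proof -
    have "p \<in> snd c ` A" using that W(2) by blast
    then show ?thesis by blast
  qed
  have chQ: "snd c' q \<in> mspace Q" if "q \<in> fst c'" for q
    using openin_subset[OF fc'(5)[OF fc'(1) order_refl]] that by auto
  have "mspace Q \<subseteq> frechet_derivative g (at (snd c x)) ` mspace S"
  proof
    fix w assume "w \<in> mspace Q"
    then obtain v where v: "v \<in> mspace S" "w = tmap S Q \<pi> x v" using onto by blast
    have "dfun S (snd c' \<circ> \<pi>) x v = frechet_derivative g (at (snd (chart_at S x) x)) v"
      by (rule dfun_eq_frechet[OF S x v(1) g(2) g(3,4)]) (use g(5,6) in \<open>auto simp: c_def\<close>)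
    then show "w \<in> frechet_derivative g (at (snd c x)) ` mspace S"
      using v by (simp add: tmap_def c'_def c_def)
  qed
  moreover have "g p \<in> mspace Q" if p: "p \<in> U \<inter> W" "p \<in> mspace S" for p
  proof -
    obtain y where y: "y \<in> A" "snd c y = p" using mem[OF p] by blast
    then have "g p = snd c' (\<pi> y)" using g(6)[of y] A(3) by auto
    then show ?thesis using chQ A(5)[OF y(1)] by simp
  qed
  moreover have "open (U \<inter> W)" "snd c x \<in> U \<inter> W" using g W cx by auto
  moreover have "Ck_on n (U \<inter> W) g" for n by (rule Ck_on_subset[OF g(2)]) blast
  ultimately obtain T \<sigma> where \<sigma>: "open T" "g (snd c x) \<in> T" "\<And>n. Ck_on n T \<sigma>" "\<sigma> ` T \<subseteq> U \<inter> W \<inter> mspace S"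
      "\<sigma> (g (snd c x)) = snd c x" "\<And>q. q \<in> T \<Longrightarrow> q \<in> mspace Q \<Longrightarrow> g (\<sigma> q) = q"
    using smooth_local_section[of "U \<inter> W" "snd c x" g "mspace S" "mspace Q"]
      smooth_manifold_facts(3)[OF S] smooth_manifold_facts(3)[OF Q] cx(1) by blast
  define B where "B = {q \<in> fst c'. snd c' q \<in> T}"
  define s where "s q = cinv c (\<sigma> (snd c' q))" for q
  have gx: "g (snd c x) = snd c' (\<pi> x)" using g(6)[OF g(4)] by simp
  have sB: "s q \<in> A \<and> snd c (s q) = \<sigma> (snd c' q) \<and> \<pi> (s q) = q" if q: "q \<in> B" for q
  proof -
    have qT: "snd c' q \<in> T" "q \<in> fst c'" using q by (auto simp: B_def)
    have "\<sigma> (snd c' q) \<in> U \<inter> W" "\<sigma> (snd c' q) \<in> mspace S" using \<sigma>(4) qT(1) by auto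
    then obtain y where y: "y \<in> A" "snd c y = \<sigma> (snd c' q)" using mem by blast
    have sy: "s q = y"
      unfolding s_def y(2)[symmetric] using A(4) y(1) fc(2) by (auto intro: inv_into_f_f)
    have "snd c' (\<pi> y) = g (\<sigma> (snd c' q))" using g(6)[of y] y A(3) by auto
    also have "\<dots> = snd c' q" using \<sigma>(6)[OF qT(1) chQ[OF qT(2)]] .
    finally have "\<pi> y = q" using inj_onD[OF fc'(2)] A(5)[OF y(1)] qT(2) by blast
    then show ?thesis using sy y by simp
  qed
  show thesis
  proof (rule that[of B s])
    show oB: "openin (mtop Q) B" unfolding B_def by (rule chart_preimage_open[OF ch' \<sigma>(1)])
    show xB: "\<pi> x \<in> B" using c'(2) \<sigma>(2) gx by (simp add: B_def)
    show "s (\<pi> x) = x" using \<sigma>(5) fc(2) c(2) unfolding s_def gx by simp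
    show "\<pi> (s q) = q" if "q \<in> B" for q using sB[OF that] by blast
    have "smooth_in (mtop Q) (snd c') (snd c \<circ> s) (\<pi> x)"
      unfolding smooth_in_def
      by (rule exI[of _ T], rule exI[of _ \<sigma>], rule exI[of _ B])
        (use \<sigma>(1,3) oB xB sB in \<open>auto simp: B_def\<close>)
    then show "smooth_in (mtop Q) (snd (chart_at Q (\<pi> x))) (snd (chart_at S x) \<circ> s) (\<pi> x)"
      by (simp add: c_def c'_def)
    show "continuous_map (subtopology (mtop Q) B) (mtop S) s"
    proof -
      have "continuous_map (subtopology (mtop Q) B) euclidean (snd c')"
        by (rule continuous_map_from_subtopology_mono[OF fc'(3)]) (auto simp: B_def)
      then have 1: "continuous_map (subtopology (mtop Q) B) (top_of_set T) (snd c')"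
        by (auto simp: continuous_map_in_subtopology B_def)
      have "continuous_map (top_of_set T) euclidean \<sigma>"
        using \<sigma>(3)[of 0] by simp
      with 1 have "continuous_map (subtopology (mtop Q) B) euclidean (\<sigma> \<circ> snd c')"
        by (rule continuous_map_compose)
      moreover have "(\<sigma> \<circ> snd c') q \<in> snd c ` fst c" if "q \<in> B" for q
      proof -
        have "s q \<in> fst c" "\<sigma> (snd c' q) = snd c (s q)" using sB[OF that] A(4) by auto
        then show ?thesis by simp
      qed
      ultimately have "continuous_map (subtopology (mtop Q) B) (top_of_set (snd c ` fst c)) (\<sigma> \<circ> snd c')"
        by (auto simp: continuous_map_in_subtopology)
      from continuous_map_compose[OF this fc(4)]
      have "continuous_map (subtopology (mtop Q) B) (subtopology (mtop S) (fst c)) s"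
        by (simp add: s_def[abs_def] o_def)
      then show ?thesis using continuous_map_in_subtopology by blast
    qed
  qed
qed

text \<open>\<open>compat\<close> says that \<open>D\<close> is a union of parts of fibres saturated
  at each time, and that \<open>F\<close> maps points of one fibre into one fibre. Locally the
  descended map is \<open>\<pi>\<close> after \<open>F\<close> after a smooth section, applied at
  fixed time; openness of its domain and smoothness both come from this formula.\<close>

lemma flow_descends:
  assumes S: "smooth_manifold S" and Q: "smooth_manifold Q"
    and \<pi>: "smooth_submersion S Q \<pi>" and onto: "\<pi> ` pts S = pts Q" and F: "flow S D F"
    and compat: "\<And>t x y. (t, x) \<in> D \<Longrightarrow> y \<in> pts S \<Longrightarrow> \<pi> y = \<pi> x \<Longrightarrow>
      (t, y) \<in> D \<and> \<pi> (F (t, y)) = \<pi> (F (t, x))"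
  defines "DQ \<equiv> (\<lambda>(t, x). (t, \<pi> x)) ` D"
  shows "\<exists>!\<K>. \<K> \<in> extensional DQ \<and> flow Q DQ \<K> \<and> (\<forall>(t, x)\<in>D. \<pi> (F (t, x)) = \<K> (t, \<pi> x))"
proof -
  let ?TS = "prod_topology euclideanreal (mtop S)" and ?TQ = "prod_topology euclideanreal (mtop Q)"
  have sm: "smooth_map S Q \<pi>" using \<pi> unfolding smooth_submersion_def by blast
  note \<pi>D = smooth_mapD[OF S Q sm]
  note FD = time_mapD[OF S S flowD(1)[OF F]]
  have DS: "x \<in> pts S" "F (t, x) \<in> pts S" if "(t, x) \<in> D" for t x
  proof -
    have "(t, x) \<in> topspace ?TS" using openin_subset[OF FD(1)] that by blast
    then show "x \<in> pts S" by simp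
    have "(t, x) \<in> topspace (subtopology ?TS D)" using \<open>(t, x) \<in> topspace ?TS\<close> that by simp
    then show "F (t, x) \<in> pts S" using continuous_map_image_subset_topspace[OF FD(2)] by blast
  qed
  have DQ: "(t, q) \<in> DQ \<longleftrightarrow> (\<exists>x. (t, x) \<in> D \<and> \<pi> x = q)" for t q unfolding DQ_def by force
  have lift: "(t, x) \<in> D" if "(t, \<pi> x) \<in> DQ" "x \<in> pts S" for t x
    using that compat unfolding DQ by metis
  \<comment> \<open>The choice of a representative is immaterial by \<open>compat\<close>;
    \<open>restrict\<close> makes the map extensional.\<close>
  define \<K> where "\<K> = restrict (\<lambda>(t, q). \<pi> (F (t, SOME x. x \<in> pts S \<and> \<pi> x = q))) DQ"
  have \<K>: "\<K> (t, \<pi> x) = \<pi> (F (t, x))" if tx: "(t, x) \<in> D" for t x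
  proof -
    let ?y = "SOME y. y \<in> pts S \<and> \<pi> y = \<pi> x"
    have y: "?y \<in> pts S \<and> \<pi> ?y = \<pi> x" by (rule someI[of _ x]) (use DS(1)[OF tx] in simp)
    have "(t, \<pi> x) \<in> DQ" using tx DQ by blast
    then have "\<K> (t, \<pi> x) = \<pi> (F (t, ?y))" by (simp add: \<K>_def)
    also have "\<dots> = \<pi> (F (t, x))" using compat[OF tx, of ?y] y by blast
    finally show ?thesis .
  qed
  have local: "\<exists>A. openin ?TQ A \<and> (t, q) \<in> A \<and> A \<subseteq> DQ \<and> continuous_germ ?TQ (mtop Q) \<K> (t, q) \<and>
      (\<forall>c\<in>atlas Q. \<forall>c'\<in>atlas Q. q \<in> fst c \<longrightarrow> \<K> (t, q) \<in> fst c' \<longrightarrow>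
        smooth_in ?TQ (map_prod (\<lambda>t. t) (snd c)) (snd c' \<circ> \<K>) (t, q))"
    if tq: "(t, q) \<in> DQ" for t q
  proof -
    obtain x where x: "(t, x) \<in> D" "\<pi> x = q" using tq DQ by blast
    note xS = DS(1)[OF x(1)]
    obtain B s where s: "openin (mtop Q) B" "\<pi> x \<in> B" "s (\<pi> x) = x"
        "continuous_map (subtopology (mtop Q) B) (mtop S) s" "\<And>q. q \<in> B \<Longrightarrow> \<pi> (s q) = q"
        "smooth_in (mtop Q) (snd (chart_at Q (\<pi> x))) (snd (chart_at S x) \<circ> s) (\<pi> x)"
      using submersion_local_section[OF S Q \<pi> xS] by blast
    have qB: "q \<in> B" "s q = x" using s(2,3) x(2) by auto
    let ?G = "map_prod (\<lambda>t. t) s"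
    have oB: "openin ?TQ (UNIV \<times> B)" using s(1) by (simp add: openin_prod_Times_iff)
    have "continuous_map (prod_topology euclideanreal (subtopology (mtop Q) B)) ?TS (\<lambda>z. (fst z, s (snd z)))"
      by (intro continuous_map_pairedI continuous_map_fst
          continuous_map_compose[OF continuous_map_snd s(4), unfolded o_def])
    then have G: "continuous_map (subtopology ?TQ (UNIV \<times> B)) ?TS ?G"
      using subtopology_Times[of euclideanreal "mtop Q" UNIV B]
      by (simp add: map_prod_def case_prod_unfold)
    \<comment> \<open>The preimage of \<open>D\<close> under the section at fixed time is an open
      neighbourhood of \<open>(t, q)\<close>. It lies in \<open>DQ\<close>, and on it
      \<open>\<K>\<close> equals \<open>\<pi> \<circ> F \<circ> ?G\<close>.\<close>
    let ?A = "{z \<in> topspace (subtopology ?TQ (UNIV \<times> B)). ?G z \<in> D}"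
    have oA: "openin ?TQ ?A"
      by (rule openin_trans_full[OF openin_continuous_map_preimage[OF G FD(1)] oB])
    have tqA: "(t, q) \<in> ?A" using qB x(1) openin_subset[OF s(1)] by auto
    have A: "z \<in> DQ \<and> (\<pi> \<circ> F \<circ> ?G) z = \<K> z" if "z \<in> ?A" for z
    proof -
      obtain r p where z: "z = (r, p)" by (cases z)
      have p: "p \<in> B" "(r, s p) \<in> D" using that z by auto
      then show ?thesis using \<K>[OF p(2)] s(5)[OF p(1)] DQ[of r p] unfolding z by auto
    qed
    have germG: "continuous_germ ?TQ ?TS ?G (t, q)"
      by (rule continuous_germI[OF G oB]) (use qB in simp)
    have germF: "continuous_germ ?TS (mtop S) F (t, x)" by (rule continuous_germI[OF FD(2,1) x(1)])
    have FG: "?G (t, q) = (t, x)" using qB by simp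
    have germ: "continuous_germ ?TQ (mtop Q) \<K> (t, q)"
    proof (rule continuous_germ_cong[OF _ oA tqA])
      show "continuous_germ ?TQ (mtop Q) (\<pi> \<circ> F \<circ> ?G) (t, q)"
        unfolding comp_assoc
        using continuous_germ_compose[OF continuous_germ_compose[OF germG germF[folded FG]]]
          \<pi>D(3)[OF DS(2)[OF x(1)]] FG by simp
    qed (use A in blast)
    have "smooth_in ?TQ (map_prod (\<lambda>t. t) (snd c)) (snd c' \<circ> \<K>) (t, q)"
      if c: "c \<in> atlas Q" "c' \<in> atlas Q" "q \<in> fst c" "\<K> (t, q) \<in> fst c'" for c c'
    proof -
      let ?cx = "chart_at S x" and ?d = "chart_at S (F (t, x))" and ?cq = "chart_at Q q"
      have cx: "?cx \<in> atlas S" "x \<in> fst ?cx" and d: "?d \<in> atlas S" "F (t, x) \<in> fst ?d"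
        using smooth_manifold_facts(5)[OF S xS] smooth_manifold_facts(5)[OF S DS(2)[OF x(1)]] by auto
      have "q \<in> pts Q" using \<pi>D(2)[OF xS] x(2) by simp
      then have cq: "?cq \<in> atlas Q" "q \<in> fst ?cq" using smooth_manifold_facts(5)[OF Q] by auto
      note mS = subsetD[OF atlas_subset_max_atlas[OF S]] and mQ = subsetD[OF atlas_subset_max_atlas[OF Q]]
      \<comment> \<open>Smoothness of the section is known in the preferred charts, so the given
        chart \<open>c\<close> is first exchanged for \<open>?cq\<close>.\<close>
      have "smooth_in (mtop Q) (snd c) (snd ?cq) q"
        by (rule max_atlas_change[OF Q mQ[OF c(1)] mQ[OF cq(1)] c(3) cq(2)])
      moreover have "smooth_in (mtop Q) (snd ?cq) (snd ?cx \<circ> s) q" using s(6) x(2) by simp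
      ultimately have "smooth_in (mtop Q) (snd c) (snd ?cx \<circ> s) q" by (rule smooth_in_trans)
      from smooth_in_map_prod[OF this, of t]
      have 1: "smooth_in ?TQ (map_prod (\<lambda>t. t) (snd c)) (map_prod (\<lambda>t. t) (snd ?cx) \<circ> ?G) (t, q)"
        by (simp add: map_prod_def o_def case_prod_unfold)
      have 2: "smooth_in ?TS (map_prod (\<lambda>t. t) (snd ?cx)) (snd ?d \<circ> F) (t, x)"
        by (rule time_map_smooth_in[OF S S flowD(1)[OF F] x(1) mS[OF cx(1)] cx(2) mS[OF d(1)] d(2)])
      have "\<pi> (F (t, x)) \<in> fst c'" using c(4) \<K>[OF x(1)] x(2) by simp
      then have 3: "smooth_in (mtop S) (snd ?d) (snd c' \<circ> \<pi>) (F (t, x))"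
        by (rule \<pi>D(4)[OF d(1) c(2) d(2)])
      have "smooth_in ?TQ (map_prod (\<lambda>t. t) (snd c)) (snd c' \<circ> \<pi> \<circ> F \<circ> ?G) (t, q)"
      proof (rule smooth_in_compose[OF germG 1])
        show "smooth_in ?TS (map_prod (\<lambda>t. t) (snd ?cx)) (snd c' \<circ> \<pi> \<circ> F) (?G (t, q))"
          unfolding FG by (rule smooth_in_compose[OF germF 2 3])
      qed
      then show ?thesis
      proof (rule smooth_in_cong[OF _ oA tqA])
        fix z assume "z \<in> ?A"
        then have "(\<pi> \<circ> F \<circ> ?G) z = \<K> z" using A by blast
        then show "(snd c' \<circ> \<pi> \<circ> F \<circ> ?G) z = (snd c' \<circ> \<K>) z" by simp
      qed
    qed
    moreover have "?A \<subseteq> DQ" using A by blast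
    ultimately show ?thesis using oA tqA germ by (intro exI[of _ ?A] conjI ballI impI) simp_all
  qed
  have oDQ: "openin ?TQ DQ"
  proof (subst openin_subopen, rule ballI)
    fix z assume "z \<in> DQ"
    moreover obtain t q where z: "z = (t, q)" by (cases z)
    ultimately have "(t, q) \<in> DQ" by simp
    from local[OF this] show "\<exists>A. openin ?TQ A \<and> z \<in> A \<and> A \<subseteq> DQ"
      unfolding z by (elim exE conjE) (intro exI conjI)
  qed
  have flowK: "flow Q DQ \<K>"
    unfolding flow_def
  proof (intro conjI ballI allI impI)
    show "smooth_map_on DQ (prod_mfd real_mfd Q) Q \<K>"
      unfolding time_map_iff[OF Q Q]
    proof (intro conjI ballI)
      show "continuous_map (subtopology ?TQ DQ) (mtop Q) \<K>"
      proof (rule continuous_map_germI)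
        fix z assume "z \<in> topspace (subtopology ?TQ DQ)"
        then obtain t q where z: "z = (t, q)" "(t, q) \<in> DQ" by (cases z) auto
        then obtain x where x: "(t, x) \<in> D" "\<pi> x = q" using DQ by blast
        show "\<K> z \<in> pts Q" unfolding z x(2)[symmetric] \<K>[OF x(1)] using DS(2)[OF x(1)] \<pi>D(2) by blast
        show "continuous_germ (subtopology ?TQ DQ) (mtop Q) \<K> z"
          unfolding z(1) using local[OF z(2)] z(2) by (elim exE conjE) (rule continuous_germ_from_subtopology)
      qed
      fix c c' z assume c: "c \<in> atlas Q" "c' \<in> atlas Q" and "z \<in> DQ"
      moreover obtain t q where z: "z = (t, q)" by (cases z)
      ultimately have "(t, q) \<in> DQ" by simp
      from local[OF this] c show "case z of (t, x) \<Rightarrow> x \<in> fst c \<longrightarrow> \<K> (t, x) \<in> fst c' \<longrightarrow>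
          smooth_in ?TQ (map_prod (\<lambda>t. t) (snd c)) (snd c' \<circ> \<K>) (t, x)"
        unfolding z by (elim exE conjE) simp
    qed (rule oDQ)
    fix q assume "q \<in> pts Q"
    then have "q \<in> \<pi> ` pts S" using onto by simp
    then obtain x where x: "x \<in> pts S" "\<pi> x = q" by blast
    \<comment> \<open>By saturation the admissible times of \<open>q\<close> are those of any one
      representative, so the interval property is inherited.\<close>
    have "(t, q) \<in> DQ \<longleftrightarrow> (t, x) \<in> D" for t
      using lift[of t x] DQ[of t "\<pi> x"] x(1) unfolding x(2)[symmetric] by blast
    then show "is_interval {t. (t, q) \<in> DQ}" using flowD(2)[OF F x(1)] by simp
    show "(0, q) \<in> DQ" using flowD(3)[OF F x(1)] x(2) DQ[of 0 q] by blast
    show "\<K> (0, q) = q" using \<K>[OF flowD(3)[OF F x(1)]] flowD(4)[OF F x(1)] x(2) by simp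
  next
    fix s t q assume st: "(s, q) \<in> DQ \<and> (t, \<K> (s, q)) \<in> DQ \<and> (t + s, q) \<in> DQ"
    then obtain x where x: "(s, x) \<in> D" "\<pi> x = q" using DQ[of s q] by blast
    have Fx: "F (s, x) \<in> pts S" "x \<in> pts S" using DS[OF x(1)] by simp_all
    have 1: "\<K> (s, q) = \<pi> (F (s, x))" using \<K>[OF x(1)] x(2) by simp
    have 2: "(t, F (s, x)) \<in> D" using lift[OF _ Fx(1)] st 1 by simp
    have 3: "(t + s, x) \<in> D" using lift[OF _ Fx(2)] st x(2) by simp
    show "\<K> (t, \<K> (s, q)) = \<K> (t + s, q)"
      using \<K>[OF 2] \<K>[OF 3] flowD(5)[OF F x(1) 2 3] 1 x(2) by simp
  qed
  have ext: "\<K> \<in> extensional DQ" by (simp add: \<K>_def)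
  have comm: "\<forall>(t, x)\<in>D. \<pi> (F (t, x)) = \<K> (t, \<pi> x)" using \<K> by auto
  \<comment> \<open>Every point of \<open>DQ\<close> has the form \<open>(t, \<pi> x)\<close> with
    \<open>(t, x)\<close> in \<open>D\<close>, so the intertwining relation prescribes all values
    there.\<close>
  have uniq: "\<K>' = \<K>"
    if "\<K>' \<in> extensional DQ" "\<forall>(t, x)\<in>D. \<pi> (F (t, x)) = \<K>' (t, \<pi> x)" for \<K>'
  proof (rule extensionalityI[OF that(1) ext])
    fix z assume "z \<in> DQ"
    then obtain t x where "(t, x) \<in> D" "z = (t, \<pi> x)" unfolding DQ_def by auto
    then show "\<K>' z = \<K> z" using \<K> that(2) by auto
  qed
  show ?thesis
  proof (rule ex1I[of _ \<K>])
    show "\<K> \<in> extensional DQ \<and> flow Q DQ \<K> \<and> (\<forall>(t, x)\<in>D. \<pi> (F (t, x)) = \<K> (t, \<pi> x))"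
      using ext flowK comm by (intro conjI)
  qed (use uniq in simp)
qed

section \<open>Orbits and the reduced flow\<close>

lemma (in group_action) orbit_element_image:
  assumes g: "g \<in> carrier G" and x: "x \<in> E"
  shows "orbit G \<phi> (\<phi> g x) = orbit G \<phi> x"
proof -
  have gx: "\<phi> g x \<in> E" "\<phi> g x \<in> orbit G \<phi> x"
    using element_image[OF g x] g by (auto simp: orbit_def)
  have sub: "orbit G \<phi> z \<subseteq> E" if "z \<in> E" for z
    using element_image that unfolding orbit_def by blast
  show ?thesis
  proof
    show "orbit G \<phi> (\<phi> g x) \<subseteq> orbit G \<phi> x"
      using orbit_trans[OF x gx(1) _ gx(2)] sub[OF gx(1)] by blast
    show "orbit G \<phi> x \<subseteq> orbit G \<phi> (\<phi> g x)"
      using orbit_trans[OF gx(1) x _ orbit_sym[OF x gx]] sub[OF x] by blast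
  qed
qed

text \<open>Each component of the Hamiltonian k-vector field is treated on its own. Tangency yields
  the flow on \<open>N\<close>, and invariance under \<open>K\<close> yields the saturation
  hypothesis of \<open>flow_descends\<close>.\<close>

theorem reduced_flow:
  assumes act: "lie_group_action G MG M \<Phi>" and K: "subgroup K G"
    and N: "submanifold M N" and Q: "quotientable G M \<Phi> K N Q"
    and X: "vector_field M X" and F: "flow_of M X D F"
    and pres: "\<And>g x. g \<in> K \<Longrightarrow> x \<in> pts M \<Longrightarrow> tmap M M (\<Phi> g) x (X x) = X (\<Phi> g x)"
    and tangent: "\<And>x. x \<in> N \<Longrightarrow> X x \<in> tangent_sub M N x"
  defines "\<pi> \<equiv> orbit_of G K \<Phi>" and "DN \<equiv> flow_domain_in N D F"
  shows "flow (submfd M N) DN F"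
    and "\<exists>!\<K>. \<K> \<in> extensional ((\<lambda>(t, x). (t, \<pi> x)) ` DN) \<and> flow Q ((\<lambda>(t, x). (t, \<pi> x)) ` DN) \<K> \<and>
      (\<forall>(t, x)\<in>DN. \<pi> (F (t, x)) = \<K> (t, \<pi> x))"
proof -
  have M: "smooth_manifold M" and ga: "group_action G (pts M) \<Phi>"
    using act unfolding lie_group_action_def by simp_all
  note gaK = group_action.induced_action[OF ga K]
  have NM: "N \<subseteq> pts M" using N unfolding submanifold_def by (rule conjunct1)
  have Q': "\<And>g. g \<in> K \<Longrightarrow> \<Phi> g ` N \<subseteq> N" "smooth_manifold Q" "pts Q = orbits (G\<lparr>carrier := K\<rparr>) N \<Phi>"
      "smooth_submersion (submfd M N) Q \<pi>"
    using Q unfolding quotientable_def \<pi>_def by simp_all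
  have ptsS: "pts (submfd M N) = N" using NM by (auto simp: submfd_simps(1))
  show fl: "flow (submfd M N) DN F"
    unfolding DN_def by (rule flow_submfd[OF M X N tangent F])
  show "\<exists>!\<K>. \<K> \<in> extensional ((\<lambda>(t, x). (t, \<pi> x)) ` DN) \<and> flow Q ((\<lambda>(t, x). (t, \<pi> x)) ` DN) \<K> \<and>
      (\<forall>(t, x)\<in>DN. \<pi> (F (t, x)) = \<K> (t, \<pi> x))"
  proof (rule flow_descends[OF smooth_manifold_submfd[OF M N] Q'(2,4) _ fl])
    show "\<pi> ` pts (submfd M N) = pts Q"
      unfolding ptsS Q'(3) orbits_def \<pi>_def by blast
    fix t x y assume tx: "(t, x) \<in> DN" and y: "y \<in> pts (submfd M N)" "\<pi> y = \<pi> x"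
    have x: "x \<in> N" "F (t, x) \<in> N" using tx by (auto simp: DN_def flow_domain_in_def)
    have "y \<in> pts M" using y(1) ptsS NM by blast
    \<comment> \<open>Fibres of the projection are orbits, so equality of projections produces a
      group element carrying \<open>x\<close> to \<open>y\<close>, to which equivariance
      applies.\<close>
    then have "y \<in> orbit_of G K \<Phi> x"
      using group_action.orbit_refl[OF gaK] y(2) unfolding \<pi>_def by blast
    then obtain g where g: "g \<in> K" "y = \<Phi> g x" unfolding orbit_def by auto
    have gG: "g \<in> carrier G" using g(1) subgroup.subset[OF K] by blast
    have "\<forall>x\<in>pts M. tmap M M (\<Phi> g) x (X x) = X (\<Phi> g x)" using pres[OF g(1)] by blast
    note eqv = flow_domain_in_equivariant[OF M X smooth_map_action[OF act gG] this F NM Q'(1)[OF g(1)] tx[unfolded DN_def]]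
    have "\<pi> (\<Phi> g (F (t, x))) = \<pi> (F (t, x))"
      using group_action.orbit_element_image[OF gaK, of g "F (t, x)"] g(1) x(2) NM unfolding \<pi>_def by auto
    then show "(t, y) \<in> DN \<and> \<pi> (F (t, y)) = \<pi> (F (t, x))"
      using eqv unfolding g(2) DN_def by simp
  qed
qed

theorem theorem4p16:
  fixes M :: "('m, 'e::euclidean_space) mfd"
    and \<eta> :: "'k::finite \<Rightarrow> 'm \<Rightarrow> 'e \<Rightarrow> real"
    and R :: "'k \<Rightarrow> 'm \<Rightarrow> 'e"
    and G :: "'g monoid" and MG :: "('g, 'l::euclidean_space) mfd"
    and \<Phi> :: "'g \<Rightarrow> 'm \<Rightarrow> 'm"
    and J :: "'k \<Rightarrow> 'm \<Rightarrow> 'l \<Rightarrow> real" and \<mu> :: "'k \<Rightarrow> 'l \<Rightarrow> real"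
    and K :: "'g set" and MK :: "('g, 'l) mfd"
    and K' :: "'k \<Rightarrow> 'g set" and MK' :: "'k \<Rightarrow> ('g, 'l) mfd"
    and N :: "'m set" and Q :: "('m set, 'q::euclidean_space) mfd"
    and h :: "'m \<Rightarrow> real" and X :: "'k \<Rightarrow> 'm \<Rightarrow> 'e"
    and D :: "'k \<Rightarrow> (real \<times> 'm) set" and F :: "'k \<Rightarrow> real \<times> 'm \<Rightarrow> 'm"
    and \<pi> :: "'m \<Rightarrow> 'm set"
  defines "N \<equiv> k_ray_preimage M J \<mu>"
    and "\<pi> \<equiv> orbit_of G K \<Phi>"
  assumes "k_contact M \<eta>"
    and "reeb_fields M \<eta> R"
    and "k_contact_action G MG M \<eta> \<Phi>"
    and "momentum_map G MG M \<eta> \<Phi> J"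
    and "\<And>\<alpha>. \<mu> \<alpha> \<in> dual (lie_algebra G MG)"
    and "weak_regular_k_value G MG M J \<mu>"
    and "ray_preimages_regular G MG M J \<mu>"
    and "connected_lie_subgroup G MG K MK (\<Inter>\<alpha>. k_ray G MG (\<mu> \<alpha>))"
    and "\<And>\<alpha>. connected_lie_subgroup G MG (K' \<alpha>) (MK' \<alpha>) (k_ray G MG (\<mu> \<alpha>))"
    and "quotientable G M \<Phi> K N Q"
    and "\<And>x \<alpha>. x \<in> N \<Longrightarrow>
       tangent_sub M (ray_preimage M J \<mu> \<alpha>) x =
         ker_form M (\<eta> \<alpha>) x \<inter> ker_d M (\<eta> \<alpha>) x + tangent_sub M N x
           + tangent_orbit G M \<Phi> (K' \<alpha>) (MK' \<alpha>) x"
    and "\<And>x. x \<in> N \<Longrightarrow>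
       tangent_orbit G M \<Phi> K MK x =
         (\<Inter>\<alpha>. (ker_form M (\<eta> \<alpha>) x \<inter> ker_d M (\<eta> \<alpha>) x)
                  + tangent_orbit G M \<Phi> (K' \<alpha>) (MK' \<alpha>) x) \<inter> tangent_sub M N x"
    and "smooth_function M h"
    and "\<And>g x. g \<in> carrier G \<Longrightarrow> x \<in> pts M \<Longrightarrow> h (\<Phi> g x) = h x"
    and "hamiltonian_k_field M \<eta> R h X"
    and "\<And>g \<alpha> x. g \<in> K \<Longrightarrow> x \<in> pts M \<Longrightarrow> tmap M M (\<Phi> g) x (X \<alpha> x) = X \<alpha> (\<Phi> g x)"
    and "\<And>\<alpha> x. x \<in> N \<Longrightarrow> X \<alpha> x \<in> tangent_sub M N x"
    and "\<And>\<alpha>. flow_of M (X \<alpha>) (D \<alpha>) (F \<alpha>)"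
  shows "\<forall>\<alpha>. let DN = flow_domain_in N (D \<alpha>) (F \<alpha>); DQ = (\<lambda>(t, x). (t, \<pi> x)) ` DN in
     flow (submfd M N) DN (F \<alpha>) \<and>
     (\<exists>!\<K>. \<K> \<in> extensional DQ \<and> flow Q DQ \<K> \<and> (\<forall>(t, x)\<in>DN. \<pi> (F \<alpha> (t, x)) = \<K> (t, \<pi> x)))"
proof (rule allI)
  fix \<alpha>
  have act: "lie_group_action G MG M \<Phi>" using \<open>k_contact_action G MG M \<eta> \<Phi>\<close> unfolding k_contact_action_def by simp
  have K: "subgroup K G"
    using \<open>connected_lie_subgroup G MG K MK (\<Inter>\<alpha>. k_ray G MG (\<mu> \<alpha>))\<close> unfolding connected_lie_subgroup_def by simp
  have N: "submanifold M N"
    using \<open>ray_preimages_regular G MG M J \<mu>\<close> unfolding ray_preimages_regular_def N_def by simp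
  have X: "vector_field M (X \<alpha>)"
    using \<open>hamiltonian_k_field M \<eta> R h X\<close> unfolding hamiltonian_k_field_def by simp
  note red = reduced_flow[OF act K N \<open>quotientable G M \<Phi> K N Q\<close> X
      \<open>\<And>\<alpha>. flow_of M (X \<alpha>) (D \<alpha>) (F \<alpha>)\<close>
      \<open>\<And>g \<alpha> x. g \<in> K \<Longrightarrow> x \<in> pts M \<Longrightarrow> tmap M M (\<Phi> g) x (X \<alpha> x) = X \<alpha> (\<Phi> g x)\<close>
      \<open>\<And>\<alpha> x. x \<in> N \<Longrightarrow> X \<alpha> x \<in> tangent_sub M N x\<close>]
  show "let DN = flow_domain_in N (D \<alpha>) (F \<alpha>); DQ = (\<lambda>(t, x). (t, \<pi> x)) ` DN in
     flow (submfd M N) DN (F \<alpha>) \<and>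
     (\<exists>!\<K>. \<K> \<in> extensional DQ \<and> flow Q DQ \<K> \<and> (\<forall>(t, x)\<in>DN. \<pi> (F \<alpha> (t, x)) = \<K> (t, \<pi> x)))"
    unfolding Let_def \<pi>_def by (intro conjI red)
qed

end
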